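(* Let $i\in\{1,2,3,4\}$ and consider the map $F_i$, with $a>1$ if $i\in\{1,2,3\}$ and $a<-1$ if $i=4$, and with $b=b^*(a)$. Then the Lyapunov exponent of $\varphi_\infty$ is $-\infty$.
   Context: Maps. $\mathbb T=\mathbb R/2\pi\mathbb Z$, $\omega\notin 2\pi\mathbb Q$, and $g:\mathbb T\to\mathbb R$ is of class $C^{1+\tau}$ for some $\tau>0$. For $i=1,2,3,4$, $F_i:\mathbb R\times\mathbb T\to\mathbb R\times\mathbb T$ is $F_i(x,\theta)=(h_i(x)+\sigma_i b\,g(\theta),\ \theta+\omega)$ with $\sigma_1=\sigma_4=-1$, $\sigma_2=\sigma_3=1$, and - $h_1(x)=-\frac{\pi}{2}$ if $x<-\frac{\pi}{2a}$, $h_1(x)=ax$ if $|x|\le\frac{\pi}{2a}$, $h_1(x)=\frac{\pi}{2}$ if $x>\frac{\pi}{2a}$; - $h_2(x)=a(x+\delta)$ if $x<-\delta$, $h_2(x)=0$ if $|x|\le\delta$, $h_2(x)=a(x-\delta)$ if $x>\delta$ (here $\delta>0$ is fixed); - $h_3(x)=ax$ if $x>-\frac1a$, $h_3(x)=-1$ if $x\le-\frac1a$; - $h_4(x)=ax$ if $x>\frac1a$, $h_4(x)=1$ if $x\le\frac1a$. Put $\mathcal F_i(\varphi)(\theta)=h_i(\varphi(\theta-\omega))+\sigma_i b\,g(\theta-\omega)$ for $\varphi:\mathbb T\to\mathbb R$. Curves. $\mu_i$ is the continuous solution of: $\mu_1(\theta+\omega)=a\mu_1(\theta)-bg(\theta)$;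 $\mu_2(\theta+\omega)=a(\mu_2(\theta)-\delta)+bg(\theta)$; $\mu_3(\theta+\omega)=a\mu_3(\theta)+bg(\theta)$; $\mu_4(\theta+\omega)=a\mu_4(\theta)-bg(\theta)$. Also $\hat\mu_2$ is the continuous solution of $\hat\mu_2(\theta+\omega)=a(\hat\mu_2(\theta)+\delta)+bg(\theta)$ and $\tilde\gamma_1(\theta)=-\frac\pi2-bg(\theta-\omega)$. The initial curve $\varphi_0$ is: $\frac\pi2-bg(\theta-\omega)$ for $i=1$; $bg(\theta-\omega)$ for $i=2$; $-1+bg(\theta-\omega)$ for $i=3$; $1-bg(\theta-\omega)$ for $i=4$. For $n\ge0$, $\varphi_{n+1}=\mathcal F_i(\varphi_n)$ if $i=1,2,3$ and $\varphi_{n+1}=\mathcal F_4^2(\varphi_n)$ if $i=4$; $\varphi_\infty=\lim_n\varphi_n$ (pointwise). Put $\lambda_0=\varphi_0-\mu_i$ if $i=1,4$ and $\lambda_0=\mu_i-\varphi_0$ if $i=2,3$. Lyapunov exponent. It is $\frac1{2\pi}\int_{\mathbb T}\log\left|\frac{\partial f}{\partial x}(\varphi_\infty(\theta),\theta)\right|d\theta$, where $f(x,\theta)$ is the first component of $F_i(x,\theta)$ if $i=1,2,3$ and of $F_4^2(x,\theta)$ if $i=4$; thus $\frac{\partial f}{\partial x}=h_i'(x)$ for $i=1,2,3$ and $\frac{\partial f}{\partial x}=h_4'(h_4(x)-bg(\theta))\,h_4'(x)$ for $i=4$. At points where $h_i$ is not differentiable one sets $h_i'=a$, and $\log 0=-\infty$.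 Bifurcation value. $b^*(a)$ (assumed to exist) is the smallest $b>0$ for which the following graphs meet: for $i=1$, the graph of $\mu_1$ and the graph of $\varphi_0$ or of $\tilde\gamma_1$; for $i=2$, the graph of $\varphi_0$ and the graph of $\mu_2$ or of $\hat\mu_2$; for $i=3,4$, the graphs of $\varphi_0$ and $\mu_i$. Standing assumptions at $b=b^*(a)$. The set $Z_{\lambda_0}=\{\theta\in\mathbb T\mid\lambda_0(\theta)=0\}$ is nonempty, and at least one of the following holds: (A) $g$ is analytic; (B) for every $\theta_0\in Z_{\lambda_0}$ there exist $\varepsilon>0$ and an even integer $m>0$ such that $\lambda_0(\theta)=(\theta-\theta_0)^m q(\theta)$ for $\theta\in(\theta_0-\varepsilon,\theta_0+\varepsilon)$, with $q>0$ on this interval.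
   Formalization: g is assumed non-constant (for constant g with Z_{λ_0} nonempty, φ_∞ sits at a corner of h_i where h_i'=a, so the exponent is finite), and the factor q in (B) is taken continuous, since otherwise infinitely flat zeros of λ_0 are allowed and the claim can fail. *)

theory Defs
  imports "HOL-Analysis.Analysis"
begin

text \<open>
  Functions on the circle of length \<open>2 * pi\<close> are rendered as \<open>2 * pi\<close>-periodic functions on the
  real line, and integrals over the circle as integrals over \<open>{0..<2 * pi}\<close>.
\<close>

definition periodic_2pi :: "(real \<Rightarrow> real) \<Rightarrow> bool" where
  "periodic_2pi u \<longleftrightarrow> (\<forall>\<theta>. u (\<theta> + 2 * pi) = u \<theta>)"

text \<open>
  Class \<open>C\<^sup>1\<^sup>+\<^sup>\<tau>\<close>, meant for \<open>0 < \<tau> \<le> 1\<close>.  For a periodic function the local and the global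
  Hoelder condition on the derivative agree.
\<close>

definition class_C1_plus :: "real \<Rightarrow> (real \<Rightarrow> real) \<Rightarrow> bool" where
  "class_C1_plus \<tau> u \<longleftrightarrow>
     (\<exists>u'. (\<forall>x. (u has_real_derivative u' x) (at x)) \<and>
           (\<exists>C. \<forall>x y. \<bar>u' x - u' y\<bar> \<le> C * \<bar>x - y\<bar> powr \<tau>))"

definition real_analytic :: "(real \<Rightarrow> real) \<Rightarrow> bool" where
  "real_analytic u \<longleftrightarrow>
     (\<forall>x0. \<exists>\<epsilon>>0. \<exists>c :: nat \<Rightarrow> real. \<forall>x. \<bar>x - x0\<bar> < \<epsilon> \<longrightarrow> (\<lambda>n. c n * (x - x0) ^ n) sums u x)"

datatype map_index = Map1 | Map2 | Map3 | Map4

text \<open>The parameter \<open>\<delta>\<close> only matters for the second map.\<close>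

fun h_map :: "map_index \<Rightarrow> real \<Rightarrow> real \<Rightarrow> real \<Rightarrow> real" where
  "h_map Map1 a \<delta> x =
     (if x < - (pi / (2 * a)) then - (pi / 2) else if x \<le> pi / (2 * a) then a * x else pi / 2)"
| "h_map Map2 a \<delta> x =
     (if x < - \<delta> then a * (x + \<delta>) else if x \<le> \<delta> then 0 else a * (x - \<delta>))"
| "h_map Map3 a \<delta> x = (if x > - (1 / a) then a * x else - 1)"
| "h_map Map4 a \<delta> x = (if x > 1 / a then a * x else 1)"

fun sigma :: "map_index \<Rightarrow> real" where
  "sigma Map1 = - 1"
| "sigma Map2 = 1"
| "sigma Map3 = 1"
| "sigma Map4 = - 1"

definition F_map ::
  "map_index \<Rightarrow> real \<Rightarrow> real \<Rightarrow> real \<Rightarrow> (real \<Rightarrow> real) \<Rightarrow> real \<Rightarrow> real \<times> real \<Rightarrow> real \<times> real" where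
  "F_map i a \<delta> \<omega> g b = (\<lambda>(x, \<theta>). (h_map i a \<delta> x + sigma i * b * g \<theta>, \<theta> + \<omega>))"

definition graph_transform ::
  "map_index \<Rightarrow> real \<Rightarrow> real \<Rightarrow> real \<Rightarrow> (real \<Rightarrow> real) \<Rightarrow> real \<Rightarrow> (real \<Rightarrow> real) \<Rightarrow> real \<Rightarrow> real" where
  "graph_transform i a \<delta> \<omega> g b \<phi> \<theta> =
     h_map i a \<delta> (\<phi> (\<theta> - \<omega>)) + sigma i * b * g (\<theta> - \<omega>)"

text \<open>
  The continuous solutions below exist and are unique because \<open>\<bar>a\<bar> > 1\<close>.
\<close>

definition mu :: "map_index \<Rightarrow> real \<Rightarrow> real \<Rightarrow> real \<Rightarrow> (real \<Rightarrow> real) \<Rightarrow> real \<Rightarrow> real \<Rightarrow> real" where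
  "mu i a \<delta> \<omega> g b =
     (THE m. continuous_on UNIV m \<and> periodic_2pi m \<and>
        (\<forall>\<theta>. m (\<theta> + \<omega>) =
           (case i of
              Map1 \<Rightarrow> a * m \<theta> - b * g \<theta>
            | Map2 \<Rightarrow> a * (m \<theta> - \<delta>) + b * g \<theta>
            | Map3 \<Rightarrow> a * m \<theta> + b * g \<theta>
            | Map4 \<Rightarrow> a * m \<theta> - b * g \<theta>)))"

definition mu2_hat :: "real \<Rightarrow> real \<Rightarrow> real \<Rightarrow> (real \<Rightarrow> real) \<Rightarrow> real \<Rightarrow> real \<Rightarrow> real" where
  "mu2_hat a \<delta> \<omega> g b =
     (THE m. continuous_on UNIV m \<and> periodic_2pi m \<and>
        (\<forall>\<theta>. m (\<theta> + \<omega>) = a * (m \<theta> + \<delta>) + b * g \<theta>))"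

definition gamma1_tilde :: "real \<Rightarrow> (real \<Rightarrow> real) \<Rightarrow> real \<Rightarrow> real \<Rightarrow> real" where
  "gamma1_tilde \<omega> g b \<theta> = - (pi / 2) - b * g (\<theta> - \<omega>)"

fun phi0 :: "map_index \<Rightarrow> real \<Rightarrow> (real \<Rightarrow> real) \<Rightarrow> real \<Rightarrow> real \<Rightarrow> real" where
  "phi0 Map1 \<omega> g b \<theta> = pi / 2 - b * g (\<theta> - \<omega>)"
| "phi0 Map2 \<omega> g b \<theta> = b * g (\<theta> - \<omega>)"
| "phi0 Map3 \<omega> g b \<theta> = - 1 + b * g (\<theta> - \<omega>)"
| "phi0 Map4 \<omega> g b \<theta> = 1 - b * g (\<theta> - \<omega>)"

fun phi ::
  "map_index \<Rightarrow> real \<Rightarrow> real \<Rightarrow> real \<Rightarrow> (real \<Rightarrow> real) \<Rightarrow> real \<Rightarrow> nat \<Rightarrow> real \<Rightarrow> real" where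
  "phi i a \<delta> \<omega> g b 0 = phi0 i \<omega> g b"
| "phi i a \<delta> \<omega> g b (Suc n) =
     (if i = Map4
      then graph_transform i a \<delta> \<omega> g b (graph_transform i a \<delta> \<omega> g b (phi i a \<delta> \<omega> g b n))
      else graph_transform i a \<delta> \<omega> g b (phi i a \<delta> \<omega> g b n))"

definition lambda0 ::
  "map_index \<Rightarrow> real \<Rightarrow> real \<Rightarrow> real \<Rightarrow> (real \<Rightarrow> real) \<Rightarrow> real \<Rightarrow> real \<Rightarrow> real" where
  "lambda0 i a \<delta> \<omega> g b \<theta> =
     (if i \<in> {Map1, Map4} then phi0 i \<omega> g b \<theta> - mu i a \<delta> \<omega> g b \<theta>
      else mu i a \<delta> \<omega> g b \<theta> - phi0 i \<omega> g b \<theta>)"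

definition graphs_meet :: "(real \<Rightarrow> real) \<Rightarrow> (real \<Rightarrow> real) \<Rightarrow> bool" where
  "graphs_meet u v \<longleftrightarrow> (\<exists>\<theta>. u \<theta> = v \<theta>)"

definition collision :: "map_index \<Rightarrow> real \<Rightarrow> real \<Rightarrow> real \<Rightarrow> (real \<Rightarrow> real) \<Rightarrow> real \<Rightarrow> bool" where
  "collision i a \<delta> \<omega> g b \<longleftrightarrow>
     (case i of
        Map1 \<Rightarrow> graphs_meet (mu Map1 a \<delta> \<omega> g b) (phi0 Map1 \<omega> g b) \<or>
                graphs_meet (mu Map1 a \<delta> \<omega> g b) (gamma1_tilde \<omega> g b)
      | Map2 \<Rightarrow> graphs_meet (phi0 Map2 \<omega> g b) (mu Map2 a \<delta> \<omega> g b) \<or>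
                graphs_meet (phi0 Map2 \<omega> g b) (mu2_hat a \<delta> \<omega> g b)
      | Map3 \<Rightarrow> graphs_meet (phi0 Map3 \<omega> g b) (mu Map3 a \<delta> \<omega> g b)
      | Map4 \<Rightarrow> graphs_meet (phi0 Map4 \<omega> g b) (mu Map4 a \<delta> \<omega> g b))"

text \<open>\<open>b\<close> is the smallest positive collision parameter, i.e. \<open>b = b\<^sup>*(a)\<close> and \<open>b\<^sup>*(a)\<close> exists.\<close>

definition bifurcation_value ::
  "map_index \<Rightarrow> real \<Rightarrow> real \<Rightarrow> real \<Rightarrow> (real \<Rightarrow> real) \<Rightarrow> real \<Rightarrow> bool" where
  "bifurcation_value i a \<delta> \<omega> g b \<longleftrightarrow>
     0 < b \<and> collision i a \<delta> \<omega> g b \<and> (\<forall>b'. 0 < b' \<and> collision i a \<delta> \<omega> g b' \<longrightarrow> b \<le> b')"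

text \<open>
  The factor \<open>q\<close> is required to be continuous: without this, positivity of \<open>q\<close> away from \<open>\<theta>0\<close>
  would put no bound on the order of the zero, since the value \<open>q \<theta>0\<close> does not enter the equation.
\<close>

definition even_order_zeros :: "(real \<Rightarrow> real) \<Rightarrow> bool" where
  "even_order_zeros u \<longleftrightarrow>
     (\<forall>\<theta>0. u \<theta>0 = 0 \<longrightarrow>
        (\<exists>\<epsilon>>0. \<exists>m>0. even m \<and>
           (\<exists>q. continuous_on {\<theta>0 - \<epsilon><..<\<theta>0 + \<epsilon>} q \<and>
                (\<forall>\<theta>\<in>{\<theta>0 - \<epsilon><..<\<theta>0 + \<epsilon>}. q \<theta> > 0 \<and> u \<theta> = (\<theta> - \<theta>0) ^ m * q \<theta>))))"

definition h_deriv :: "map_index \<Rightarrow> real \<Rightarrow> real \<Rightarrow> real \<Rightarrow> real" where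
  "h_deriv i a \<delta> x = (if h_map i a \<delta> differentiable at x then deriv (h_map i a \<delta>) x else a)"

text \<open>For the fourth map this is the chain rule applied to the second iterate.\<close>

definition fibre_deriv ::
  "map_index \<Rightarrow> real \<Rightarrow> real \<Rightarrow> real \<Rightarrow> (real \<Rightarrow> real) \<Rightarrow> real \<Rightarrow> real \<Rightarrow> real \<Rightarrow> real" where
  "fibre_deriv i a \<delta> \<omega> g b x \<theta> =
     (if i = Map4
      then h_deriv i a \<delta> (fst (F_map i a \<delta> \<omega> g b (x, \<theta>))) * h_deriv i a \<delta> x
      else h_deriv i a \<delta> x)"

definition ln_abs :: "real \<Rightarrow> ereal" where
  "ln_abs x = (if x = 0 then - \<infinity> else ereal (ln \<bar>x\<bar>))"

text \<open>
  The Lebesgue integral of an extended real valued function, as positive part minus negative part.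
  As \<open>\<infinity> - \<infinity> = \<infinity>\<close> in \<^typ>\<open>ereal\<close>, the value \<open>- \<infinity>\<close> is only taken if the positive part
  has finite integral.
\<close>

definition ereal_integral :: "'a measure \<Rightarrow> ('a \<Rightarrow> ereal) \<Rightarrow> ereal" where
  "ereal_integral M f =
     enn2ereal (\<integral>\<^sup>+x. e2ennreal (f x) \<partial>M) - enn2ereal (\<integral>\<^sup>+x. e2ennreal (- f x) \<partial>M)"

definition lyapunov_exponent ::
  "map_index \<Rightarrow> real \<Rightarrow> real \<Rightarrow> real \<Rightarrow> (real \<Rightarrow> real) \<Rightarrow> real \<Rightarrow> (real \<Rightarrow> real) \<Rightarrow> ereal" where
  "lyapunov_exponent i a \<delta> \<omega> g b \<phi> =
     ereal (1 / (2 * pi)) *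
     ereal_integral (lebesgue_on {0..<2 * pi}) (\<lambda>\<theta>. ln_abs (fibre_deriv i a \<delta> \<omega> g b (\<phi> \<theta>) \<theta>))"

lemma F_map_graph:
  "F_map i a \<delta> \<omega> g b (\<phi> (\<theta> - \<omega>), \<theta> - \<omega>) = (graph_transform i a \<delta> \<omega> g b \<phi> \<theta>, \<theta>)"
  by (simp add: F_map_def graph_transform_def)

end

theory Submission
  imports Defs "HOL-Complex_Analysis.Complex_Analysis"
begin

text \<open>
  Let \<open>l\<^sub>n = \<bar>\<phi>\<^sub>n - \<mu>\<^sub>i\<bar>\<close>, \<open>f = \<lambda>\<^sub>0\<close>, and let \<open>(A, \<Omega>)\<close> be \<open>(a, \<omega>)\<close>, or \<open>(a\<^sup>2, 2 \<omega>)\<close> for the fourth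
  map.  Minimality of \<open>b\<close> gives \<open>f \<ge> 0\<close>, and
  \<open>min (A l\<^sub>n(\<theta>), f(\<theta> + \<Omega>)) \<le> l\<^sub>n\<^sub>+\<^sub>1(\<theta> + \<Omega>) \<le> A l\<^sub>n(\<theta>)\<close>.  The fibre derivative vanishes at
  \<open>\<phi>\<^sub>\<infinity>(\<theta>)\<close> as soon as \<open>A l\<^sub>\<infinity>(\<theta>)\<close> is slightly larger than \<open>f(\<theta> + \<Omega>)\<close>, so it is enough to find a
  set of positive measure of such \<open>\<theta>\<close>.

  As the zeros of \<open>f\<close> have finite order, the sets \<open>{\<theta>. A\<^sup>k f(\<theta> - k \<Omega>) < c}\<close> have exponentially small
  measure, so \<open>\<Lambda>(\<theta>) = inf\<^sub>k A\<^sup>k f(\<theta> - k \<Omega>) \<le> l\<^sub>\<infinity>(\<theta>)\<close> is positive on a set of positive measure.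
  At a point of density of \<open>{\<Lambda> \<ge> c}\<close>, a value of \<open>l\<^sub>\<infinity>\<close> in a suitable interval \<open>[x1, x2]\<close> below \<open>c\<close> is
  expanded until it lands in the flat part.  If almost no value lies in this interval, then
  \<open>l\<^sub>\<infinity> > x2\<close> almost everywhere on \<open>{\<Lambda> \<ge> x1}\<close>, and by Baire's theorem (this is where convergence at
  every point is used) \<open>A\<^sup>n f(\<theta> - n \<Omega>) \<ge> l\<^sub>n(\<theta>)\<close> stays away from \<open>x1\<close> on an open piece of this set.
  But the intervals around the orbit of a zero of \<open>f\<close> that are removed from this set shrink
  exponentially and return close to each other only after a long time, so that they cannot exhaust
  one side of a boundary point from which all of them keep a distance proportional to their length.
\<close>

section \<open>Periodic functions on the real line\<close>

lemma periodic_2pi_int: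
  assumes "periodic_2pi u"
  shows "u (x + 2 * pi * of_int j) = u x"
proof -
  have nat: "u (y + 2 * pi * of_nat n) = u y" for y n
  proof (induction n)
    case (Suc n)
    have "u (y + 2 * pi * of_nat (Suc n)) = u ((y + 2 * pi * of_nat n) + 2 * pi)"
      by (simp add: algebra_simps)
    then show ?case
      using assms Suc by (simp add: periodic_2pi_def)
  qed simp
  show ?thesis
  proof (cases "0 \<le> j")
    case True
    then show ?thesis using nat[of x "nat j"] by simp
  next
    case False
    then show ?thesis using nat[of "x + 2 * pi * of_int j" "nat (- j)"] by simp
  qed
qed

lemma obtain_2pi_representative:
  obtains j :: int where "x - 2 * pi * of_int j \<in> {0..<2 * pi}"
proof
  let ?q = "x / (2 * pi)"
  have "2 * pi * of_int \<lfloor>?q\<rfloor> \<le> 2 * pi * ?q" "2 * pi * ?q < 2 * pi * (of_int \<lfloor>?q\<rfloor> + 1)"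
    by (intro mult_left_mono mult_strict_left_mono; simp)+
  then show "x - 2 * pi * of_int \<lfloor>?q\<rfloor> \<in> {0..<2 * pi}"
    by (simp add: distrib_left)
qed

lemma periodic_2pi_bounded:
  fixes u :: "real \<Rightarrow> real"
  assumes "continuous_on UNIV u" "periodic_2pi u"
  obtains B where "0 < B" "\<And>x. \<bar>u x\<bar> \<le> B"
proof -
  have "compact (u ` {0..2 * pi})"
    by (rule compact_continuous_image[OF continuous_on_subset[OF assms(1)]]) simp_all
  then have "bounded (u ` {0..2 * pi})"
    by (rule compact_imp_bounded)
  then obtain B where B: "0 < B" "\<forall>x\<in>{0..2 * pi}. norm (u x) \<le> B"
    unfolding bounded_pos by auto
  have "\<bar>u x\<bar> \<le> B" for x
  proof -
    obtain j :: int where "x - 2 * pi * of_int j \<in> {0..<2 * pi}"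
      by (rule obtain_2pi_representative)
    then have "norm (u (x - 2 * pi * of_int j)) \<le> B"
      using B(2) by auto
    then show ?thesis
      using periodic_2pi_int[OF assms(2), of "x - 2 * pi * of_int j" j] by simp
  qed
  then show thesis
    using B(1) that by blast
qed

subsection \<open>Zeros of finite order along an irrational rotation\<close>

text \<open>Common form of the two standing assumptions. A limit \<open>c\<close> is required rather
  than a pair of bounds, so that the upper and lower constants can be brought within any factor
  \<open>1 + \<eta>\<close> of each other.\<close>

definition finite_order_zero :: "(real \<Rightarrow> real) \<Rightarrow> real \<Rightarrow> bool" where
  "finite_order_zero f z \<longleftrightarrow>
     (\<exists>m>0. \<exists>c>0. ((\<lambda>x. f x / \<bar>x - z\<bar> ^ m) \<longlongrightarrow> c) (at z))"

lemma finite_order_zero_bounds: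
  assumes "finite_order_zero f z" "f z = 0" "0 < \<eta>"
  obtains m c s where "0 < m" "0 < c" "0 < s"
    "\<And>x. \<bar>x - z\<bar> < s \<Longrightarrow> c * \<bar>x - z\<bar> ^ m \<le> f x \<and> f x \<le> (1 + \<eta>) * c * \<bar>x - z\<bar> ^ m"
proof -
  obtain m c where mc: "0 < m" "0 < c" and lim: "((\<lambda>x. f x / \<bar>x - z\<bar> ^ m) \<longlongrightarrow> c) (at z)"
    using assms(1) unfolding finite_order_zero_def by blast
  let ?c = "c / (1 + \<eta> / 2)"
  have "?c < c" "c < (1 + \<eta>) * ?c"
    using mc assms(3) by (auto simp: field_simps)
  then have "\<forall>\<^sub>F x in at z. ?c < f x / \<bar>x - z\<bar> ^ m \<and> f x / \<bar>x - z\<bar> ^ m < (1 + \<eta>) * ?c"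
    by (intro eventually_conj order_tendstoD[OF lim])
  then obtain s where s: "0 < s"
    "\<And>x. x \<noteq> z \<Longrightarrow> dist x z < s \<Longrightarrow> ?c < f x / \<bar>x - z\<bar> ^ m \<and> f x / \<bar>x - z\<bar> ^ m < (1 + \<eta>) * ?c"
    unfolding eventually_at by blast
  show thesis
  proof (rule that[OF mc(1) _ s(1)])
    show "0 < ?c" using mc assms(3) by simp
    fix x assume x: "\<bar>x - z\<bar> < s"
    show "?c * \<bar>x - z\<bar> ^ m \<le> f x \<and> f x \<le> (1 + \<eta>) * ?c * \<bar>x - z\<bar> ^ m"
    proof (cases "x = z")
      case True
      then show ?thesis using assms(2) mc by (simp add: power_0_left)
    next
      case False
      then have pos: "0 < \<bar>x - z\<bar> ^ m" by simp
      have "?c < f x / \<bar>x - z\<bar> ^ m" "f x / \<bar>x - z\<bar> ^ m < (1 + \<eta>) * ?c"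
        using s(2)[OF False] x by (auto simp: dist_real_def)
      then show ?thesis
        unfolding pos_less_divide_eq[OF pos] pos_divide_less_eq[OF pos] by simp
    qed
  qed
qed

text \<open>Countable subadditivity of Lebesgue measure. It serves in contrapositive form: intervals
  whose radii sum to too little leave a set \<open>N\<close> that is not negligible.\<close>

lemma interval_cover_length:
  fixes p r :: "'a \<Rightarrow> nat \<Rightarrow> real"
  assumes sub: "{u<..<v} \<subseteq> N \<union> (\<Union>z\<in>Z. \<Union>k. {p z k - r z k <..< p z k + r z k})"
    and N: "negligible N" and Z: "finite Z"
    and r: "\<And>z k. z \<in> Z \<Longrightarrow> 0 \<le> r z k" "\<And>z. z \<in> Z \<Longrightarrow> summable (r z)"
  shows "v - u \<le> (\<Sum>z\<in>Z. 2 * (\<Sum>k. r z k))"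
proof (cases "u \<le> v")
  case True
  let ?I = "\<lambda>z k. {p z k - r z k <..< p z k + r z k}"
  have N0: "N \<in> null_sets lebesgue"
    using N by (simp add: negligible_iff_null_sets)
  have "ennreal (v - u) = emeasure lebesgue {u<..<v}"
    using True by simp
  also have "\<dots> \<le> emeasure lebesgue (N \<union> (\<Union>z\<in>Z. \<Union>k. ?I z k))"
    using N0 Z by (intro emeasure_mono sub sets.Un sets.finite_UN sets.countable_UN) auto
  also have "\<dots> = emeasure lebesgue (\<Union>z\<in>Z. \<Union>k. ?I z k)"
    using N0 Z by (subst Un_commute, intro emeasure_Un_null_set sets.finite_UN sets.countable_UN) auto
  also have "\<dots> \<le> (\<Sum>z\<in>Z. emeasure lebesgue (\<Union>k. ?I z k))"
    using Z by (intro emeasure_subadditive_finite) auto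
  also have "\<dots> \<le> (\<Sum>z\<in>Z. ennreal (2 * (\<Sum>k. r z k)))"
  proof (rule sum_mono)
    fix z assume z: "z \<in> Z"
    have "emeasure lebesgue (\<Union>k. ?I z k) \<le> (\<Sum>k. emeasure lebesgue (?I z k))"
      by (intro emeasure_subadditive_countably) auto
    also have "\<dots> = (\<Sum>k. ennreal (2 * r z k))"
    proof (rule suminf_cong)
      fix k
      have "p z k - r z k \<le> p z k + r z k"
        using r(1)[OF z, of k] by linarith
      then show "emeasure lebesgue (?I z k) = ennreal (2 * r z k)"
        by simp
    qed
    also have "\<dots> = ennreal (\<Sum>k. 2 * r z k)"
      using r z by (intro suminf_ennreal2 summable_mult) auto
    also have "(\<Sum>k. 2 * r z k) = 2 * (\<Sum>k. r z k)"
      using r(2)[OF z] by (rule suminf_mult)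
    finally show "emeasure lebesgue (\<Union>k. ?I z k) \<le> ennreal (2 * (\<Sum>k. r z k))" .
  qed
  also have "\<dots> = ennreal (\<Sum>z\<in>Z. 2 * (\<Sum>k. r z k))"
    using r by (intro sum_ennreal) (auto intro!: suminf_nonneg)
  finally show ?thesis
    using r by (subst (asm) ennreal_le_iff) (auto intro!: sum_nonneg suminf_nonneg)
next
  case False
  then have "v - u \<le> 0" by simp
  also have "0 \<le> (\<Sum>z\<in>Z. 2 * (\<Sum>k. r z k))"
    using r by (auto intro!: sum_nonneg suminf_nonneg)
  finally show ?thesis .
qed

text \<open>Two translates of \<open>y\<close> that both come close to the interval would be at
  distance less than \<open>2 * pi\<close>, so at most one does. This turns arcs of the circle into
  intervals of the line.\<close>

lemma short_arc:
  fixes y r :: real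
  assumes "v - u + 2 * r \<le> 2 * pi"
  obtains p where "\<And>x j::int. \<lbrakk>u < x; x < v; \<bar>x - (y + 2 * pi * of_int j)\<bar> < r\<rbrakk> \<Longrightarrow> \<bar>x - p\<bar> < r"
proof (cases "\<exists>x j::int. u < x \<and> x < v \<and> \<bar>x - (y + 2 * pi * of_int j)\<bar> < r")
  case True
  then obtain x0 and j0 :: int where
    x0: "u < x0" "x0 < v" "\<bar>x0 - (y + 2 * pi * of_int j0)\<bar> < r" by blast
  show thesis
  proof (rule that)
    fix x and j :: int
    assume x: "u < x" "x < v" "\<bar>x - (y + 2 * pi * of_int j)\<bar> < r"
    have "\<bar>2 * pi * of_int (j - j0)\<bar> < 2 * pi"
      using x x0 assms by (auto simp: algebra_simps abs_less_iff)
    then have "\<bar>real_of_int (j - j0)\<bar> < 1"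
      by (simp add: abs_mult)
    then have "j = j0" by linarith
    then show "\<bar>x - (y + 2 * pi * of_int j0)\<bar> < r" using x by simp
  qed
next
  case False
  then show thesis by (intro that) blast
qed

text \<open>The lower power bound isolates each zero, so a period contains only finitely many;
  outside their neighbourhoods \<open>f\<close> has a positive minimum by compactness.\<close>

lemma finite_order_zeros_structure:
  fixes f :: "real \<Rightarrow> real"
  assumes cont: "continuous_on UNIV f" and per: "periodic_2pi f" and nonneg: "\<And>x. 0 \<le> f x"
    and zeros: "\<forall>z. f z = 0 \<longrightarrow> finite_order_zero f z" and \<eta>: "0 < \<eta>"
  obtains Z e s m C where "finite Z" "0 < e" "0 < s" "\<And>z. z \<in> Z \<Longrightarrow> 0 < m z" "\<And>z. z \<in> Z \<Longrightarrow> 0 < C z"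
    "\<And>x. f x < e \<Longrightarrow> \<exists>z\<in>Z. \<exists>j::int. \<bar>x - (z + 2 * pi * of_int j)\<bar> < s"
    "\<And>z x j. \<lbrakk>z \<in> Z; \<bar>x - (z + 2 * pi * of_int j)\<bar> < s\<rbrakk> \<Longrightarrow>
       C z * \<bar>x - (z + 2 * pi * of_int j)\<bar> ^ m z \<le> f x \<and>
       f x \<le> (1 + \<eta>) * C z * \<bar>x - (z + 2 * pi * of_int j)\<bar> ^ m z"
proof -
  have "\<forall>z. \<exists>m c s. f z = 0 \<longrightarrow> 0 < m \<and> 0 < c \<and> 0 < s \<and>
          (\<forall>x. \<bar>x - z\<bar> < s \<longrightarrow> c * \<bar>x - z\<bar> ^ m \<le> f x \<and> f x \<le> (1 + \<eta>) * c * \<bar>x - z\<bar> ^ m)"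
    using finite_order_zero_bounds[OF zeros[rule_format] _ \<eta>] by metis
  then obtain m C S where mCS: "\<And>z. f z = 0 \<Longrightarrow> 0 < m z" "\<And>z. f z = 0 \<Longrightarrow> 0 < C z"
    "\<And>z. f z = 0 \<Longrightarrow> 0 < S z"
    "\<And>z x. f z = 0 \<Longrightarrow> \<bar>x - z\<bar> < S z \<Longrightarrow>
       C z * \<bar>x - z\<bar> ^ m z \<le> f x \<and> f x \<le> (1 + \<eta>) * C z * \<bar>x - z\<bar> ^ m z"
    by metis
  define Z where "Z = {z \<in> {0..2 * pi}. f z = 0}"
  have cont': "continuous_on {0..2 * pi} f"
    using cont continuous_on_subset by blast
  have "closed {z. f z = 0}"
    using cont by (intro closed_Collect_eq) auto
  then have "compact ({0..2 * pi} \<inter> {z. f z = 0})"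
    by (intro compact_Int_closed) auto
  then have compact_Z: "compact Z"
    by (simp only: Z_def Collect_conj_eq Collect_mem_eq)
  have cover_Z: "Z \<subseteq> (\<Union>z\<in>Z. ball z (S z))"
    using mCS(3) by (auto simp: Z_def)
  obtain Z' where Z': "Z' \<subseteq> Z" "finite Z'" "Z \<subseteq> (\<Union>z\<in>Z'. ball z (S z))"
    by (rule compactE_image[OF compact_Z _ cover_Z]) (simp, rule that)
  \<comment> \<open>No ball of the subcover contains a zero besides its centre, so no zero was
    dropped.\<close>
  have "Z \<subseteq> Z'"
  proof
    fix x assume x: "x \<in> Z"
    then obtain z where z: "z \<in> Z'" "\<bar>x - z\<bar> < S z"
      using Z'(3) by (auto simp: dist_real_def abs_minus_commute)
    then have "f z = 0" "f x = 0"
      using Z'(1) x by (auto simp: Z_def)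
    then have "C z * \<bar>x - z\<bar> ^ m z \<le> f x" "f x = 0" "0 < C z"
      using mCS(2,4) z(2) by blast+
    then have "\<bar>x - z\<bar> ^ m z \<le> 0"
      by (simp add: mult_le_0_iff)
    then have "x = z"
      using zero_less_power[of "\<bar>x - z\<bar>" "m z"] by fastforce
    then show "x \<in> Z'" using z by simp
  qed
  then have fin: "finite Z"
    using Z'(2) finite_subset by blast
  define s where "s = Min (insert 1 (S ` Z))"
  have s: "0 < s" "\<And>z. z \<in> Z \<Longrightarrow> s \<le> S z"
    using fin mCS(3) by (auto simp: s_def Z_def)
  define T where "T = {0..2 * pi} - (\<Union>z\<in>Z. ball z s)"
  have "compact T"
    unfolding T_def by (intro compact_diff) auto
  have Tpos: "0 < f x" if "x \<in> T" for x
  proof -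
    have "f x \<noteq> 0" using that s(1) by (auto simp: T_def Z_def)
    then show ?thesis using nonneg[of x] by simp
  qed
  obtain e where e: "0 < e" "\<And>x. x \<in> T \<Longrightarrow> e \<le> f x"
  proof (cases "T = {}")
    case True
    then show thesis using that[of 1] by simp
  next
    case False
    obtain x0 where "x0 \<in> T" "\<forall>x\<in>T. f x0 \<le> f x"
      using continuous_attains_inf[OF \<open>compact T\<close> False continuous_on_subset[OF cont subset_UNIV]] by blast
    then show thesis using that[of "f x0"] Tpos by auto
  qed
  show thesis
  proof (rule that[of Z e s m C])
    fix x assume x: "f x < e"
    obtain j :: int where j: "x - 2 * pi * of_int j \<in> {0..<2 * pi}"
      by (rule obtain_2pi_representative)
    have "f (x - 2 * pi * of_int j) < e"
      using x periodic_2pi_int[OF per, of "x - 2 * pi * of_int j" j] by simp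
    then have "x - 2 * pi * of_int j \<notin> T"
      using e(2) by fastforce
    then obtain z where "z \<in> Z" "\<bar>x - 2 * pi * of_int j - z\<bar> < s"
      using j by (auto simp: T_def dist_real_def abs_minus_commute)
    then show "\<exists>z\<in>Z. \<exists>j::int. \<bar>x - (z + 2 * pi * of_int j)\<bar> < s"
      by (intro bexI[of _ z] exI[of _ j]) (auto simp: algebra_simps)
  next
    fix z x :: real and j :: int
    assume z: "z \<in> Z" "\<bar>x - (z + 2 * pi * of_int j)\<bar> < s"
    have "f (x - 2 * pi * of_int j) = f x"
      using periodic_2pi_int[OF per, of "x - 2 * pi * of_int j" j] by simp
    moreover have eq: "x - 2 * pi * of_int j - z = x - (z + 2 * pi * of_int j)" by simp
    moreover have "f z = 0" "\<bar>x - 2 * pi * of_int j - z\<bar> < S z"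
      unfolding eq using z s(2)[OF z(1)] by (auto simp: Z_def)
    ultimately show "C z * \<bar>x - (z + 2 * pi * of_int j)\<bar> ^ m z \<le> f x \<and>
       f x \<le> (1 + \<eta>) * C z * \<bar>x - (z + 2 * pi * of_int j)\<bar> ^ m z"
      using mCS(4)[of z "x - 2 * pi * of_int j"] unfolding eq by simp
  qed (use fin e s mCS in \<open>auto simp: Z_def\<close>)
qed

section \<open>Irrational rotations: short return times and density\<close>

lemma rotation_gap:
  fixes \<Omega> :: real
  assumes "\<Omega> / (2 * pi) \<notin> \<rat>"
  obtains \<gamma> where "0 < \<gamma>" "\<And>d j. \<lbrakk>0 < d; d \<le> Q\<rbrakk> \<Longrightarrow> \<gamma> \<le> \<bar>real d * \<Omega> + 2 * pi * of_int j\<bar>"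
proof -
  \<comment> \<open>For a single \<open>d\<close> the gap is governed by the distance from
    \<open>real d * (\<Omega> / (2 * pi))\<close> to the integers, which irrationality makes
    positive; finitely many \<open>d\<close> are then handled by a minimum.\<close>
  have one: "\<exists>\<gamma>>0. \<forall>j::int. \<gamma> \<le> \<bar>real d * \<Omega> + 2 * pi * of_int j\<bar>" if "0 < d" for d
  proof -
    let ?x = "real d * (\<Omega> / (2 * pi))"
    have "?x \<notin> \<int>"
    proof
      assume "?x \<in> \<int>"
      then have "?x / real d \<in> \<rat>"
        using Ints_subset_Rats by (intro Rats_divide) auto
      then show False using that assms by simp
    qed
    then have fr: "0 < frac ?x" "frac ?x < 1"
      by (auto simp: frac_lt_1 frac_gt_0_iff)
    have "2 * pi * min (frac ?x) (1 - frac ?x) \<le> \<bar>real d * \<Omega> + 2 * pi * of_int j\<bar>" for j :: int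
    proof -
      have "min (frac ?x) (1 - frac ?x) \<le> \<bar>frac ?x + of_int i\<bar>" for i :: int
      proof (cases "0 \<le> i")
        case True
        then have "0 \<le> real_of_int i" by simp
        then show ?thesis using fr by linarith
      next
        case False
        then have "real_of_int i \<le> - 1" by linarith
        then show ?thesis using fr by linarith
      qed
      from this[of "\<lfloor>?x\<rfloor> + j"] have "min (frac ?x) (1 - frac ?x) \<le> \<bar>?x + of_int j\<bar>"
        by (simp add: frac_def)
      then have "2 * pi * min (frac ?x) (1 - frac ?x) \<le> \<bar>2 * pi\<bar> * \<bar>?x + of_int j\<bar>"
        by (simp add: mult_left_mono)
      also have "\<dots> = \<bar>2 * pi * (?x + of_int j)\<bar>"
        by (simp only: abs_mult)
      also have "2 * pi * (?x + of_int j) = real d * \<Omega> + 2 * pi * of_int j"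
        by (simp add: field_simps)
      finally show ?thesis .
    qed
    then show ?thesis
      using fr by (intro exI[of _ "2 * pi * min (frac ?x) (1 - frac ?x)"]) auto
  qed
  have "\<exists>\<gamma>>0. \<forall>d j. 0 < d \<and> d \<le> Q \<longrightarrow> \<gamma> \<le> \<bar>real d * \<Omega> + 2 * pi * of_int j\<bar>"
  proof (induction Q)
    case 0
    then show ?case by (intro exI[of _ 1]) auto
  next
    case (Suc Q)
    then obtain \<gamma> where \<gamma>: "0 < \<gamma>"
      "\<forall>d j. 0 < d \<and> d \<le> Q \<longrightarrow> \<gamma> \<le> \<bar>real d * \<Omega> + 2 * pi * of_int j\<bar>" by blast
    obtain \<gamma>' where \<gamma>': "0 < \<gamma>'" "\<forall>j::int. \<gamma>' \<le> \<bar>real (Suc Q) * \<Omega> + 2 * pi * of_int j\<bar>"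
      using one[of "Suc Q"] by auto
    show ?case
    proof (intro exI[of _ "min \<gamma> \<gamma>'"] conjI allI impI)
      fix d and j :: int assume d: "0 < d \<and> d \<le> Suc Q"
      show "min \<gamma> \<gamma>' \<le> \<bar>real d * \<Omega> + 2 * pi * of_int j\<bar>"
      proof (cases "d = Suc Q")
        case True
        then show ?thesis using \<gamma>'(2) by (simp add: min.coboundedI2)
      next
        case False
        then have "0 < d \<and> d \<le> Q" using d by simp
        then show ?thesis using \<gamma>(2) by (simp add: min.coboundedI1)
      qed
    qed (use \<gamma> \<gamma>' in auto)
  qed
  then show thesis using that by blast
qed

text \<open>The density theorem for fractional parts provides a positive multiplier, so the forward
  orbit alone reaches every interval.\<close>

lemma rotation_orbit_dense:
  fixes \<Omega> :: real
  assumes "\<Omega> / (2 * pi) \<notin> \<rat>" "u < v"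
  obtains n :: nat and j :: int where "u < y + real n * \<Omega> + 2 * pi * of_int j"
    "y + real n * \<Omega> + 2 * pi * of_int j < v"
proof -
  let ?\<alpha> = "((u + v) / 2 - y) / (2 * pi)"
  have "0 < (v - u) / (4 * pi)" using assms by simp
  then obtain h k :: int where k: "k > 0" "\<bar>of_int k * (\<Omega> / (2 * pi)) - of_int h - ?\<alpha>\<bar> < (v - u) / (4 * pi)"
    using sequence_of_fractional_parts_is_dense[OF assms(1)] by metis
  have "\<bar>2 * pi\<bar> * \<bar>of_int k * (\<Omega> / (2 * pi)) - of_int h - ?\<alpha>\<bar> < 2 * pi * ((v - u) / (4 * pi))"
    using k(2) by (simp del: times_divide_eq_right)
  also have "\<bar>2 * pi\<bar> * \<bar>of_int k * (\<Omega> / (2 * pi)) - of_int h - ?\<alpha>\<bar> =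
      \<bar>2 * pi * (of_int k * (\<Omega> / (2 * pi)) - of_int h - ?\<alpha>)\<bar>"
    by (simp only: abs_mult)
  also have "2 * pi * (of_int k * (\<Omega> / (2 * pi)) - of_int h - ?\<alpha>) =
      of_int k * \<Omega> - 2 * pi * of_int h - ((u + v) / 2 - y)"
    by (simp add: field_simps)
  also have "2 * pi * ((v - u) / (4 * pi)) = (v - u) / 2"
    by (simp add: field_simps)
  finally have "\<bar>of_int k * \<Omega> - 2 * pi * of_int h - ((u + v) / 2 - y)\<bar> < (v - u) / 2" .
  moreover have "real (nat k) = of_int k"
    using k(1) by simp
  ultimately show thesis
    by (intro that[of "nat k" "- h"]) (auto simp: abs_less_iff field_simps)
qed

lemma less_root_if_power_less:
  fixes y t :: real
  assumes "0 < n" "0 \<le> y" "y ^ n < t"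
  shows "y < root n t"
  using real_root_less_mono[OF assms(1,3)] assms(1,2) by (simp add: real_root_power_cancel)

section \<open>Superlevel sets of the infimum over the backward orbit\<close>

locale rotated_zeros =
  fixes f :: "real \<Rightarrow> real" and A \<Omega> :: real
  assumes cont: "continuous_on UNIV f" and per: "periodic_2pi f" and nonneg: "\<And>x. 0 \<le> f x"
    and zeros: "\<forall>z. f z = 0 \<longrightarrow> finite_order_zero f z"
    and expanding: "1 < A" and irrational: "\<Omega> / (2 * pi) \<notin> \<rat>"
begin

text \<open>The superlevel set of \<open>\<Lambda>\<close> from the overview. Stating the condition
  for each \<open>k\<close> avoids the infimum and makes closedness evident.\<close>

definition above :: "real \<Rightarrow> real set" where
  "above c = {\<theta>. \<forall>k. c \<le> A ^ k * f (\<theta> - real k * \<Omega>)}"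

lemma A_pos [simp]: "0 < A" "0 < A ^ k"
  using expanding by auto

lemma continuous_on_scaled: "continuous_on UNIV (\<lambda>\<theta>. A ^ k * f (\<theta> - real k * \<Omega>))"
  by (intro continuous_intros continuous_on_compose2[OF cont]) auto

lemma closed_above: "closed (above c)"
  unfolding above_def by (intro closed_Collect_all closed_Collect_le continuous_on_scaled continuous_intros)

text \<open>This is the radius \<open>t\<close> at which \<open>A ^ k * C * t ^ n\<close> equals
  \<open>c\<close>; it shrinks by a fixed factor per rotation step, which makes the covering sums
  geometric.\<close>

lemma root_shrink:
  assumes "0 < n" "0 < c" "0 < C"
  shows "root n (c / (C * A ^ k)) = root n (c / C) * root n (1 / A) ^ k"
proof -
  have "c / (C * A ^ k) = (c / C) * (1 / A) ^ k"
    by (simp add: power_divide)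
  then show ?thesis
    using assms(1) by (simp only: real_root_mult real_root_power)
qed

text \<open>A point outside \<open>above c\<close> lies near the \<open>k\<close>-th forward rotate
  of some zero, within a radius geometric in \<open>k\<close>. The radii tend to 0 with
  \<open>c\<close>, so for small \<open>c\<close> these intervals do not even cover
  \<open>{0<..<1}\<close>.\<close>

lemma above_nonnegligible:
  obtains c where "0 < c" "\<not> negligible (above c)"
proof -
  obtain Z e s m C where str: "finite Z" "0 < e" "0 < s"
    "\<And>z. z \<in> Z \<Longrightarrow> 0 < m z" "\<And>z. z \<in> Z \<Longrightarrow> 0 < C z"
    "\<And>x. f x < e \<Longrightarrow> \<exists>z\<in>Z. \<exists>j::int. \<bar>x - (z + 2 * pi * of_int j)\<bar> < s"
    "\<And>z x j. \<lbrakk>z \<in> Z; \<bar>x - (z + 2 * pi * of_int j)\<bar> < s\<rbrakk> \<Longrightarrow>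
       C z * \<bar>x - (z + 2 * pi * of_int j)\<bar> ^ m z \<le> f x \<and>
       f x \<le> (1 + 1) * C z * \<bar>x - (z + 2 * pi * of_int j)\<bar> ^ m z"
    by (rule finite_order_zeros_structure[OF cont per nonneg zeros zero_less_one]) (rule that)
  define \<beta> where "\<beta> z = root (m z) (1 / A)" for z
  have \<beta>: "0 < \<beta> z" "\<beta> z < 1" if "z \<in> Z" for z
    using str(4)[OF that] expanding by (auto simp: \<beta>_def)
  \<comment> \<open>Total length of the removed intervals, with each geometric series already
    summed.\<close>
  define S where "S c = (\<Sum>z\<in>Z. 2 * (root (m z) (c / C z) * (1 / (1 - \<beta> z))))" for c
  have root0: "((\<lambda>c. root (m z) (c / C z)) \<longlongrightarrow> 0) (at_right 0)" if "z \<in> Z" for z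
  proof -
    have "((\<lambda>c. root (m z) (c / C z)) \<longlongrightarrow> root (m z) (0 / C z)) (at_right 0)"
      using str(5)[OF that] by (intro tendsto_intros) auto
    then show ?thesis by simp
  qed
  have "(S \<longlongrightarrow> (\<Sum>z\<in>Z. 2 * (0 * (1 / (1 - \<beta> z))))) (at_right 0)"
    unfolding S_def by (intro tendsto_intros root0)
  then have "\<forall>\<^sub>F c in at_right 0. S c < 1"
    by (intro order_tendstoD) auto
  \<comment> \<open>Radii at most 1 make \<open>short_arc\<close> applicable to the unit interval,
    as \<open>1 + 2 \<le> 2 * pi\<close>; the condition \<open>c < e\<close> below forces values of
    \<open>f\<close> under \<open>c\<close> to occur only near zeros.\<close>
  moreover have "\<forall>\<^sub>F c in at_right 0. \<forall>z\<in>Z. root (m z) (c / C z) < 1"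
    using str(1) root0 by (intro eventually_ball_finite ballI order_tendstoD(2)[OF root0]) auto
  moreover have "\<forall>\<^sub>F c in at_right 0. c < e \<and> 0 < c"
    using str(2) by (auto simp: eventually_at_right_field)
  ultimately have "\<forall>\<^sub>F c in at_right (0::real). S c < 1 \<and> (\<forall>z\<in>Z. root (m z) (c / C z) < 1) \<and> c < e \<and> 0 < c"
    by eventually_elim auto
  then obtain c where c: "S c < 1" "\<And>z. z \<in> Z \<Longrightarrow> root (m z) (c / C z) < 1" "c < e" "0 < c"
    using eventually_happens'[OF trivial_limit_at_right_real] by blast
  define r where "r z k = root (m z) (c / C z) * \<beta> z ^ k" for z k
  have r: "0 \<le> r z k" "r z k \<le> 1" if "z \<in> Z" for z k
  proof -
    have "0 \<le> root (m z) (c / C z)"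
      using str(4,5)[OF that] c(4) by simp
    moreover have "0 \<le> \<beta> z ^ k" "\<beta> z ^ k \<le> 1"
      using \<beta>[OF that] by (simp_all add: power_le_one)
    ultimately show "0 \<le> r z k" "r z k \<le> 1"
      using c(2)[OF that] mult_mono[of "root (m z) (c / C z)" 1 "\<beta> z ^ k" 1] by (auto simp: r_def)
  qed
  have "\<exists>p. z \<in> Z \<longrightarrow> (\<forall>x. \<forall>j::int. 0 < x \<longrightarrow> x < 1 \<longrightarrow>
          \<bar>x - ((z + real k * \<Omega>) + 2 * pi * of_int j)\<bar> < r z k \<longrightarrow> \<bar>x - p\<bar> < r z k)" for z k
  proof (cases "z \<in> Z")
    case True
    have "1 - 0 + 2 * r z k \<le> 2 * pi"
      using r(2)[OF True, of k] pi_gt3 by linarith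
    then show ?thesis by (rule short_arc[where y = "z + real k * \<Omega>"]) blast
  qed simp
  then obtain p where p: "\<And>z k x j. \<lbrakk>z \<in> Z; 0 < x; x < 1;
      \<bar>x - ((z + real k * \<Omega>) + 2 * pi * of_int j)\<bar> < r z k\<rbrakk> \<Longrightarrow> \<bar>x - p z k\<bar> < r z k"
    by metis
  have "\<not> negligible (above c)"
  proof
    assume neg: "negligible (above c)"
    have sub: "{0<..<1} \<subseteq> above c \<union> (\<Union>z\<in>Z. \<Union>k. {p z k - r z k <..< p z k + r z k})"
    proof
      fix x :: real assume x: "x \<in> {0<..<1}"
      show "x \<in> above c \<union> (\<Union>z\<in>Z. \<Union>k. {p z k - r z k <..< p z k + r z k})"
      proof (cases "x \<in> above c")
        case False
        then obtain k where k: "A ^ k * f (x - real k * \<Omega>) < c"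
          by (auto simp: above_def not_le)
        then have small: "f (x - real k * \<Omega>) < c / A ^ k"
          by (simp add: field_simps)
        also have "c / A ^ k \<le> c"
          using c(4) expanding by (simp add: divide_le_eq)
        finally have "f (x - real k * \<Omega>) < e"
          using c(3) by simp
        then obtain z and j :: int where z: "z \<in> Z" "\<bar>x - real k * \<Omega> - (z + 2 * pi * of_int j)\<bar> < s"
          using str(6) by blast
        let ?t = "\<bar>x - real k * \<Omega> - (z + 2 * pi * of_int j)\<bar>"
        have "C z * ?t ^ m z < c / A ^ k"
          using str(7)[OF z] small by linarith
        then have "?t ^ m z < c / (C z * A ^ k)"
          using str(5)[OF z(1)] by (simp add: field_simps)
        then have "?t < root (m z) (c / (C z * A ^ k))"
          by (intro less_root_if_power_less str(4) z) auto
        also have "\<dots> = r z k"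
          unfolding r_def \<beta>_def by (intro root_shrink str(4,5) z c)
        finally have "\<bar>x - ((z + real k * \<Omega>) + 2 * pi * of_int j)\<bar> < r z k"
          by (simp add: algebra_simps)
        then have "\<bar>x - p z k\<bar> < r z k"
          using p[OF z(1)] x by auto
        then show ?thesis
          using z(1) by (auto simp: abs_less_iff intro!: bexI[of _ z] exI[of _ k])
      qed simp
    qed
    have sums: "r z sums (root (m z) (c / C z) * (1 / (1 - \<beta> z)))" if "z \<in> Z" for z
      unfolding r_def using \<beta>[OF that] by (intro sums_mult geometric_sums) auto
    have "1 - 0 \<le> (\<Sum>z\<in>Z. 2 * (\<Sum>k. r z k))"
      by (rule interval_cover_length[OF sub neg str(1)]) (use r sums sums_summable in blast)+
    also have "\<dots> = S c"
      unfolding S_def using sums by (intro sum.cong) (auto simp: sums_iff)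
    finally show False using c(1) by simp
  qed
  then show thesis using that c(4) by blast
qed

text \<open>
  In the proof, \<open>y z k j\<close> and \<open>r z k\<close> are the centres and radii of the intervals outside \<open>above x1\<close>.
  As \<open>\<alpha>\<close> lies in \<open>above x3\<close>, it has distance at least \<open>\<rho> r z k\<close> to \<open>y z k j\<close>, hence each interval meets at
  most one of the geometrically shrinking annuli \<open>a i\<close> at \<open>\<alpha>\<close>.  Next to \<open>\<alpha>\<close>, all but the first interval
  \<open>k0 z\<close> of each of the \<open>n\<close> zeros come more than \<open>Q\<close> steps later and are too small to fill an
  annulus, so that one of \<open>n + 1\<close> annuli is not covered.
\<close>

lemma above_recurs:
  assumes x: "0 < x1" "x1 < x3" and \<alpha>: "\<alpha> \<in> above x3" and l: "0 < l"
  shows "\<not> negligible ({\<alpha><..<\<alpha> + l} \<inter> above x1)"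
proof -
  \<comment> \<open>One factor \<open>R\<close> of \<open>x3 / x1 = R * R\<close> absorbs the ratio
    of the upper and lower constants at the zeros, the other the enlargement of the radii by
    \<open>\<rho>\<close>.\<close>
  define R where "R = sqrt (x3 / x1)"
  have R: "1 < R" "x3 = R * R * x1"
    using x by (auto simp: R_def)
  have R1: "0 < R - 1" using R by simp
  obtain Z e s m C where str: "finite Z" "0 < e" "0 < s"
    "\<And>z. z \<in> Z \<Longrightarrow> 0 < m z" "\<And>z. z \<in> Z \<Longrightarrow> 0 < C z"
    "\<And>x. f x < e \<Longrightarrow> \<exists>z\<in>Z. \<exists>j::int. \<bar>x - (z + 2 * pi * of_int j)\<bar> < s"
    "\<And>z x j. \<lbrakk>z \<in> Z; \<bar>x - (z + 2 * pi * of_int j)\<bar> < s\<rbrakk> \<Longrightarrow>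
       C z * \<bar>x - (z + 2 * pi * of_int j)\<bar> ^ m z \<le> f x \<and>
       f x \<le> (1 + (R - 1)) * C z * \<bar>x - (z + 2 * pi * of_int j)\<bar> ^ m z"
    by (rule finite_order_zeros_structure[OF cont per nonneg zeros R1]) (rule that)
  \<comment> \<open>The largest order gives a \<open>\<rho>\<close> with
    \<open>\<rho> ^ m z \<le> R\<close> and a decay rate \<open>\<beta> < 1\<close> that serve all
    zeros at once.\<close>
  define M where "M = Max (insert 1 (m ` Z))"
  have M: "0 < M" "\<And>z. z \<in> Z \<Longrightarrow> m z \<le> M"
    using str(1) by (auto simp: M_def Max_gr_iff)
  define \<rho> where "\<rho> = root M R"
  have \<rho>: "1 < \<rho>" "\<And>z. z \<in> Z \<Longrightarrow> \<rho> ^ m z \<le> R"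
  proof -
    show *: "1 < \<rho>" using R M by (simp add: \<rho>_def)
    fix z assume "z \<in> Z"
    then have "\<rho> ^ m z \<le> \<rho> ^ M" using * M by (intro power_increasing) auto
    also have "\<dots> = R" using M R by (simp add: \<rho>_def)
    finally show "\<rho> ^ m z \<le> R" .
  qed
  define \<beta> where "\<beta> = root M (1 / A)"
  have \<beta>: "0 < \<beta>" "\<beta> < 1"
    using M expanding by (auto simp: \<beta>_def)
  have \<beta>_le: "root (m z) (1 / A) \<le> \<beta>" if "z \<in> Z" for z
    using real_root_increasing[of "m z" M "1 / A"] M(2)[OF that] str(4)[OF that] expanding
    by (cases "m z = M") (auto simp: \<beta>_def)
  define r where "r z k = root (m z) (x1 / (C z * A ^ k))" for z k
  have r_pos: "0 < r z k" if "z \<in> Z" for z k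
    using str(4,5)[OF that] x by (simp add: r_def)
  have r_shrink: "r z (k + d) \<le> r z k * \<beta> ^ d" if "z \<in> Z" for z k d
  proof -
    have "r z (k + d) = r z k * root (m z) (1 / A) ^ d"
      unfolding r_def root_shrink[OF str(4)[OF that] x(1) str(5)[OF that]] by (simp add: power_add)
    also have "\<dots> \<le> r z k * \<beta> ^ d"
      using r_pos[OF that, of k] \<beta>_le[OF that] str(4)[OF that] expanding
      by (intro mult_left_mono power_mono) auto
    finally show ?thesis .
  qed
  \<comment> \<open>An interval of radius \<open>r\<close> whose centre has distance at least
    \<open>\<rho> * r\<close> from \<open>\<alpha>\<close> has endpoints whose distances to
    \<open>\<alpha>\<close> are in ratio at least \<open>q\<close>.\<close>
  define q where "q = (\<rho> - 1) / (\<rho> + 1)"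
  have q: "0 < q" "q < 1" using \<rho> by (auto simp: q_def)
  define n where "n = card Z"
  \<comment> \<open>In units of \<open>len\<close>, the left side bounds the total length of all
    intervals that come at least \<open>Q\<close> steps after the first one of their zero; the right
    side is the length of the narrowest of the annuli \<open>a 0\<close>, ...,
    \<open>a n\<close>.\<close>
  obtain Q where Q: "real n * (2 * (\<beta> ^ Q / ((\<rho> - 1) * (1 - \<beta>)))) < q ^ (2 * n) * (1 - q)"
  proof -
    have "(\<lambda>Q. real n * (2 * (\<beta> ^ Q / ((\<rho> - 1) * (1 - \<beta>))))) \<longlonglongrightarrow> real n * (2 * (0 / ((\<rho> - 1) * (1 - \<beta>))))"
      using \<beta> \<rho> by (intro tendsto_intros LIMSEQ_realpow_zero) auto
    then have "\<forall>\<^sub>F Q in sequentially. real n * (2 * (\<beta> ^ Q / ((\<rho> - 1) * (1 - \<beta>)))) < q ^ (2 * n) * (1 - q)"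
      using q by (intro order_tendstoD(2)) auto
    then show thesis
      using that eventually_happens' sequentially_bot by blast
  qed
  obtain \<gamma> where \<gamma>: "0 < \<gamma>" "\<And>d j. \<lbrakk>0 < d; d \<le> Q\<rbrakk> \<Longrightarrow> \<gamma> \<le> \<bar>real d * \<Omega> + 2 * pi * of_int j\<bar>"
    using rotation_gap[OF irrational] by metis
  \<comment> \<open>From time \<open>K\<close> on, values below \<open>x1 / A ^ k\<close> occur only
    near zeros, and the intervals enlarged by \<open>\<rho>\<close> stay where the power bounds are
    valid.\<close>
  obtain K where K: "\<And>k. K \<le> k \<Longrightarrow> x1 / A ^ k < e"
    "\<And>k z. \<lbrakk>K \<le> k; z \<in> Z\<rbrakk> \<Longrightarrow> \<rho> * r z k < s"
  proof -
    have inv0: "(\<lambda>k. x1 * (1 / A) ^ k) \<longlonglongrightarrow> x1 * 0"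
      using expanding by (intro tendsto_intros LIMSEQ_realpow_zero) auto
    have "\<forall>\<^sub>F k in sequentially. x1 / A ^ k < e"
      using order_tendstoD(2)[OF inv0, of e] str(2) by (simp add: power_divide)
    moreover have "\<forall>\<^sub>F k in sequentially. \<rho> * r z k < s" if "z \<in> Z" for z
    proof -
      have "root (m z) (1 / A) < 1" "0 \<le> root (m z) (1 / A)"
        using str(4)[OF that] expanding by auto
      then have "(\<lambda>k. \<rho> * (root (m z) (x1 / C z) * root (m z) (1 / A) ^ k)) \<longlonglongrightarrow> \<rho> * (root (m z) (x1 / C z) * 0)"
        by (intro tendsto_intros LIMSEQ_realpow_zero) auto
      from order_tendstoD(2)[OF this, of s] show ?thesis
        using str(3) unfolding r_def root_shrink[OF str(4)[OF that] x(1) str(5)[OF that]] by simp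
    qed
    then have "\<forall>\<^sub>F k in sequentially. \<forall>z\<in>Z. \<rho> * r z k < s"
      using str(1) by (intro eventually_ball_finite) auto
    ultimately have "\<forall>\<^sub>F k in sequentially. x1 / A ^ k < e \<and> (\<forall>z\<in>Z. \<rho> * r z k < s)"
      by eventually_elim auto
    then show thesis
      using that unfolding eventually_sequentially by blast
  qed
  \<comment> \<open>The conditions with \<open>k < K\<close> hold strictly at
    \<open>\<alpha>\<close>, hence on a neighbourhood; only later intervals matter there.\<close>
  obtain l1 where l1: "0 < l1" "\<And>\<theta> k. \<lbrakk>\<bar>\<theta> - \<alpha>\<bar> < l1; k < K\<rbrakk> \<Longrightarrow> x1 < A ^ k * f (\<theta> - real k * \<Omega>)"
  proof -
    have "\<forall>\<^sub>F \<theta> in nhds \<alpha>. x1 < A ^ k * f (\<theta> - real k * \<Omega>)" for k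
    proof -
      have "((\<lambda>\<theta>. A ^ k * f (\<theta> - real k * \<Omega>)) \<longlongrightarrow> A ^ k * f (\<alpha> - real k * \<Omega>)) (nhds \<alpha>)"
        using continuous_on_scaled[of k]
        by (intro tendsto_at_iff_tendsto_nhds[THEN iffD1]) (simp add: continuous_on_eq_continuous_at isCont_def)
      moreover have "x1 < A ^ k * f (\<alpha> - real k * \<Omega>)"
        using \<alpha> x(2) by (auto simp: above_def intro: less_le_trans)
      ultimately show ?thesis
        by (rule order_tendstoD)
    qed
    then have "\<forall>\<^sub>F \<theta> in nhds \<alpha>. \<forall>k\<in>{..<K}. x1 < A ^ k * f (\<theta> - real k * \<Omega>)"
      by (intro eventually_ball_finite) auto
    then show thesis
      using that unfolding eventually_nhds_metric dist_real_def by auto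
  qed
  \<comment> \<open>\<open>C1 * len\<close> bounds the distance from \<open>\<alpha>\<close> to the
    centre of any interval meeting \<open>{\<alpha><..<\<alpha> + len}\<close>. With
    \<open>len\<close> chosen so that this is at most \<open>\<gamma>\<close> and
    \<open>2 * pi\<close>, neither two hits of the same zero within \<open>Q\<close> steps nor two
    translates can occur.\<close>
  define C1 where "C1 = 1 + 1 / (\<rho> - 1)"
  have C1: "0 < C1" using \<rho> by (simp add: C1_def add_pos_pos)
  define len where "len = min l (min l1 (min (\<gamma> / C1) (2 * pi / C1)))"
  have len: "0 < len" "len \<le> l" "len \<le> l1" "C1 * len \<le> \<gamma>" "C1 * len \<le> 2 * pi"
  proof -
    show "0 < len" "len \<le> l" "len \<le> l1" using l l1 \<gamma> C1 by (auto simp: len_def)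
    have "len \<le> \<gamma> / C1" "len \<le> 2 * pi / C1" by (auto simp: len_def)
    then show "C1 * len \<le> \<gamma>" "C1 * len \<le> 2 * pi" using C1 by (auto simp: field_simps)
  qed
  define y where "y z k j = z + real k * \<Omega> + 2 * pi * of_int j" for z k and j :: int
  have needle: "\<exists>z\<in>Z. \<exists>k\<ge>K. \<exists>j. \<bar>\<theta> - y z k j\<bar> < r z k"
    if \<theta>: "\<theta> \<in> {\<alpha><..<\<alpha> + len}" "\<theta> \<notin> above x1" for \<theta>
  proof -
    obtain k where k: "A ^ k * f (\<theta> - real k * \<Omega>) < x1"
      using \<theta>(2) by (auto simp: above_def not_le)
    have "\<bar>\<theta> - \<alpha>\<bar> < l1" using \<theta>(1) len by auto
    then have kK: "K \<le> k" using l1(2)[of \<theta> k] k by force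
    from k have small: "f (\<theta> - real k * \<Omega>) < x1 / A ^ k"
      by (simp add: field_simps)
    then have "f (\<theta> - real k * \<Omega>) < e"
      using K(1)[OF kK] by simp
    then obtain z and j :: int where z: "z \<in> Z" "\<bar>\<theta> - real k * \<Omega> - (z + 2 * pi * of_int j)\<bar> < s"
      using str(6) by blast
    let ?t = "\<bar>\<theta> - real k * \<Omega> - (z + 2 * pi * of_int j)\<bar>"
    have "C z * ?t ^ m z < x1 / A ^ k"
      using str(7)[OF z] small by linarith
    then have "?t ^ m z < x1 / (C z * A ^ k)"
      using str(5)[OF z(1)] by (simp add: field_simps)
    then have "?t < r z k"
      unfolding r_def by (intro less_root_if_power_less str(4) z) auto
    then have "\<bar>\<theta> - y z k j\<bar> < r z k"
      by (simp add: y_def algebra_simps)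
    then show ?thesis using z(1) kK by blast
  qed
  \<comment> \<open>Otherwise the upper bound at the zero gives \<open>f (\<alpha> - real k *
    \<Omega>) < R * \<rho> ^ m z * x1 / A ^ k\<close>, which is at most
    \<open>x3 / A ^ k\<close>.\<close>
  have away: "\<rho> * r z k \<le> \<bar>\<alpha> - y z k j\<bar>" if z: "z \<in> Z" and k: "K \<le> k" for z k j
  proof (rule ccontr)
    assume less: "\<not> ?thesis"
    let ?t = "\<bar>\<alpha> - real k * \<Omega> - (z + 2 * pi * of_int j)\<bar>"
    have t: "?t = \<bar>\<alpha> - y z k j\<bar>" by (simp add: y_def algebra_simps)
    then have "?t < \<rho> * r z k" "?t < s"
      using less K(2)[OF k z] by auto
    then have "f (\<alpha> - real k * \<Omega>) \<le> R * C z * ?t ^ m z"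
      using str(7)[OF z, of "\<alpha> - real k * \<Omega>" j] by simp
    also have "?t ^ m z < (\<rho> * r z k) ^ m z"
      using \<open>?t < \<rho> * r z k\<close> str(4)[OF z] by (intro power_strict_mono) auto
    then have "R * C z * ?t ^ m z < R * C z * (\<rho> * r z k) ^ m z"
      using R str(5)[OF z] by simp
    also have "(\<rho> * r z k) ^ m z = \<rho> ^ m z * (x1 / (C z * A ^ k))"
      unfolding r_def power_mult_distrib using x(1) str(4,5)[OF z]
      by (subst real_root_pow_pos2) (auto intro!: divide_nonneg_pos)
    also have "R * C z * (\<rho> ^ m z * (x1 / (C z * A ^ k))) = \<rho> ^ m z * (R * x1 / A ^ k)"
      using str(5)[OF z] by (simp add: field_simps)
    also have "\<dots> \<le> R * (R * x1 / A ^ k)"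
      using \<rho>(2)[OF z] R x by (intro mult_right_mono) (auto intro!: divide_nonneg_pos)
    also have "\<dots> = x3 / A ^ k" using R by simp
    finally have "A ^ k * f (\<alpha> - real k * \<Omega>) < x3"
      by (simp add: field_simps)
    then show False using \<alpha> by (auto simp: above_def not_le[symmetric])
  qed
  have right: "\<alpha> < y z k j" "(\<rho> - 1) * r z k < u - \<alpha>" "y z k j - \<alpha> < u - \<alpha> + r z k"
    if z: "z \<in> Z" and k: "K \<le> k" and u: "\<alpha> < u" "\<bar>u - y z k j\<bar> < r z k" for z k j u
  proof -
    have "1 * r z k < \<rho> * r z k"
      using \<rho>(1) r_pos[OF z] by (intro mult_strict_right_mono) auto
    then show "\<alpha> < y z k j" "(\<rho> - 1) * r z k < u - \<alpha>" "y z k j - \<alpha> < u - \<alpha> + r z k"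
      using away[OF z k, of j] u by (auto simp: abs_if left_diff_distrib split: if_splits)
  qed
  have bounded_r: "r z k < len / (\<rho> - 1)" "\<alpha> < y z k j" "y z k j < \<alpha> + C1 * len"
    if z: "z \<in> Z" and k: "K \<le> k" and u: "\<alpha> < u" "u < \<alpha> + len" "\<bar>u - y z k j\<bar> < r z k" for z k j u
  proof -
    note ri = right[OF z k u(1,3)]
    have "(\<rho> - 1) * r z k < len" using ri(2) u(2) by simp
    then show rl: "r z k < len / (\<rho> - 1)" using \<rho> by (simp add: field_simps)
    show "\<alpha> < y z k j" by (rule ri)
    have "y z k j < \<alpha> + len + len / (\<rho> - 1)" using ri(3) rl u(2) by simp
    then show "y z k j < \<alpha> + C1 * len" by (simp add: C1_def distrib_right)
  qed
  define hits where "hits z k \<longleftrightarrow> K \<le> k \<and> (\<exists>j. \<exists>u. \<alpha> < u \<and> u < \<alpha> + len \<and> \<bar>u - y z k j\<bar> < r z k)" for z k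
  define j0 where "j0 z k = (SOME j. \<exists>u. \<alpha> < u \<and> u < \<alpha> + len \<and> \<bar>u - y z k j\<bar> < r z k)" for z k
  have j0: "j = j0 z k" if z: "z \<in> Z" and k: "K \<le> k"
    and u: "\<alpha> < u" "u < \<alpha> + len" "\<bar>u - y z k j\<bar> < r z k" for z k j u
  proof -
    have "\<exists>u. \<alpha> < u \<and> u < \<alpha> + len \<and> \<bar>u - y z k (j0 z k)\<bar> < r z k"
      unfolding j0_def by (rule someI[of _ j]) (use u in blast)
    then obtain u' where u': "\<alpha> < u'" "u' < \<alpha> + len" "\<bar>u' - y z k (j0 z k)\<bar> < r z k" by blast
    have "\<bar>y z k j - y z k (j0 z k)\<bar> < 2 * pi"
      using bounded_r[OF z k u] bounded_r[OF z k u'] len(5) by (auto simp: abs_if)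
    also have "y z k j - y z k (j0 z k) = 2 * pi * of_int (j - j0 z k)"
      by (simp add: y_def algebra_simps)
    finally have "\<bar>real_of_int (j - j0 z k)\<bar> < 1"
      by (simp add: abs_mult)
    then show ?thesis by linarith
  qed
  \<comment> \<open>The first time at which an interval of \<open>z\<close> hits. A second hit
    within \<open>Q\<close> steps would bring two centres closer than
    \<open>\<gamma>\<close>.\<close>
  define k0 where "k0 z = (LEAST k. hits z k)" for z
  have k0: "hits z (k0 z)" "k = k0 z \<or> k0 z + Q < k" if z: "z \<in> Z" and h: "hits z k" for z k
  proof -
    show h0: "hits z (k0 z)" unfolding k0_def by (rule LeastI) (rule h)
    have le: "k0 z \<le> k" unfolding k0_def by (rule Least_le) (rule h)
    show "k = k0 z \<or> k0 z + Q < k"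
    proof (rule ccontr)
      assume "\<not> ?thesis"
      then have d: "0 < k - k0 z" "k - k0 z \<le> Q" using le by auto
      from h obtain j u where u: "K \<le> k" "\<alpha> < u" "u < \<alpha> + len" "\<bar>u - y z k j\<bar> < r z k"
        by (auto simp: hits_def)
      from h0 obtain j' u' where u': "K \<le> k0 z" "\<alpha> < u'" "u' < \<alpha> + len" "\<bar>u' - y z (k0 z) j'\<bar> < r z (k0 z)"
        by (auto simp: hits_def)
      have "\<bar>y z k j - y z (k0 z) j'\<bar> < \<gamma>"
        using bounded_r[OF z u] bounded_r[OF z u'] len(4) by (auto simp: abs_if)
      also have "y z k j - y z (k0 z) j' = real (k - k0 z) * \<Omega> + 2 * pi * of_int (j - j')"
        using le by (simp add: y_def algebra_simps of_nat_diff)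
      finally show False using \<gamma>(2)[OF d, of "j - j'"] by simp
    qed
  qed
  \<comment> \<open>The gaps between consecutive annuli have ratio \<open>q\<close> as well, so by
    the choice of \<open>q\<close> no single interval can cross one.\<close>
  define a where "a i = {\<alpha> + len * q ^ (2 * i + 1) <..< \<alpha> + len * q ^ (2 * i)}" for i
  have a_sub: "\<alpha> < u \<and> u < \<alpha> + len" if "u \<in> a i" for u i
  proof -
    have "0 < len * q ^ (2 * i + 1)" using len(1) q by simp
    moreover have "len * q ^ (2 * i) \<le> len * 1"
      using len(1) q by (intro mult_left_mono power_le_one) auto
    ultimately show ?thesis using that by (auto simp: a_def)
  qed
  have one_annulus: "\<not> i < i'"
    if z: "z \<in> Z" and k: "K \<le> k" and v: "v \<in> a i" "\<bar>v - y z k j\<bar> < r z k"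
      and u: "u \<in> a i'" "\<bar>u - y z k j\<bar> < r z k" for z k i i' u v j
  proof
    assume ii: "i < i'"
    have "\<alpha> < u" using a_sub[OF u(1)] by simp
    have ri: "(\<rho> - 1) * r z k < u - \<alpha>" by (rule right(2)[OF z k \<open>\<alpha> < u\<close> u(2)])
    have "v - u < 2 * r z k" using u(2) v(2) by linarith
    then have "(\<rho> - 1) * (v - u) < (\<rho> - 1) * (2 * r z k)"
      using \<rho> by (intro mult_strict_left_mono) auto
    then have "(\<rho> - 1) * (v - \<alpha>) < (\<rho> + 1) * (u - \<alpha>)"
      using ri by (simp add: algebra_simps)
    then have 1: "q * (v - \<alpha>) < u - \<alpha>"
      using \<rho> by (simp add: q_def field_simps)
    have "u - \<alpha> < len * q ^ (2 * i')" using u(1) by (auto simp: a_def)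
    also have "\<dots> \<le> len * q ^ (2 * i + 2)"
      using len(1) q ii by (intro mult_left_mono power_decreasing) auto
    also have "\<dots> = q * (len * q ^ (2 * i + 1))" by simp
    also have "\<dots> < q * (v - \<alpha>)"
      using v(1) q by (intro mult_strict_left_mono) (auto simp: a_def)
    finally show False using 1 by simp
  qed
  \<comment> \<open>The only annulus that the first interval of \<open>z\<close> may meet, or an
    arbitrary index if it meets none.\<close>
  define idx where "idx z = (SOME i. \<exists>u\<in>a i. \<bar>u - y z (k0 z) (j0 z (k0 z))\<bar> < r z (k0 z))" for z
  have "card (idx ` Z) < card {..n}"
    using card_image_le[OF str(1), of idx] by (simp add: n_def)
  then have "\<not> {..n} \<subseteq> idx ` Z"
    using str(1) by (metis card_mono finite_imageI not_le)
  then obtain i where i: "i \<le> n" "i \<notin> idx ` Z" by auto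
  \<comment> \<open>First intervals do not meet annulus \<open>i\<close>; the later ones are
    numbered by their delay \<open>d\<close> beyond \<open>k0 z + Q\<close>.\<close>
  have small_needle: "\<exists>d. \<bar>\<theta> - y z (k0 z + Q + d) (j0 z (k0 z + Q + d))\<bar> < len / (\<rho> - 1) * \<beta> ^ Q * \<beta> ^ d"
    if z: "z \<in> Z" and k: "K \<le> k" and \<theta>: "\<theta> \<in> a i" "\<bar>\<theta> - y z k j\<bar> < r z k" for z k j \<theta>
  proof -
    note as = conjunct1[OF a_sub[OF \<theta>(1)]] conjunct2[OF a_sub[OF \<theta>(1)]]
    have h: "hits z k" using as k \<theta>(2) by (auto simp: hits_def)
    have jj: "j = j0 z k" by (rule j0[OF z k as \<theta>(2)])
    note k0h = k0[OF z h]
    have "k \<noteq> k0 z"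
    proof
      assume kk: "k = k0 z"
      have "\<exists>u\<in>a (idx z). \<bar>u - y z (k0 z) (j0 z (k0 z))\<bar> < r z (k0 z)"
        unfolding idx_def by (rule someI[of _ i]) (use \<theta> kk jj in auto)
      then obtain u where u: "u \<in> a (idx z)" "\<bar>u - y z k j\<bar> < r z k"
        using kk jj by auto
      have "\<not> i < idx z" "\<not> idx z < i"
        using one_annulus[OF z k \<theta> u] one_annulus[OF z k u \<theta>] by auto
      then show False using i(2) z by auto
    qed
    then have "k = k0 z + Q + (k - k0 z - Q)" using k0h(2) by simp
    then obtain d where d: "k = k0 z + Q + d" by blast
    obtain j' u' where u': "K \<le> k0 z" "\<alpha> < u'" "u' < \<alpha> + len" "\<bar>u' - y z (k0 z) j'\<bar> < r z (k0 z)"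
      using k0h(1) by (auto simp: hits_def)
    have "r z k \<le> r z (k0 z) * \<beta> ^ (Q + d)"
      using r_shrink[OF z, of "k0 z" "Q + d"] by (simp add: d add.assoc)
    also have "\<dots> \<le> len / (\<rho> - 1) * \<beta> ^ (Q + d)"
      using bounded_r(1)[OF z u'] \<beta> by (intro mult_right_mono) auto
    finally have "\<bar>\<theta> - y z k j\<bar> < len / (\<rho> - 1) * \<beta> ^ Q * \<beta> ^ d"
      using \<theta>(2) by (simp add: power_add mult.assoc)
    then show ?thesis using d jj by auto
  qed
  show ?thesis
  proof
    assume neg: "negligible ({\<alpha><..<\<alpha> + l} \<inter> above x1)"
    define P where "P z d = y z (k0 z + Q + d) (j0 z (k0 z + Q + d))" for z d
    define r' where "r' z d = len / (\<rho> - 1) * \<beta> ^ Q * \<beta> ^ d" for z :: real and d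
    have sub: "{\<alpha> + len * q ^ (2 * i + 1) <..< \<alpha> + len * q ^ (2 * i)} \<subseteq>
        ({\<alpha><..<\<alpha> + l} \<inter> above x1) \<union> (\<Union>z\<in>Z. \<Union>d. {P z d - r' z d <..< P z d + r' z d})"
    proof
      fix \<theta> assume "\<theta> \<in> {\<alpha> + len * q ^ (2 * i + 1) <..< \<alpha> + len * q ^ (2 * i)}"
      then have \<theta>: "\<theta> \<in> a i" by (simp add: a_def)
      show "\<theta> \<in> ({\<alpha><..<\<alpha> + l} \<inter> above x1) \<union> (\<Union>z\<in>Z. \<Union>d. {P z d - r' z d <..< P z d + r' z d})"
      proof (cases "\<theta> \<in> above x1")
        case True
        then show ?thesis using a_sub[OF \<theta>] len(2) by auto
      next
        case False
        obtain z k j where zkj: "z \<in> Z" "K \<le> k" "\<bar>\<theta> - y z k j\<bar> < r z k"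
          using needle[OF _ False] a_sub[OF \<theta>] by auto
        obtain d where "\<bar>\<theta> - P z d\<bar> < r' z d"
          using small_needle[OF zkj(1,2) \<theta> zkj(3)] by (auto simp: P_def r'_def)
        then show ?thesis
          using zkj(1) by (auto simp: abs_less_iff intro!: bexI[of _ z] exI[of _ d])
      qed
    qed
    have r'_nonneg: "0 \<le> r' z d" for z d
      using len(1) \<rho> \<beta> by (simp add: r'_def)
    have sums: "r' z sums (len / (\<rho> - 1) * \<beta> ^ Q * (1 / (1 - \<beta>)))" for z
      unfolding r'_def using \<beta> by (intro sums_mult geometric_sums) auto
    have "(\<alpha> + len * q ^ (2 * i)) - (\<alpha> + len * q ^ (2 * i + 1)) \<le> (\<Sum>z\<in>Z. 2 * (\<Sum>d. r' z d))"
      by (rule interval_cover_length[OF sub neg str(1) r'_nonneg sums_summable[OF sums]])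
    also have "\<dots> = real n * (2 * (len / (\<rho> - 1) * \<beta> ^ Q * (1 / (1 - \<beta>))))"
      by (simp add: sums_unique[OF sums, symmetric] n_def)
    also have "\<dots> = len * (real n * (2 * (\<beta> ^ Q / ((\<rho> - 1) * (1 - \<beta>)))))"
      by simp
    also have "\<dots> < len * (q ^ (2 * n) * (1 - q))"
      using Q len(1) by (intro mult_strict_left_mono)
    also have "\<dots> \<le> len * (q ^ (2 * i) * (1 - q))"
      using len(1) q i(1) by (intro mult_left_mono mult_right_mono power_decreasing) auto
    also have "\<dots> = (\<alpha> + len * q ^ (2 * i)) - (\<alpha> + len * q ^ (2 * i + 1))"
      by (simp add: algebra_simps)
    finally show False by simp
  qed
qed

end

subsection \<open>Limits of iterates over an irrational rotation\<close>

text \<open>The image under \<open>f\<close> of Lebesgue measure on a bounded interval is a finite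
  measure, hence has only countably many atoms. This allows generic levels to be chosen.\<close>

lemma countable_nonnegligible_levels:
  fixes f :: "real \<Rightarrow> real"
  assumes "continuous_on UNIV f"
  shows "countable {y. \<not> negligible {x. f x = y}}"
proof -
  have f [measurable]: "f \<in> borel_measurable borel"
    using assms by (rule borel_measurable_continuous_onI)
  define D where "D n = distr (restrict_space lborel {- real n..real n}) borel f" for n
  have [measurable]: "f \<in> borel_measurable (restrict_space lborel {- real n..real n})" for n
    by (intro measurable_restrict_space1) simp
  have "finite_measure (restrict_space lborel {- real n..real n})" for n
    by (intro finite_measureI) (simp add: emeasure_restrict_space space_restrict_space)
  then have fin: "finite_measure (D n)" for n
    unfolding D_def by (intro finite_measure.finite_measure_distr) simp_all
  have "countable (\<Union>n. {y. measure (D n) {y} \<noteq> 0})"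
    using finite_measure.countable_support[OF fin] by (intro countable_UN) auto
  moreover have "{y. \<not> negligible {x. f x = y}} \<subseteq> (\<Union>n. {y. measure (D n) {y} \<noteq> 0})"
  proof clarify
    fix y assume y: "\<not> negligible {x. f x = y}"
    show "y \<in> (\<Union>n. {y. measure (D n) {y} \<noteq> 0})"
    proof (rule ccontr)
      assume "y \<notin> (\<Union>n. {y. measure (D n) {y} \<noteq> 0})"
      then have "measure (D n) {y} = 0" for n by auto
      then have 0: "emeasure (D n) {y} = 0" for n
        by (simp add: finite_measure.emeasure_eq_measure[OF fin])
      have "negligible ({- real n..real n} \<inter> {x. f x = y})" for n
      proof -
        have "emeasure (D n) {y} =
            emeasure (restrict_space lborel {- real n..real n}) (f -` {y} \<inter> {- real n..real n})"
          unfolding D_def by (subst emeasure_distr) (simp_all add: space_restrict_space)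
        also have "\<dots> = emeasure lborel (f -` {y} \<inter> {- real n..real n})"
          by (intro emeasure_restrict_space) auto
        also have "f -` {y} \<inter> {- real n..real n} = {- real n..real n} \<inter> {x. f x = y}" by auto
        finally have "{- real n..real n} \<inter> {x. f x = y} \<in> null_sets lborel"
          using 0[of n] by (intro null_setsI) auto
        then show ?thesis
          by (simp add: negligible_iff_null_sets null_sets_completionI)
      qed
      then have "negligible (\<Union>n. {- real n..real n} \<inter> {x. f x = y})"
        by (rule negligible_Union_nat)
      moreover have "{x. f x = y} \<subseteq> (\<Union>n. {- real n..real n} \<inter> {x. f x = y})"
      proof clarify
        fix x assume "y = f x"
        moreover obtain n :: nat where "\<bar>x\<bar> \<le> real n"
          using real_arch_simple by blast
        ultimately show "x \<in> (\<Union>n. {- real n..real n} \<inter> {x'. f x' = f x})"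
          by (intro UN_I[of n]) auto
      qed
      ultimately show False
        using y negligible_subset by blast
    qed
  qed
  ultimately show ?thesis
    by (rule countable_subset[rotated])
qed

text \<open>For measurable \<open>G\<close> this is the support of Lebesgue measure restricted to
  \<open>G\<close>. Being closed, it is a set to which Baire's theorem applies.\<close>

definition negligible_support :: "real set \<Rightarrow> real set" where
  "negligible_support G = {x. \<forall>e>0. \<not> negligible (G \<inter> ball x e)}"

lemma closed_negligible_support: "closed (negligible_support G)"
proof -
  have "\<exists>e>0. ball x e \<subseteq> - negligible_support G" if "x \<in> - negligible_support G" for x
  proof -
    obtain e where e: "0 < e" "negligible (G \<inter> ball x e)"
      using \<open>x \<in> - negligible_support G\<close> by (auto simp: negligible_support_def)
    have "ball x (e / 2) \<subseteq> - negligible_support G"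
    proof
      fix u assume "u \<in> ball x (e / 2)"
      then have "ball u (e / 2) \<subseteq> ball x e"
        using dist_triangle[of x _ u] by (force intro: order.strict_trans1)
      then have "negligible (G \<inter> ball u (e / 2))"
        using negligible_subset[OF e(2)] by blast
      then show "u \<in> - negligible_support G"
        using e(1) by (auto simp: negligible_support_def intro!: exI[of _ "e / 2"])
    qed
    then show ?thesis
      using e(1) by (intro exI[of _ "e / 2"]) auto
  qed
  then have "open (- negligible_support G)"
    unfolding open_contains_ball by auto
  then show ?thesis by (simp add: closed_def)
qed

text \<open>A set that is locally null is null.\<close>

lemma negligible_off_support: "negligible (G - negligible_support G)"
proof (subst locally_negligible_alt, intro ballI)
  fix x assume x: "x \<in> G - negligible_support G"
  then obtain e where e: "0 < e" "negligible (G \<inter> ball x e)"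
    by (auto simp: negligible_support_def)
  show "\<exists>U. openin (top_of_set (G - negligible_support G)) U \<and> x \<in> U \<and> negligible U"
  proof (intro exI[of _ "(G - negligible_support G) \<inter> ball x e"] conjI)
    show "openin (top_of_set (G - negligible_support G)) ((G - negligible_support G) \<inter> ball x e)"
      by (intro openin_open_Int) simp
    show "negligible ((G - negligible_support G) \<inter> ball x e)"
      by (rule negligible_subset[OF e(2)]) auto
  qed (use x e in auto)
qed

text \<open>Selects generic points: the part of \<open>G\<close> off its support and the exceptional
  set \<open>N\<close> are together null, so they cannot exhaust \<open>G\<close> near
  \<open>x\<close>.\<close>

lemma nonnegligible_near_support:
  assumes "x \<in> negligible_support G" "0 < e" "negligible N"
  shows "\<exists>u\<in>G \<inter> negligible_support G \<inter> ball x e. u \<notin> N"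
proof (rule ccontr)
  assume "\<not> ?thesis"
  then have "G \<inter> ball x e \<subseteq> N \<union> (G - negligible_support G)" by auto
  then have "negligible (G \<inter> ball x e)"
    using assms(3) negligible_off_support negligible_Un negligible_subset by metis
  then show False using assms(1,2) by (auto simp: negligible_support_def)
qed

section \<open>Iterates, their pointwise limit and the flat part\<close>

context rotated_zeros
begin

text \<open>Rotating back by \<open>\<Omega>\<close> shifts \<open>k\<close> by one and turns
  membership in \<open>above c\<close> into membership in \<open>above (c / A)\<close>; one step of
  the iteration restores the factor \<open>A\<close>.\<close>

lemma iterate_ge:
  assumes l0: "l 0 = f" and lower: "\<And>n \<theta>. min (A * l n \<theta>) (f (\<theta> + \<Omega>)) \<le> l (Suc n) (\<theta> + \<Omega>)"
    and "\<theta> \<in> above c"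
  shows "c \<le> l n \<theta>"
  using assms(3)
proof (induction n arbitrary: \<theta> c)
  case 0
  then have "c \<le> A ^ 0 * f (\<theta> - real 0 * \<Omega>)"
    unfolding above_def by blast
  then show ?case by (simp add: l0)
next
  case (Suc n)
  have "c \<le> A ^ 0 * f (\<theta> - real 0 * \<Omega>)"
    using Suc.prems unfolding above_def by blast
  moreover have "\<theta> - \<Omega> \<in> above (c / A)"
    unfolding above_def
  proof clarify
    fix k
    have "c \<le> A ^ Suc k * f (\<theta> - real (Suc k) * \<Omega>)"
      using Suc.prems unfolding above_def by blast
    then show "c / A \<le> A ^ k * f (\<theta> - \<Omega> - real k * \<Omega>)"
      by (simp add: field_simps)
  qed
  then have "c / A \<le> l n (\<theta> - \<Omega>)" by (rule Suc.IH)
  then have "c \<le> A * l n (\<theta> - \<Omega>)" by (simp add: field_simps)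
  ultimately show ?case using lower[of n "\<theta> - \<Omega>"] by simp
qed

lemma iterate_le:
  assumes l0: "l 0 = f" and upper: "\<And>n \<theta>. l (Suc n) (\<theta> + \<Omega>) \<le> A * l n \<theta>"
  shows "l n \<theta> \<le> A ^ n * f (\<theta> - real n * \<Omega>)"
proof (induction n arbitrary: \<theta>)
  case (Suc n)
  have "l (Suc n) \<theta> \<le> A * l n (\<theta> - \<Omega>)"
    using upper[of n "\<theta> - \<Omega>"] by simp
  also have "\<dots> \<le> A * (A ^ n * f (\<theta> - \<Omega> - real n * \<Omega>))"
    by (intro mult_left_mono Suc less_imp_le A_pos)
  also have "\<dots> = A ^ Suc n * f (\<theta> - real (Suc n) * \<Omega>)"
    by (simp add: algebra_simps)
  finally show ?case .
qed (simp add: l0)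

text \<open>
  If almost no value of the limit \<open>L\<close> lies in \<open>[x1, x2]\<close>, then on the support \<open>K\<close> of \<open>above x1\<close> the
  limit is almost everywhere larger than \<open>x2\<close>.  By Baire's theorem the iterates then stay away from
  \<open>x1\<close> on an open piece of \<open>K\<close>, and \<open>above_recurs\<close> at the boundary of a gap of \<open>K\<close> shows that the
  gap is not a gap.
\<close>

lemma limit_takes_intermediate_values:
  assumes l0: "l 0 = f" and lcont: "\<And>n. continuous_on UNIV (l n)"
    and lower: "\<And>n \<theta>. min (A * l n \<theta>) (f (\<theta> + \<Omega>)) \<le> l (Suc n) (\<theta> + \<Omega>)"
    and upper: "\<And>n \<theta>. l (Suc n) (\<theta> + \<Omega>) \<le> A * l n \<theta>"
    and lim: "\<And>\<theta>. (\<lambda>n. l n \<theta>) \<longlonglongrightarrow> L \<theta>"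
    and z0: "f z0 = 0"
    and x: "0 < x1" "x1 < x2" and levels: "\<And>k. negligible {\<theta>. A ^ k * f (\<theta> - real k * \<Omega>) = x1}"
    and G: "\<not> negligible (above x1 \<inter> ball c0 \<eta>)"
  shows "\<not> negligible {\<theta> \<in> ball c0 \<eta>. x1 \<le> L \<theta> \<and> L \<theta> \<le> x2}"
proof
  assume neg: "negligible {\<theta> \<in> ball c0 \<eta>. x1 \<le> L \<theta> \<and> L \<theta> \<le> x2}"
  define G where "G = above x1 \<inter> ball c0 \<eta>"
  define K where "K = negligible_support G"
  have closed: "closed K" unfolding K_def by (rule closed_negligible_support)
  have K_above: "K \<subseteq> above x1"
  proof
    fix u assume u: "u \<in> K"
    have "u \<in> closure (above x1)"
      unfolding closure_approachable
    proof safe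
      fix e :: real assume "0 < e"
      then obtain v where "v \<in> G" "v \<in> ball u e"
        using nonnegligible_near_support[of u G e "{}"] u by (auto simp: K_def)
      then show "\<exists>y\<in>above x1. dist y u < e"
        by (auto simp: G_def dist_commute)
    qed
    then show "u \<in> above x1" using closed_above by simp
  qed
  have L_ge: "x1 \<le> L \<theta>" if "\<theta> \<in> above x1" for \<theta>
    using iterate_ge[OF l0 lower that] by (intro tendsto_lowerbound[OF lim]) auto
  \<comment> \<open>On almost all of \<open>G\<close> the limit exceeds \<open>x2\<close>, and
    \<open>G\<close> is nonnegligible near each point of \<open>K\<close>.\<close>
  have L_big: "\<exists>u\<in>K \<inter> ball v e. x2 < L u" if v: "v \<in> K" and e: "0 < e" for v e
  proof -
    obtain u where u: "u \<in> G \<inter> K \<inter> ball v e" "u \<notin> {\<theta> \<in> ball c0 \<eta>. x1 \<le> L \<theta> \<and> L \<theta> \<le> x2}"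
      using nonnegligible_near_support[of v G e, OF _ e neg] v unfolding K_def by blast
    then have "x2 < L u"
      using L_ge[of u] by (auto simp: G_def)
    then show ?thesis using u by blast
  qed
  define x3 where "x3 = (x1 + x2) / 2"
  have x3: "x1 < x3" "x3 < x2" using x by (auto simp: x3_def)
  \<comment> \<open>Points with a late iterate below \<open>x3\<close>, respectively above
    \<open>x2\<close>. Were both sets dense in \<open>K\<close> for every \<open>N\<close>, Baire's
    theorem would give a point where the iterates forever oscillate between these levels and so do
    not converge.\<close>
  define D where "D N = {\<theta> \<in> K. \<exists>n\<ge>N. l n \<theta> < x3}" for N :: nat
  define E where "E N = {\<theta> \<in> K. \<exists>n\<ge>N. x2 < l n \<theta>}" for N :: nat
  have openin_D: "openin (top_of_set K) (D N)" for N
  proof -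
    have "D N = K \<inter> (\<Union>n\<in>{N..}. {\<theta>. l n \<theta> < x3})" by (auto simp: D_def)
    then show ?thesis
      by (simp only:) (intro openin_open_Int open_UN ballI open_Collect_less lcont continuous_intros)
  qed
  have openin_E: "openin (top_of_set K) (E N)" for N
  proof -
    have "E N = K \<inter> (\<Union>n\<in>{N..}. {\<theta>. x2 < l n \<theta>})" by (auto simp: E_def)
    then show ?thesis
      by (simp only:) (intro openin_open_Int open_UN ballI open_Collect_less lcont continuous_intros)
  qed
  have dense_E: "K \<subseteq> closure (E N)" for N
  proof
    fix v assume v: "v \<in> K"
    show "v \<in> closure (E N)"
      unfolding closure_approachable
    proof safe
      fix e :: real assume "0 < e"
      then obtain u where u: "u \<in> K" "u \<in> ball v e" "x2 < L u"
        using L_big[OF v] by blast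
      have "\<forall>\<^sub>F n in sequentially. x2 < l n u"
        using order_tendstoD(1)[OF lim u(3)] .
      then have "\<forall>\<^sub>F n in sequentially. N \<le> n \<and> x2 < l n u"
        using eventually_ge_at_top[of N] by eventually_elim auto
      then obtain n where "N \<le> n" "x2 < l n u"
        using eventually_happens' sequentially_bot by blast
      then show "\<exists>y\<in>E N. dist y v < e"
        using u by (auto simp: E_def dist_commute)
    qed
  qed
  have K_ne: "K \<noteq> {}"
    using G negligible_off_support[of G] by (auto simp: K_def G_def)
  have "\<exists>N. \<not> K \<subseteq> closure (D N)"
  proof (rule ccontr)
    assume "\<not> ?thesis"
    then have dense_D: "K \<subseteq> closure (D N)" for N by blast
    have "K \<subseteq> closure (\<Inter>(range D \<union> range E))"
    proof (rule Baire[OF closed])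
      fix T assume "T \<in> range D \<union> range E"
      then show "openin (top_of_set K) T \<and> K \<subseteq> closure T"
        using openin_D openin_E dense_D dense_E by blast
    qed auto
    then have "\<Inter>(range D \<union> range E) \<noteq> {}" using K_ne by auto
    then obtain \<theta> where "\<theta> \<in> \<Inter>(range D \<union> range E)" by blast
    then have \<theta>: "\<theta> \<in> D N" "\<theta> \<in> E N" for N
      by (simp_all add: ball_Un)
    have "\<forall>\<^sub>F n in sequentially. x3 \<le> l n \<theta>" if "x3 < L \<theta>"
      using order_tendstoD(1)[OF lim that] by eventually_elim auto
    moreover have "\<forall>\<^sub>F n in sequentially. l n \<theta> \<le> x2" if "L \<theta> < x2"
      using order_tendstoD(2)[OF lim that] by eventually_elim auto
    moreover have "\<not> (\<forall>\<^sub>F n in sequentially. x3 \<le> l n \<theta>)" "\<not> (\<forall>\<^sub>F n in sequentially. l n \<theta> \<le> x2)"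
      using \<theta> unfolding D_def E_def eventually_sequentially by (auto simp: not_le)
    ultimately show False using x3(2) by linarith
  qed
  then obtain N p where p: "p \<in> K" "p \<notin> closure (D N)" by blast
  then obtain e where e: "0 < e" "\<And>u n. \<lbrakk>u \<in> K; dist u p < e; N \<le> n\<rbrakk> \<Longrightarrow> x3 \<le> l n u"
    unfolding closure_approachable D_def by (force simp: not_le)
  \<comment> \<open>By the assumption on levels there is a point \<open>w\<close> of
    \<open>K\<close> at which no condition of \<open>above x1\<close> is an equality, so that the
    first \<open>N\<close> of them hold strictly on a neighbourhood.\<close>
  have "negligible (\<Union>k. {\<theta>. A ^ k * f (\<theta> - real k * \<Omega>) = x1})"
    by (rule negligible_Union_nat) (rule levels)
  then obtain w where w: "w \<in> G" "w \<in> K" "w \<in> ball p e" "\<And>k. A ^ k * f (w - real k * \<Omega>) \<noteq> x1"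
    using nonnegligible_near_support[of p G e] p(1) e(1) unfolding K_def by blast
  have w': "x1 < A ^ k * f (w - real k * \<Omega>)" for k
    using w(1,4) by (auto simp: G_def above_def less_le)
  have "\<forall>\<^sub>F \<theta> in nhds w. x1 < A ^ k * f (\<theta> - real k * \<Omega>)" for k
  proof (rule order_tendstoD(1)[OF _ w'])
    show "((\<lambda>\<theta>. A ^ k * f (\<theta> - real k * \<Omega>)) \<longlongrightarrow> A ^ k * f (w - real k * \<Omega>)) (nhds w)"
      using continuous_on_scaled[of k]
      by (intro tendsto_at_iff_tendsto_nhds[THEN iffD1]) (simp add: continuous_on_eq_continuous_at isCont_def)
  qed
  then have "\<forall>\<^sub>F \<theta> in nhds w. \<forall>k\<in>{..<N}. x1 < A ^ k * f (\<theta> - real k * \<Omega>)"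
    by (intro eventually_ball_finite) auto
  moreover have "\<forall>\<^sub>F \<theta> in nhds w. \<theta> \<in> ball p e \<inter> ball c0 \<eta>"
    using w(1,3) by (intro eventually_nhds_in_open) (auto simp: G_def)
  ultimately have "\<forall>\<^sub>F \<theta> in nhds w. (\<forall>k\<in>{..<N}. x1 < A ^ k * f (\<theta> - real k * \<Omega>)) \<and> \<theta> \<in> ball p e \<inter> ball c0 \<eta>"
    by eventually_elim auto
  then obtain \<rho> where \<rho>: "0 < \<rho>" "\<And>\<theta> k. \<lbrakk>\<bar>\<theta> - w\<bar> < \<rho>; k < N\<rbrakk> \<Longrightarrow> x1 < A ^ k * f (\<theta> - real k * \<Omega>)"
    "\<And>\<theta>. \<bar>\<theta> - w\<bar> < \<rho> \<Longrightarrow> dist \<theta> p < e \<and> \<theta> \<in> ball c0 \<eta>"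
    unfolding eventually_nhds_metric dist_real_def by (auto simp: dist_real_def abs_minus_commute)
  \<comment> \<open>A forward rotate of the zero \<open>z0\<close> just to the right of
    \<open>w\<close> is outside \<open>above x1\<close>, hence outside \<open>K\<close>.\<close>
  obtain n j where nj: "w < z0 + real n * \<Omega> + 2 * pi * of_int j" "z0 + real n * \<Omega> + 2 * pi * of_int j < w + \<rho>"
    using rotation_orbit_dense[OF irrational, of w "w + \<rho>" z0] \<rho>(1) by auto
  define y where "y = z0 + real n * \<Omega> + 2 * pi * of_int j"
  have y: "w < y" "y < w + \<rho>" using nj by (auto simp: y_def)
  have "f (y - real n * \<Omega>) = f z0"
    using periodic_2pi_int[OF per, of z0 j] by (simp add: y_def)
  then have "\<not> x1 \<le> A ^ n * f (y - real n * \<Omega>)" using z0 x(1) by simp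
  then have y_notin: "y \<notin> K" using K_above unfolding above_def by blast
  \<comment> \<open>The last point of \<open>K\<close> before \<open>y\<close>, that is, the left
    end of a gap of \<open>K\<close>.\<close>
  define \<alpha> where "\<alpha> = Sup (K \<inter> {w..y})"
  have bdd: "bdd_above (K \<inter> {w..y})" by auto
  have "\<alpha> \<in> K \<inter> {w..y}"
    unfolding \<alpha>_def using w(2) y(1) closed bdd
    by (intro closed_contains_Sup closed_Int) auto
  then have \<alpha>: "\<alpha> \<in> K" "w \<le> \<alpha>" "\<alpha> < y"
    using y_notin by (auto simp: less_le)
  have gap: "u \<notin> K" if "\<alpha> < u" "u < y" for u
  proof
    assume "u \<in> K"
    then have "u \<le> \<alpha>" unfolding \<alpha>_def using that \<alpha>(2) by (intro cSup_upper bdd) auto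
    then show False using that by simp
  qed
  have \<alpha>_near: "\<bar>\<alpha> - w\<bar> < \<rho>" using \<alpha> y by auto
  \<comment> \<open>Times \<open>k < N\<close> are controlled by the choice of
    \<open>\<rho>\<close>, later ones by \<open>x3 \<le> l k \<alpha> \<le> A ^ k * f (\<alpha> -
    real k * \<Omega>)\<close>; so \<open>\<alpha>\<close> lies in a strictly higher superlevel set,
    as \<open>above_recurs\<close> demands.\<close>
  obtain x4 where x4: "x1 < x4" "\<alpha> \<in> above x4"
  proof -
    define x4 where "x4 = Min (insert x3 ((\<lambda>k. A ^ k * f (\<alpha> - real k * \<Omega>)) ` {..<N}))"
    have "x1 < x4" unfolding x4_def using x3 \<rho>(2)[OF \<alpha>_near] by simp
    moreover have "\<alpha> \<in> above x4"
      unfolding above_def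
    proof clarify
      fix k
      show "x4 \<le> A ^ k * f (\<alpha> - real k * \<Omega>)"
      proof (cases "k < N")
        case True
        then show ?thesis unfolding x4_def by (intro Min_le) auto
      next
        case False
        have "x4 \<le> x3" unfolding x4_def by (intro Min_le) auto
        also have "x3 \<le> l k \<alpha>" using e(2)[OF \<alpha>(1)] \<rho>(3)[OF \<alpha>_near] False by auto
        also have "l k \<alpha> \<le> A ^ k * f (\<alpha> - real k * \<Omega>)" by (rule iterate_le[OF l0 upper])
        finally show ?thesis .
      qed
    qed
    ultimately show thesis by (rule that)
  qed
  have "\<not> negligible ({\<alpha><..<\<alpha> + (y - \<alpha>)} \<inter> above x1)"
    using \<alpha>(3) by (intro above_recurs[OF x(1) x4]) simp
  moreover have "{\<alpha><..<\<alpha> + (y - \<alpha>)} \<inter> above x1 \<subseteq> G - K"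
  proof
    fix u assume u: "u \<in> {\<alpha><..<\<alpha> + (y - \<alpha>)} \<inter> above x1"
    then have "\<bar>u - w\<bar> < \<rho>" using \<alpha> y by auto
    then show "u \<in> G - K" using u gap[of u] \<rho>(3)[of u] by (auto simp: G_def)
  qed
  ultimately show False
    using negligible_off_support[of G] negligible_subset unfolding K_def by blast
qed

text \<open>Limit values are multiplied by \<open>A\<close> along the rotation as long as the
  product stays below \<open>f\<close>. Near a point of \<open>above c\<close> in its support, a
  narrow range of values below \<open>c\<close> is taken on a nonnegligible set and carried along
  for \<open>i\<close> steps, after which one more factor \<open>A\<close> lands in the window of
  width \<open>\<kappa>\<close> above \<open>f\<close>.\<close>

lemma limit_enters_flat_part:
  assumes l0: "l 0 = f" and lcont: "\<And>n. continuous_on UNIV (l n)"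
    and lower: "\<And>n \<theta>. min (A * l n \<theta>) (f (\<theta> + \<Omega>)) \<le> l (Suc n) (\<theta> + \<Omega>)"
    and upper: "\<And>n \<theta>. l (Suc n) (\<theta> + \<Omega>) \<le> A * l n \<theta>"
    and lim: "\<And>\<theta>. (\<lambda>n. l n \<theta>) \<longlonglongrightarrow> L \<theta>"
    and z0: "f z0 = 0" and \<kappa>: "0 < \<kappa>"
  shows "\<not> negligible {\<theta>. f (\<theta> + \<Omega>) < A * L \<theta> \<and> A * L \<theta> < f (\<theta> + \<Omega>) + \<kappa>}"
proof
  assume neg: "negligible {\<theta>. f (\<theta> + \<Omega>) < A * L \<theta> \<and> A * L \<theta> < f (\<theta> + \<Omega>) + \<kappa>}"
    (is "negligible ?P")
  obtain c where c: "0 < c" "\<not> negligible (above c)"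
    by (rule above_nonnegligible)
  obtain t where t: "t \<in> above c" "\<And>e. 0 < e \<Longrightarrow> \<not> negligible (above c \<inter> ball t e)"
  proof -
    have "\<not> above c \<subseteq> above c - negligible_support (above c)"
      using c(2) negligible_off_support negligible_subset by blast
    then show thesis using that unfolding negligible_support_def by blast
  qed
  obtain B where B: "0 < B" "\<And>x. \<bar>f x\<bar> \<le> B"
    by (rule periodic_2pi_bounded[OF cont per]) (rule that)
  have "\<exists>i. f (t + real (Suc i) * \<Omega>) < A ^ Suc i * c"
  proof -
    obtain i where i: "B / c < A ^ i" using real_arch_pow[OF expanding] by blast
    have "A ^ i \<le> A ^ Suc i" using expanding by (intro power_increasing) auto
    then have "B / c < A ^ Suc i" using i by linarith
    then have "B < A ^ Suc i * c" using c(1) by (simp add: pos_divide_less_eq)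
    then show ?thesis using B(2)[of "t + real (Suc i) * \<Omega>"] by (intro exI[of _ i]) linarith
  qed
  \<comment> \<open>The expansion of the value \<open>c\<close>, started at \<open>t\<close>,
    exceeds \<open>f\<close> for the first time at step \<open>Suc i\<close>.\<close>
  define i where "i = (LEAST i. f (t + real (Suc i) * \<Omega>) < A ^ Suc i * c)"
  have i: "f (t + real (Suc i) * \<Omega>) < A ^ Suc i * c"
    unfolding i_def by (rule LeastI_ex) fact
  have i_least: "A ^ Suc k * c \<le> f (t + real (Suc k) * \<Omega>)" if "k < i" for k
    using not_less_Least[OF that[unfolded i_def]] by (simp add: not_less)
  \<comment> \<open>After \<open>Suc i\<close> expansions \<open>xl\<close> becomes exactly
    \<open>f (t + real (Suc i) * \<Omega>)\<close>; \<open>xu\<close> keeps the overshoot below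
    \<open>\<kappa>\<close> and the value below \<open>c\<close>.\<close>
  define xl where "xl = f (t + real (Suc i) * \<Omega>) / A ^ Suc i"
  define xu where "xu = min c (xl + \<kappa> / A ^ Suc i)"
  have "0 \<le> xl" unfolding xl_def using nonneg by (intro divide_nonneg_pos) auto
  have "xl < c" using i unfolding xl_def by (simp add: pos_divide_less_eq mult.commute del: power_Suc)
  moreover have "0 < \<kappa> / A ^ Suc i" using \<kappa> by (intro divide_pos_pos) auto
  ultimately have "xl < xu" by (simp add: xu_def)
  \<comment> \<open>Only countably many values have a nonnegligible level set for some
    \<open>k\<close>, so \<open>x1\<close> can avoid them.\<close>
  have "countable (\<Union>k. {y. \<not> negligible {\<theta>. A ^ k * f (\<theta> - real k * \<Omega>) = y}})"
    by (intro countable_UN countable_nonnegligible_levels continuous_on_scaled) auto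
  then have "\<not> {xl<..<xu} \<subseteq> (\<Union>k. {y. \<not> negligible {\<theta>. A ^ k * f (\<theta> - real k * \<Omega>) = y}})"
    using uncountable_open_interval[of xl xu] \<open>xl < xu\<close> countable_subset by blast
  then obtain x1 where x1: "x1 \<in> {xl<..<xu}" "\<And>k. negligible {\<theta>. A ^ k * f (\<theta> - real k * \<Omega>) = x1}"
    by blast
  define x2 where "x2 = (x1 + xu) / 2"
  have x2: "x1 < x2" "x2 < xu" using x1(1) by (auto simp: x2_def)
  have scaled: "f (t + real (Suc i) * \<Omega>) < A ^ Suc i * x1" "A ^ Suc i * x2 < f (t + real (Suc i) * \<Omega>) + \<kappa>" "x2 < c"
  proof -
    show "f (t + real (Suc i) * \<Omega>) < A ^ Suc i * x1"
      using x1(1)[THEN greaterThanLessThan_iff[THEN iffD1, THEN conjunct1]] unfolding xl_def by (simp add: pos_divide_less_eq mult.commute del: power_Suc)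
    have "x2 < (f (t + real (Suc i) * \<Omega>) + \<kappa>) / A ^ Suc i"
      using x2(2) unfolding xu_def xl_def add_divide_distrib by simp
    then show "A ^ Suc i * x2 < f (t + real (Suc i) * \<Omega>) + \<kappa>"
      by (simp add: pos_less_divide_eq mult.commute del: power_Suc)
    show "x2 < c" using x2(2) by (simp add: xu_def)
  qed
  have ft: "((\<lambda>\<theta>. f (\<theta> + s)) \<longlongrightarrow> f (t + s)) (nhds t)" for s
  proof -
    have "continuous_on UNIV (\<lambda>\<theta>. f (\<theta> + s))"
      by (intro continuous_on_compose2[OF cont] continuous_intros) auto
    then show ?thesis
      by (intro tendsto_at_iff_tendsto_nhds[THEN iffD1]) (simp add: continuous_on_eq_continuous_at isCont_def)
  qed
  have "\<forall>\<^sub>F \<theta> in nhds t. f (\<theta> + real (Suc i) * \<Omega>) < A ^ Suc i * x1"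
    by (rule order_tendstoD(2)[OF ft scaled(1)])
  moreover have "\<forall>\<^sub>F \<theta> in nhds t. A ^ Suc i * x2 - \<kappa> < f (\<theta> + real (Suc i) * \<Omega>)"
    using scaled(2) by (intro order_tendstoD(1)[OF ft]) linarith
  moreover have "\<forall>\<^sub>F \<theta> in nhds t. \<forall>k\<in>{..<i}. A ^ Suc k * x2 < f (\<theta> + real (Suc k) * \<Omega>)"
  proof (intro eventually_ball_finite ballI order_tendstoD(1)[OF ft])
    fix k assume "k \<in> {..<i}"
    have "A ^ Suc k * x2 < A ^ Suc k * c" using scaled(3) by (intro mult_strict_left_mono) auto
    also have "\<dots> \<le> f (t + real (Suc k) * \<Omega>)" using i_least \<open>k \<in> {..<i}\<close> by blast
    finally show "A ^ Suc k * x2 < f (t + real (Suc k) * \<Omega>)" .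
  qed simp
  ultimately have "\<forall>\<^sub>F \<theta> in nhds t. f (\<theta> + real (Suc i) * \<Omega>) < A ^ Suc i * x1 \<and>
      A ^ Suc i * x2 - \<kappa> < f (\<theta> + real (Suc i) * \<Omega>) \<and>
      (\<forall>k\<in>{..<i}. A ^ Suc k * x2 < f (\<theta> + real (Suc k) * \<Omega>))"
    by eventually_elim auto
  then obtain \<eta> where \<eta>: "0 < \<eta>"
    "\<And>\<theta>. \<theta> \<in> ball t \<eta> \<Longrightarrow> f (\<theta> + real (Suc i) * \<Omega>) < A ^ Suc i * x1"
    "\<And>\<theta>. \<theta> \<in> ball t \<eta> \<Longrightarrow> A ^ Suc i * x2 - \<kappa> < f (\<theta> + real (Suc i) * \<Omega>)"
    "\<And>\<theta> k. \<theta> \<in> ball t \<eta> \<Longrightarrow> k < i \<Longrightarrow> A ^ Suc k * x2 < f (\<theta> + real (Suc k) * \<Omega>)"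
    unfolding eventually_nhds_metric by (auto simp: dist_commute)
  \<comment> \<open>Where the limit is not truncated, the lower and upper bounds for the iterates
    converge to the same value.\<close>
  have L_step: "L (\<theta> + \<Omega>) = A * L \<theta>" if "A * L \<theta> \<le> f (\<theta> + \<Omega>)" for \<theta>
  proof (rule antisym)
    have lim': "(\<lambda>n. l (Suc n) (\<theta> + \<Omega>)) \<longlonglongrightarrow> L (\<theta> + \<Omega>)"
      by (rule LIMSEQ_Suc[OF lim])
    have limA: "(\<lambda>n. A * l n \<theta>) \<longlonglongrightarrow> A * L \<theta>"
      by (intro tendsto_intros lim)
    show "L (\<theta> + \<Omega>) \<le> A * L \<theta>"
      by (rule LIMSEQ_le[OF lim' limA]) (use upper in blast)
    have "(\<lambda>n. min (A * l n \<theta>) (f (\<theta> + \<Omega>))) \<longlonglongrightarrow> min (A * L \<theta>) (f (\<theta> + \<Omega>))"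
      by (intro tendsto_min limA tendsto_const)
    then have "min (A * L \<theta>) (f (\<theta> + \<Omega>)) \<le> L (\<theta> + \<Omega>)"
      by (rule LIMSEQ_le[OF _ lim']) (use lower in blast)
    then show "A * L \<theta> \<le> L (\<theta> + \<Omega>)" using that by simp
  qed
  have L_iter: "L (\<theta> + real k * \<Omega>) = A ^ k * L \<theta>"
    if \<theta>: "\<theta> \<in> ball t \<eta>" "L \<theta> \<le> x2" and "k \<le> i" for \<theta> k
    using \<open>k \<le> i\<close>
  proof (induction k)
    case (Suc k)
    then have IH: "L (\<theta> + real k * \<Omega>) = A ^ k * L \<theta>" by simp
    have eq: "\<theta> + real k * \<Omega> + \<Omega> = \<theta> + real (Suc k) * \<Omega>" by (simp add: algebra_simps)
    have "A * L (\<theta> + real k * \<Omega>) = A ^ Suc k * L \<theta>" by (simp add: IH)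
    also have "\<dots> \<le> A ^ Suc k * x2" by (intro mult_left_mono \<theta>(2) less_imp_le A_pos)
    also have "\<dots> \<le> f (\<theta> + real k * \<Omega> + \<Omega>)"
      using \<eta>(4)[OF \<theta>(1), of k] Suc.prems unfolding eq by simp
    finally have "L (\<theta> + real k * \<Omega> + \<Omega>) = A * L (\<theta> + real k * \<Omega>)" by (rule L_step)
    then show ?case unfolding eq by (simp add: IH)
  qed simp
  \<comment> \<open>Rotation by \<open>real i * \<Omega>\<close> preserves null sets and carries
    these points into \<open>?P\<close>.\<close>
  have "{\<theta> \<in> ball t \<eta>. x1 \<le> L \<theta> \<and> L \<theta> \<le> x2} \<subseteq> (+) (- real i * \<Omega>) ` ?P"
  proof clarify
    fix \<theta> assume \<theta>: "\<theta> \<in> ball t \<eta>" "x1 \<le> L \<theta>" "L \<theta> \<le> x2"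
    have eq: "\<theta> + real i * \<Omega> + \<Omega> = \<theta> + real (Suc i) * \<Omega>" by (simp add: algebra_simps)
    have Li: "A * L (\<theta> + real i * \<Omega>) = A ^ Suc i * L \<theta>"
      using L_iter[OF \<theta>(1,3), of i] by simp
    have "A ^ Suc i * x1 \<le> A ^ Suc i * L \<theta>" "A ^ Suc i * L \<theta> \<le> A ^ Suc i * x2"
      using \<theta>(2,3) by (auto intro!: mult_left_mono simp del: power_Suc)
    then have "\<theta> + real i * \<Omega> \<in> ?P"
      unfolding mem_Collect_eq eq Li using \<eta>(2,3)[OF \<theta>(1)] by linarith
    then show "\<theta> \<in> (+) (- real i * \<Omega>) ` ?P"
      by (intro image_eqI[of _ _ "\<theta> + real i * \<Omega>"]) simp_all
  qed
  then have "negligible {\<theta> \<in> ball t \<eta>. x1 \<le> L \<theta> \<and> L \<theta> \<le> x2}"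
    using negligible_translation[OF neg] negligible_subset by blast
  moreover have "\<not> negligible (above x1 \<inter> ball t \<eta>)"
  proof -
    have "x1 \<le> c" using x2 scaled(3) by simp
    have "above c \<subseteq> above x1"
    proof
      fix u assume "u \<in> above c"
      then have "c \<le> A ^ k * f (u - real k * \<Omega>)" for k
        by (simp add: above_def)
      then show "u \<in> above x1"
        unfolding above_def by (intro CollectI allI order_trans[OF \<open>x1 \<le> c\<close>])
    qed
    then show ?thesis using t(2)[OF \<eta>(1)] negligible_subset by blast
  qed
  moreover have "0 < x1" using x1(1) \<open>0 \<le> xl\<close> by simp
  ultimately show False
    using limit_takes_intermediate_values[OF l0 lcont lower upper lim z0 _ x2(1) x1(2), of t \<eta>]
    by simp
qed

end

subsection \<open>Real analytic periodic functions\<close>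

text \<open>The power series at \<open>x0\<close> extends to a holomorphic function on a complex
  disc, and Cauchy's inequality then bounds the Taylor coefficients at all nearby centres at
  once.\<close>

lemma real_analytic_local_expansions:
  assumes "real_analytic g"
  obtains r B where "0 < r" "0 \<le> B" "\<And>x. \<bar>x - x0\<bar> < r \<Longrightarrow>
      \<exists>c. (\<forall>n. \<bar>c n\<bar> \<le> B / r ^ n) \<and> (\<forall>t. \<bar>t\<bar> < r \<longrightarrow> (\<lambda>n. c n * t ^ n) sums g (x + t))"
proof -
  obtain e c0 where e: "0 < e" and c0: "\<And>x. \<bar>x - x0\<bar> < e \<Longrightarrow> (\<lambda>n. c0 n * (x - x0) ^ n) sums g x"
    using assms unfolding real_analytic_def by metis
  define X where "X = complex_of_real x0"
  define G where "G w = (\<Sum>n. complex_of_real (c0 n) * (w - X) ^ n)" for w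
  have G_sums: "(\<lambda>n. complex_of_real (c0 n) * (w - X) ^ n) sums G w" if "w \<in> ball X e" for w
  proof -
    obtain s where s: "norm (w - X) < s" "s < e"
      using \<open>w \<in> ball X e\<close> dense by (auto simp: dist_norm norm_minus_commute)
    then have "0 < s" using norm_ge_zero[of "w - X"] by linarith
    then have "summable (\<lambda>n. c0 n * (x0 + s - x0) ^ n)"
      using c0[of "x0 + s"] s(2) sums_summable by auto
    then have "summable (\<lambda>n. complex_of_real (c0 n * s ^ n))"
      by (intro summable_of_real) simp
    then have "summable (\<lambda>n. complex_of_real (c0 n) * complex_of_real s ^ n)" by simp
    then have "summable (\<lambda>n. complex_of_real (c0 n) * (w - X) ^ n)"
      by (rule powser_inside) (use s \<open>0 < s\<close> in auto)
    then show ?thesis unfolding G_def by (rule summable_sums)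
  qed
  have hol: "G holomorphic_on ball X e"
    by (rule power_series_holomorphic[OF G_sums])
  have G_real: "G (complex_of_real x) = complex_of_real (g x)" if "\<bar>x - x0\<bar> < e" for x
  proof -
    have "(\<lambda>n. complex_of_real (c0 n * (x - x0) ^ n)) sums complex_of_real (g x)"
      by (rule sums_of_real[OF c0[OF that]])
    then have "(\<lambda>n. complex_of_real (c0 n) * (complex_of_real x - X) ^ n) sums complex_of_real (g x)"
      by (simp add: X_def)
    moreover have "complex_of_real x \<in> ball X e"
      using that by (simp add: X_def dist_norm abs_minus_commute flip: of_real_diff)
    ultimately show ?thesis using G_sums sums_unique2 by blast
  qed
  \<comment> \<open>Discs of radius \<open>2 * r\<close> around points within \<open>r\<close> of
    \<open>x0\<close> stay inside the disc of radius \<open>e\<close>.\<close>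
  define r where "r = e / 4"
  have r: "0 < r" using e by (simp add: r_def)
  have cont_G: "continuous_on (cball X (2 * r)) G"
    using e by (intro continuous_on_subset[OF holomorphic_on_imp_continuous_on[OF hol]]) (auto simp: r_def)
  have "bounded (G ` cball X (2 * r))"
    by (intro compact_imp_bounded compact_continuous_image cont_G compact_cball)
  then obtain B where B: "0 < B" "\<forall>w\<in>cball X (2 * r). norm (G w) \<le> B"
    unfolding bounded_pos by auto
  show thesis
  proof (rule that[OF r less_imp_le[OF B(1)]])
    fix x assume x: "\<bar>x - x0\<bar> < r"
    define x' where "x' = complex_of_real x"
    have dx: "dist X x' < r"
      using x by (simp add: X_def x'_def dist_norm abs_minus_commute flip: of_real_diff)
    have in_ball: "w \<in> ball X e" if "dist x' w \<le> 2 * r" for w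
      using dist_triangle[of X w x'] dx that e by (auto simp: r_def)
    have hol': "G holomorphic_on ball x' (2 * r)"
      by (rule holomorphic_on_subset[OF hol]) (use in_ball in auto)
    define d where "d n = (deriv ^^ n) G x' / fact n" for n
    have d_le: "norm (d n) \<le> B / r ^ n" for n
    proof -
      have "norm ((deriv ^^ n) G x') \<le> fact n * B / r ^ n"
      proof (rule Cauchy_inequality[OF _ _ r])
        show "G holomorphic_on ball x' r"
          using r by (intro holomorphic_on_subset[OF hol'] subset_ball) simp
        show "continuous_on (cball x' r) G"
          using r in_ball
          by (intro continuous_on_subset[OF holomorphic_on_imp_continuous_on[OF hol]]) force
        fix w assume "norm (x' - w) = r"
        then have "w \<in> cball X (2 * r)"
          using dist_triangle[of X w x'] dx by (simp add: dist_norm)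
        then show "norm (G w) \<le> B" using B(2) by blast
      qed
      then show ?thesis by (simp add: d_def norm_divide field_simps)
    qed
    show "\<exists>c. (\<forall>n. \<bar>c n\<bar> \<le> B / r ^ n) \<and> (\<forall>t. \<bar>t\<bar> < r \<longrightarrow> (\<lambda>n. c n * t ^ n) sums g (x + t))"
    proof (intro exI[of _ "\<lambda>n. Re (d n)"] conjI allI impI)
      fix n show "\<bar>Re (d n)\<bar> \<le> B / r ^ n"
        using abs_Re_le_cmod d_le order_trans by blast
    next
      fix t :: real assume t: "\<bar>t\<bar> < r"
      have "x' + of_real t \<in> ball x' (2 * r)" using t r by (simp add: dist_norm)
      from holomorphic_power_series[OF hol' this]
      have "(\<lambda>n. d n * of_real t ^ n) sums G (x' + of_real t)" by (simp add: d_def)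
      moreover have "G (x' + of_real t) = of_real (g (x + t))"
      proof -
        have "\<bar>x + t - x0\<bar> < e" using x t e unfolding r_def by linarith
        then show ?thesis using G_real[of "x + t"] by (simp add: x'_def)
      qed
      ultimately have "(\<lambda>n. Re (d n * of_real t ^ n)) sums g (x + t)"
        using sums_Re by fastforce
      then show "(\<lambda>n. Re (d n) * t ^ n) sums g (x + t)"
        by (simp flip: of_real_power)
    qed
  qed
qed

text \<open>A finite subcover of one period makes radius and bound uniform; periodicity covers the
  rest.\<close>

lemma real_analytic_uniform_expansions:
  assumes an: "real_analytic g" and per: "periodic_2pi g"
  obtains r B where "0 < r" "0 \<le> B" "\<And>x.
      \<exists>c. (\<forall>n. \<bar>c n\<bar> \<le> B / r ^ n) \<and> (\<forall>t. \<bar>t\<bar> < r \<longrightarrow> (\<lambda>n. c n * t ^ n) sums g (x + t))"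
proof -
  define E where "E r B x \<longleftrightarrow>
      (\<exists>c. (\<forall>n. \<bar>c n\<bar> \<le> B / r ^ n) \<and> (\<forall>t. \<bar>t\<bar> < r \<longrightarrow> (\<lambda>n. c n * t ^ n) sums g (x + t)))" for r B x
  have "\<forall>x0. \<exists>r B. 0 < r \<and> 0 \<le> B \<and> (\<forall>x. \<bar>x - x0\<bar> < r \<longrightarrow> E r B x)"
  proof
    fix x0
    obtain r B where "0 < r" "0 \<le> B" "\<And>x. \<bar>x - x0\<bar> < r \<Longrightarrow> E r B x"
      by (rule real_analytic_local_expansions[OF an, of x0, folded E_def]) (rule that)
    then show "\<exists>r B. 0 < r \<and> 0 \<le> B \<and> (\<forall>x. \<bar>x - x0\<bar> < r \<longrightarrow> E r B x)" by blast
  qed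
  then obtain r B where rB: "\<And>x0. 0 < r x0" "\<And>x0. 0 \<le> B x0"
    "\<And>x0 x. \<bar>x - x0\<bar> < r x0 \<Longrightarrow> E (r x0) (B x0) x"
    by metis
  have cover: "{0..2 * pi} \<subseteq> (\<Union>x\<in>{0..2 * pi}. ball x (r x))"
    using rB(1) by auto
  obtain X where X: "X \<subseteq> {0..2 * pi}" "finite X" "{0..2 * pi} \<subseteq> (\<Union>x\<in>X. ball x (r x))"
    by (rule compactE_image[OF compact_Icc _ cover]) (simp, rule that)
  have "X \<noteq> {}" using X(3) by force
  define r' where "r' = Min (r ` X)"
  define B' where "B' = Max (B ` X)"
  have r': "0 < r'" "\<And>x. x \<in> X \<Longrightarrow> r' \<le> r x"
    using X(2) \<open>X \<noteq> {}\<close> rB(1) by (auto simp: r'_def)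
  have B': "\<And>x. x \<in> X \<Longrightarrow> B x \<le> B'"
    using X(2) by (auto simp: B'_def)
  then have B'0: "0 \<le> B'" using \<open>X \<noteq> {}\<close> rB(2) order_trans by (metis ex_in_conv)
  show thesis
  proof (rule that[OF r'(1) B'0])
    fix x
    obtain j :: int where j: "x - 2 * pi * of_int j \<in> {0..<2 * pi}"
      by (rule obtain_2pi_representative)
    then have "x - 2 * pi * of_int j \<in> (\<Union>x\<in>X. ball x (r x))"
      by (intro subsetD[OF X(3)]) auto
    then obtain x0 where x0: "x0 \<in> X" "\<bar>x - 2 * pi * of_int j - x0\<bar> < r x0"
      by (auto simp: dist_real_def abs_minus_commute)
    obtain c where c: "\<And>n. \<bar>c n\<bar> \<le> B x0 / r x0 ^ n"
      "\<And>t. \<bar>t\<bar> < r x0 \<Longrightarrow> (\<lambda>n. c n * t ^ n) sums g (x - 2 * pi * of_int j + t)"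
      using rB(3)[OF x0(2)] unfolding E_def by blast
    have "g (x - 2 * pi * of_int j + t) = g (x + t)" for t
      using periodic_2pi_int[OF per, of "x - 2 * pi * of_int j + t" j] by (simp add: algebra_simps)
    moreover have "B x0 / r x0 ^ n \<le> B' / r' ^ n" for n
      using r'(1) r'(2)[OF x0(1)] B'[OF x0(1)] B'0 by (intro frac_le power_mono) auto
    ultimately show "\<exists>c. (\<forall>n. \<bar>c n\<bar> \<le> B' / r' ^ n) \<and>
        (\<forall>t. \<bar>t\<bar> < r' \<longrightarrow> (\<lambda>n. c n * t ^ n) sums g (x + t))"
      using c r'(2)[OF x0(1)] by (intro exI[of _ c]) (fastforce intro: order_trans)
  qed
qed

text \<open>Neumann series: for \<open>\<bar>u\<bar> < 1\<close> and bounded \<open>g\<close> it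
  solves \<open>v x - u * v (x + \<omega>) = g x\<close>.\<close>

definition orbit_sum :: "real \<Rightarrow> real \<Rightarrow> (real \<Rightarrow> real) \<Rightarrow> real \<Rightarrow> real" where
  "orbit_sum u \<omega> g x = (\<Sum>k. u ^ k * g (x + real k * \<omega>))"

text \<open>Uniform radius and coefficient bounds along the orbit of \<open>x0\<close> dominate the
  double series by a product of two geometric series, so that summation over \<open>k\<close> and
  over the powers of \<open>t\<close> can be exchanged.\<close>

lemma real_analytic_orbit_sum:
  assumes an: "real_analytic g" and per: "periodic_2pi g" and u: "\<bar>u\<bar> < 1"
  shows "real_analytic (orbit_sum u \<omega> g)"
  unfolding real_analytic_def
proof
  fix x0
  obtain r B where rB: "0 < r" "0 \<le> B" and ex: "\<And>x.
      \<exists>c. (\<forall>n. \<bar>c n\<bar> \<le> B / r ^ n) \<and> (\<forall>t. \<bar>t\<bar> < r \<longrightarrow> (\<lambda>n. c n * t ^ n) sums g (x + t))"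
    by (rule real_analytic_uniform_expansions[OF an per]) (rule that)
  obtain c where c: "\<And>k n. \<bar>c k n\<bar> \<le> B / r ^ n"
    "\<And>k t. \<bar>t\<bar> < r \<Longrightarrow> (\<lambda>n. c k n * t ^ n) sums g (x0 + real k * \<omega> + t)"
    using ex[of "x0 + real _ * \<omega>"] by metis
  define d where "d n = (\<Sum>k. u ^ k * c k n)" for n
  have "(\<lambda>n. d n * t ^ n) sums orbit_sum u \<omega> g (x0 + t)" if t: "\<bar>t\<bar> < r" for t
  proof -
    define q where "q = \<bar>t\<bar> / r"
    have q: "0 \<le> q" "q < 1" using t rB(1) by (auto simp: q_def)
    define F where "F k n = u ^ k * (c k n * t ^ n)" for k n
    have F_le: "\<bar>F k n\<bar> \<le> \<bar>u\<bar> ^ k * B * q ^ n" for k n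
    proof -
      have "\<bar>F k n\<bar> = \<bar>u\<bar> ^ k * (\<bar>c k n\<bar> * \<bar>t\<bar> ^ n)"
        by (simp add: F_def abs_mult power_abs)
      also have "\<dots> \<le> \<bar>u\<bar> ^ k * (B / r ^ n * \<bar>t\<bar> ^ n)"
        by (intro mult_left_mono mult_right_mono c) auto
      finally show ?thesis by (simp add: q_def power_divide)
    qed
    have sum_n: "summable (\<lambda>n. norm (F k n))" for k
      by (rule summable_comparison_test'[where N = 0 and g = "\<lambda>n. \<bar>u\<bar> ^ k * B * q ^ n"])
         (use q F_le in \<open>auto intro!: summable_mult summable_geometric\<close>)
    have sum_k: "summable (\<lambda>k. norm (F k n))" for n
    proof (rule summable_comparison_test'[where N = 0 and g = "\<lambda>k. \<bar>u\<bar> ^ k * (B * q ^ n)"])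
      show "summable (\<lambda>k. \<bar>u\<bar> ^ k * (B * q ^ n))"
        using u by (intro summable_mult2 summable_geometric) auto
    qed (use F_le in \<open>auto simp: mult.assoc\<close>)
    have F_row: "(F k has_sum (u ^ k * g (x0 + t + real k * \<omega>))) UNIV" for k
    proof -
      have "F k sums (u ^ k * g (x0 + real k * \<omega> + t))"
        unfolding F_def by (intro sums_mult c t)
      then show ?thesis
        using norm_summable_imp_has_sum[OF sum_n] by (simp add: add_ac)
    qed
    have F_col: "((\<lambda>k. F k n) has_sum (d n * t ^ n)) UNIV" for n
    proof (rule norm_summable_imp_has_sum[OF sum_k])
      show "(\<lambda>k. F k n) sums (d n * t ^ n)"
      \<comment> \<open>Summability of the coefficient series is obtained by dividing by
        \<open>t ^ n\<close>; where this power is 0, all terms vanish.\<close>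
      proof (cases "t = 0 \<and> 0 < n")
        case True
        then show ?thesis by (simp add: F_def power_0_left)
      next
        case False
        then have "t ^ n \<noteq> 0" by auto
        have "summable (\<lambda>k. F k n)" by (rule summable_norm_cancel[OF sum_k])
        then have sm: "summable (\<lambda>k. F k n * (1 / t ^ n))" by (rule summable_mult2)
        have eq: "F k n * (1 / t ^ n) = u ^ k * c k n" for k
        proof -
          have "F k n * (1 / t ^ n) = (u ^ k * c k n) * t ^ n / t ^ n"
            by (simp only: F_def mult.assoc times_divide_eq_right mult_1_right)
          also have "\<dots> = u ^ k * c k n"
            by (rule nonzero_mult_div_cancel_right) fact
          finally show ?thesis .
        qed
        have "summable (\<lambda>k. u ^ k * c k n)" using sm unfolding eq .
        then have "(\<lambda>k. u ^ k * c k n * t ^ n) sums (d n * t ^ n)"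
          unfolding d_def by (intro sums_mult2 summable_sums)
        then show ?thesis by (simp add: F_def mult.assoc)
      qed
    qed
    have abs_F: "(\<lambda>x. norm (case x of (k, n) \<Rightarrow> F k n)) summable_on UNIV \<times> UNIV"
    proof (rule Infinite_Sum.abs_summable_on_Sigma_iff[THEN iffD2], intro conjI ballI)
      fix k :: nat
      show "(\<lambda>n. norm (case (k, n) of (k, n) \<Rightarrow> F k n)) summable_on UNIV"
        using sum_n by (simp add: summable_on_UNIV_nonneg_real_iff)
    next
      have row_le: "infsum (\<lambda>n. norm (F k n)) UNIV \<le> \<bar>u\<bar> ^ k * (B * (1 / (1 - q)))" for k
      proof -
        have geo: "(\<lambda>n. \<bar>u\<bar> ^ k * B * q ^ n) sums (\<bar>u\<bar> ^ k * B * (1 / (1 - q)))"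
          using q by (intro sums_mult geometric_sums) auto
        have "infsum (\<lambda>n. norm (F k n)) UNIV = (\<Sum>n. norm (F k n))"
          using sum_n by (intro infsumI norm_summable_imp_has_sum) (auto simp: summable_sums)
        also have "\<dots> \<le> (\<Sum>n. \<bar>u\<bar> ^ k * B * q ^ n)"
          using F_le sum_n sums_summable[OF geo] by (intro suminf_le) auto
        finally show ?thesis using geo by (simp add: sums_iff mult.assoc)
      qed
      have nonneg: "0 \<le> infsum (\<lambda>n. norm (F k n)) UNIV" for k
        by (intro infsum_nonneg) auto
      have "summable (\<lambda>k. infsum (\<lambda>n. norm (F k n)) UNIV)"
      proof (rule summable_comparison_test'[where N = 0 and g = "\<lambda>k. \<bar>u\<bar> ^ k * (B * (1 / (1 - q)))"])
        show "summable (\<lambda>k. \<bar>u\<bar> ^ k * (B * (1 / (1 - q))))"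
          using u by (intro summable_mult2 summable_geometric) auto
        show "norm (infsum (\<lambda>n. norm (F k n)) UNIV) \<le> \<bar>u\<bar> ^ k * (B * (1 / (1 - q)))" for k
          using row_le[of k] nonneg[of k] by simp
      qed
      then show "(\<lambda>k. norm (\<Sum>\<^sub>\<infinity>n\<in>UNIV. norm (case (k, n) of (k, n) \<Rightarrow> F k n))) summable_on UNIV"
        using nonneg by (simp add: summable_on_UNIV_nonneg_real_iff)
    qed
    then have F_sum: "(\<lambda>(k, n). F k n) summable_on UNIV \<times> UNIV"
      by (rule abs_summable_summable)
    then have F_sum': "(\<lambda>(n, k). F k n) summable_on UNIV \<times> UNIV"
      by (subst (asm) summable_on_swap) (simp add: case_prod_unfold)
    have "(\<lambda>k. infsum (F k) UNIV) summable_on UNIV"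
      using summable_on_Sigma_banach[OF F_sum] by simp
    then have "((\<lambda>k. u ^ k * g (x0 + t + real k * \<omega>)) has_sum (\<Sum>\<^sub>\<infinity>k. infsum (F k) UNIV)) UNIV"
      by (simp add: infsumI[OF F_row])
    then have s1: "orbit_sum u \<omega> g (x0 + t) = (\<Sum>\<^sub>\<infinity>k. infsum (F k) UNIV)"
      unfolding orbit_sum_def using has_sum_imp_sums sums_unique by metis
    have "(\<lambda>n. infsum (\<lambda>k. F k n) UNIV) summable_on UNIV"
      using summable_on_Sigma_banach[OF F_sum'] by simp
    then have "((\<lambda>n. d n * t ^ n) has_sum (\<Sum>\<^sub>\<infinity>n. infsum (\<lambda>k. F k n) UNIV)) UNIV"
      by (simp add: infsumI[OF F_col])
    moreover have "(\<Sum>\<^sub>\<infinity>n. infsum (\<lambda>k. F k n) UNIV) = (\<Sum>\<^sub>\<infinity>k. infsum (F k) UNIV)"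
      using infsum_swap_banach[OF F_sum] by simp
    ultimately show ?thesis
      using has_sum_imp_sums s1 by metis
  qed
  from this[of "_ - x0"] show "\<exists>\<epsilon>>0. \<exists>c. \<forall>x. \<bar>x - x0\<bar> < \<epsilon> \<longrightarrow> (\<lambda>n. c n * (x - x0) ^ n) sums orbit_sum u \<omega> g x"
    using rB(1) by (intro exI[of _ r] conjI exI[of _ d]) simp_all
qed

text \<open>The first nonzero coefficient is the limit of \<open>f (z + t) / t ^ m\<close>, and
  since \<open>f\<close> is nonnegative, passing to absolute values only removes the sign of
  \<open>t ^ m\<close>. If all coefficients vanish, so does \<open>f\<close> near
  \<open>z\<close>.\<close>

lemma power_series_zero_cases:
  fixes f :: "real \<Rightarrow> real"
  assumes e: "0 < e" and c: "\<And>x. \<bar>x - z\<bar> < e \<Longrightarrow> (\<lambda>n. c n * (x - z) ^ n) sums f x"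
    and z: "f z = 0" and nonneg: "\<And>x. 0 \<le> f x"
  shows "finite_order_zero f z \<or> (\<forall>x. \<bar>x - z\<bar> < e \<longrightarrow> f x = 0)"
proof (cases "\<forall>n. c n = 0")
  case True
  have "f x = 0" if "\<bar>x - z\<bar> < e" for x
    using sums_unique2[OF c[OF that], of 0] True by simp
  then show ?thesis by blast
next
  case False
  define m where "m = (LEAST n. c n \<noteq> 0)"
  have m: "c m \<noteq> 0" unfolding m_def by (rule LeastI_ex) (use False in blast)
  have m_least: "c i = 0" if "i < m" for i
    using not_less_Least[OF that[unfolded m_def]] by simp
  have "c 0 = 0"
    using c[of z] e z by simp
  then have m0: "0 < m" using m by (cases m) auto
  have "((\<lambda>t. f (z + t) / t ^ m) \<longlongrightarrow> c (0 + m)) (at 0)"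
  proof (rule powser_limit_0_strong[OF e])
    fix t :: real assume t: "t \<noteq> 0" "norm t < e"
    have "(\<lambda>n. c n * t ^ n) sums f (z + t)" using c[of "z + t"] t(2) by simp
    then have "(\<lambda>n. c (n + m) * t ^ (n + m)) sums (f (z + t) - (\<Sum>i<m. c i * t ^ i))"
      by (rule sums_split_initial_segment)
    then have "(\<lambda>n. c (n + m) * t ^ (n + m)) sums f (z + t)"
      using m_least by simp
    then have "(\<lambda>n. c (n + m) * t ^ (n + m) / t ^ m) sums (f (z + t) / t ^ m)"
      by (rule sums_divide)
    then show "(\<lambda>n. c (n + m) * t ^ n) sums (f (z + t) / t ^ m)"
      using t(1) by (simp add: power_add)
  qed
  then have "((\<lambda>t. \<bar>f (z + t) / t ^ m\<bar>) \<longlongrightarrow> \<bar>c m\<bar>) (at 0)"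
    by (intro tendsto_rabs) simp
  moreover have "\<bar>f (z + t) / t ^ m\<bar> = f (z + t) / \<bar>z + t - z\<bar> ^ m" for t
    using nonneg[of "z + t"] by (simp add: abs_divide power_abs)
  ultimately have "((\<lambda>t. f (z + t) / \<bar>z + t - z\<bar> ^ m) \<longlongrightarrow> \<bar>c m\<bar>) (at 0)" by simp
  then have "((\<lambda>x. f x / \<bar>x - z\<bar> ^ m) \<longlongrightarrow> \<bar>c m\<bar>) (at z)"
    by (rule LIM_offset_zero_cancel)
  then show ?thesis
    unfolding finite_order_zero_def using m m0 by (intro disjI1 exI[of _ m] exI[of _ "\<bar>c m\<bar>"] conjI) auto
qed

text \<open>Identity theorem: with a zero of infinite order, the set of points near which
  \<open>f\<close> vanishes is nonempty, open and closed, hence the whole line.\<close>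

lemma real_analytic_finite_order_zeros:
  assumes an: "real_analytic f" and nonneg: "\<And>x. 0 \<le> f x" and nonzero: "f p \<noteq> 0" and z: "f z = 0"
  shows "finite_order_zero f z"
proof (rule ccontr)
  assume not_finite: "\<not> finite_order_zero f z"
  define S where "S = {x. \<exists>e>0. \<forall>y. \<bar>y - x\<bar> < e \<longrightarrow> f y = 0}"
  have series: "\<exists>e>0. \<exists>c. \<forall>x. \<bar>x - x0\<bar> < e \<longrightarrow> (\<lambda>n. c n * (x - x0) ^ n) sums f x" for x0
    using an unfolding real_analytic_def by blast
  have cases: "x \<in> S" if "\<not> finite_order_zero f x" "f x = 0" for x
  proof -
    obtain e c where "0 < e" "\<And>y. \<bar>y - x\<bar> < e \<Longrightarrow> (\<lambda>n. c n * (y - x) ^ n) sums f y"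
      using series[of x] by blast
    then show ?thesis
      using power_series_zero_cases[of e x c f, OF _ _ that(2) nonneg] that(1) unfolding S_def by blast
  qed
  have open_S: "open S"
    unfolding open_contains_ball
  proof
    fix x assume "x \<in> S"
    then obtain e where e: "0 < e" "\<And>y. \<bar>y - x\<bar> < e \<Longrightarrow> f y = 0" by (auto simp: S_def)
    have "ball x (e / 2) \<subseteq> S"
    proof
      fix v assume v: "v \<in> ball x (e / 2)"
      have "f y = 0" if "\<bar>y - v\<bar> < e / 2" for y
      proof (rule e(2))
        have "\<bar>x - v\<bar> < e / 2" using v by (simp add: dist_real_def)
        then show "\<bar>y - x\<bar> < e" using that by linarith
      qed
      then show "v \<in> S" unfolding S_def using e(1) by (intro CollectI exI[of _ "e / 2"]) auto
    qed
    then show "\<exists>d>0. ball x d \<subseteq> S" using e(1) by (intro exI[of _ "e / 2"]) auto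
  qed
  \<comment> \<open>A limit point of \<open>S\<close> is a zero by continuity; other zeros
    accumulate at it, which finite order excludes, so the dichotomy for power series puts it in
    \<open>S\<close>.\<close>
  have "closed S"
    unfolding closed_limpt
  proof (intro allI impI)
    fix x assume "x islimpt S"
    then have near: "\<exists>y\<in>S. y \<noteq> x \<and> \<bar>y - x\<bar> < e" if "0 < e" for e
      using that by (auto simp: islimpt_approachable dist_real_def)
    have S0: "f y = 0" if "y \<in> S" for y using that by (auto simp: S_def)
    show "x \<in> S"
    proof (rule cases)
      obtain e c where e: "0 < e" "\<And>y. \<bar>y - x\<bar> < e \<Longrightarrow> (\<lambda>n. c n * (y - x) ^ n) sums f y"
        using series[of x] by blast
      have c0: "f x = c 0" using e(2)[of x] e(1) by simp
      have "((\<lambda>t. f (x + t)) \<longlongrightarrow> f x) (at 0)"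
        unfolding c0 by (rule powser_limit_0[OF e(1)]) (use e(2)[of "x + _"] in simp)
      then have lim: "(f \<longlongrightarrow> f x) (at x)" by (rule LIM_offset_zero_cancel)
      show "f x = 0"
      proof (rule ccontr)
        assume "f x \<noteq> 0"
        then have "\<forall>\<^sub>F y in at x. f y \<noteq> 0" using tendsto_imp_eventually_ne[OF lim] by simp
        then obtain d where "0 < d" "\<And>y. y \<noteq> x \<Longrightarrow> dist y x < d \<Longrightarrow> f y \<noteq> 0"
          unfolding eventually_at by blast
        then show False using near[of d] S0 by (auto simp: dist_real_def)
      qed
      show "\<not> finite_order_zero f x"
      proof
        assume "finite_order_zero f x"
        then obtain m c s where "0 < m" "0 < c" "0 < s"
          "\<And>y. \<bar>y - x\<bar> < s \<Longrightarrow> c * \<bar>y - x\<bar> ^ m \<le> f y \<and> f y \<le> (1 + 1) * c * \<bar>y - x\<bar> ^ m"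
          using finite_order_zero_bounds[of f x 1] \<open>f x = 0\<close> zero_less_one by metis
        moreover obtain y where "y \<in> S" "y \<noteq> x" "\<bar>y - x\<bar> < s"
          using near \<open>0 < s\<close> by blast
        ultimately have "c * \<bar>y - x\<bar> ^ m \<le> 0" "0 < c * \<bar>y - x\<bar> ^ m"
          using S0 by fastforce+
        then show False by simp
      qed
    qed
  qed
  moreover have "z \<in> S" using cases[OF not_finite z] .
  ultimately have "S = UNIV" using open_S clopen by blast
  then have "p \<in> S" by simp
  then show False using nonzero by (auto simp: S_def)
qed

text \<open>Continuity of \<open>q\<close> at \<open>z\<close> supplies the limit; the even exponent
  lets \<open>x - z\<close> be replaced by its absolute value.\<close>

lemma even_order_zeros_finite_order:
  assumes "even_order_zeros f" "f z = 0"
  shows "finite_order_zero f z"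
proof -
  obtain e m q where e: "0 < e" "0 < m" "even m" "continuous_on {z - e<..<z + e} q"
    and q: "\<And>x. x \<in> {z - e<..<z + e} \<Longrightarrow> 0 < q x \<and> f x = (x - z) ^ m * q x"
    using assms unfolding even_order_zeros_def by blast
  have "isCont q z" using e(1,4) by (simp add: continuous_on_eq_continuous_at)
  moreover have "\<forall>\<^sub>F x in at z. f x / \<bar>x - z\<bar> ^ m = q x"
    unfolding eventually_at
  proof (intro exI[of _ e] conjI ballI impI)
    fix x assume x: "x \<noteq> z \<and> dist x z < e"
    then have "x \<in> {z - e<..<z + e}" by (auto simp: dist_real_def)
    then show "f x / \<bar>x - z\<bar> ^ m = q x"
      using q x e(3) by (simp add: power_even_abs)
  qed (rule e(1))
  ultimately have "((\<lambda>x. f x / \<bar>x - z\<bar> ^ m) \<longlongrightarrow> q z) (at z)"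
    unfolding isCont_def by (subst tendsto_cong)
  moreover have "0 < q z" using q[of z] e(1) by simp
  ultimately show ?thesis
    unfolding finite_order_zero_def using e(2) by blast
qed

subsection \<open>The four maps at the bifurcation value\<close>

lemma orbit_sum_summable:
  assumes "\<bar>u\<bar> < 1" "continuous_on UNIV g" "periodic_2pi g"
  shows "summable (\<lambda>k. u ^ k * g (x + real k * \<omega>))"
proof -
  obtain B where B: "0 < B" "\<And>x. \<bar>g x\<bar> \<le> B"
    by (rule periodic_2pi_bounded[OF assms(2,3)]) (rule that)
  show ?thesis
  proof (rule summable_comparison_test'[where N = 0 and g = "\<lambda>k. \<bar>u\<bar> ^ k * B"])
    show "summable (\<lambda>k. \<bar>u\<bar> ^ k * B)"
      using assms(1) by (intro summable_mult2 summable_geometric) auto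
    show "norm (u ^ k * g (x + real k * \<omega>)) \<le> \<bar>u\<bar> ^ k * B" for k
      using B by (simp add: abs_mult power_abs mult_left_mono)
  qed
qed

lemma continuous_orbit_sum:
  assumes u: "\<bar>u\<bar> < 1" and g: "continuous_on UNIV g" "periodic_2pi g"
  shows "continuous_on UNIV (orbit_sum u \<omega> g)"
proof -
  obtain B where B: "0 < B" "\<And>x. \<bar>g x\<bar> \<le> B"
    by (rule periodic_2pi_bounded[OF g]) (rule that)
  have "uniform_limit UNIV (\<lambda>n x. \<Sum>k<n. u ^ k * g (x + real k * \<omega>)) (\<lambda>x. \<Sum>k. u ^ k * g (x + real k * \<omega>)) sequentially"
  proof (rule Weierstrass_m_test[where M = "\<lambda>k. \<bar>u\<bar> ^ k * B"])
    show "summable (\<lambda>k. \<bar>u\<bar> ^ k * B)"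
      using u by (intro summable_mult2 summable_geometric) auto
    show "norm (u ^ k * g (x + real k * \<omega>)) \<le> \<bar>u\<bar> ^ k * B" for k x
      using B by (simp add: abs_mult power_abs mult_left_mono)
  qed
  moreover have "\<forall>\<^sub>F n in sequentially. continuous_on UNIV (\<lambda>x. \<Sum>k<n. u ^ k * g (x + real k * \<omega>))"
    by (intro always_eventually allI continuous_intros continuous_on_compose2[OF g(1)]) auto
  ultimately have "continuous_on UNIV (\<lambda>x. \<Sum>k. u ^ k * g (x + real k * \<omega>))"
    by (intro uniform_limit_theorem) auto
  then show ?thesis by (simp add: orbit_sum_def[abs_def])
qed

lemma orbit_sum_unfold:
  assumes "\<bar>u\<bar> < 1" "continuous_on UNIV g" "periodic_2pi g"
  shows "orbit_sum u \<omega> g x = g x + u * orbit_sum u \<omega> g (x + \<omega>)"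
proof -
  have "orbit_sum u \<omega> g x = (\<Sum>k. u ^ Suc k * g (x + real (Suc k) * \<omega>)) + u ^ 0 * g (x + real 0 * \<omega>)"
    unfolding orbit_sum_def using suminf_split_head[OF orbit_sum_summable[OF assms]] by simp
  also have "(\<Sum>k. u ^ Suc k * g (x + real (Suc k) * \<omega>)) = (\<Sum>k. u * (u ^ k * g (x + \<omega> + real k * \<omega>)))"
    by (simp add: algebra_simps)
  also have "\<dots> = u * orbit_sum u \<omega> g (x + \<omega>)"
    unfolding orbit_sum_def by (intro suminf_mult orbit_sum_summable assms)
  finally show ?thesis by simp
qed

text \<open>Obtained by solving \<open>W (\<theta> + \<omega>) = a * W \<theta> - g \<theta>\<close>
  for \<open>W \<theta>\<close> and iterating forward, which contracts by
  \<open>1 / a\<close>.\<close>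

definition expanding_solution :: "real \<Rightarrow> real \<Rightarrow> (real \<Rightarrow> real) \<Rightarrow> real \<Rightarrow> real" where
  "expanding_solution a \<omega> g \<theta> = orbit_sum (1 / a) \<omega> g \<theta> / a"

lemma expanding_solution:
  assumes a: "1 < \<bar>a\<bar>" and g: "continuous_on UNIV g" "periodic_2pi g"
  shows "continuous_on UNIV (expanding_solution a \<omega> g)"
    and "periodic_2pi (expanding_solution a \<omega> g)"
    and "expanding_solution a \<omega> g (\<theta> + \<omega>) = a * expanding_solution a \<omega> g \<theta> - g \<theta>"
proof -
  have u: "\<bar>1 / a\<bar> < 1" "a \<noteq> 0" using a by auto
  show "continuous_on UNIV (expanding_solution a \<omega> g)"
    unfolding expanding_solution_def[abs_def] using u
    by (intro continuous_intros continuous_orbit_sum g) auto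
  have "g (\<theta> + 2 * pi + real k * \<omega>) = g (\<theta> + real k * \<omega>)" for \<theta> k
    using g(2)[unfolded periodic_2pi_def, rule_format, of "\<theta> + real k * \<omega>"] by (simp add: add_ac)
  then show "periodic_2pi (expanding_solution a \<omega> g)"
    by (simp add: periodic_2pi_def expanding_solution_def orbit_sum_def)
  show "expanding_solution a \<omega> g (\<theta> + \<omega>) = a * expanding_solution a \<omega> g \<theta> - g \<theta>"
    using orbit_sum_unfold[OF u(1) g, of \<omega> \<theta>] u(2) by (simp add: expanding_solution_def field_simps)
qed

text \<open>Unless it is zero, the difference of two solutions grows like
  \<open>\<bar>a\<bar> ^ n\<close> along an orbit, but continuity and periodicity bound it.\<close>

lemma expanding_solution_unique:
  fixes m1 m2 :: "real \<Rightarrow> real"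
  assumes a: "1 < \<bar>a\<bar>" and m1: "continuous_on UNIV m1" "periodic_2pi m1"
    and m2: "continuous_on UNIV m2" "periodic_2pi m2"
    and eq: "\<And>\<theta>. m1 (\<theta> + \<omega>) - m2 (\<theta> + \<omega>) = a * (m1 \<theta> - m2 \<theta>)"
  shows "m1 = m2"
proof
  fix \<theta>
  have iter: "m1 (\<theta> + real n * \<omega>) - m2 (\<theta> + real n * \<omega>) = a ^ n * (m1 \<theta> - m2 \<theta>)" for n
  proof (induction n)
    case (Suc n)
    have "\<theta> + real (Suc n) * \<omega> = \<theta> + real n * \<omega> + \<omega>" by (simp add: algebra_simps)
    then show ?case using eq[of "\<theta> + real n * \<omega>"] unfolding Suc by (simp only: power_Suc mult.assoc)
  qed simp
  have "continuous_on UNIV (\<lambda>\<theta>. m1 \<theta> - m2 \<theta>)" "periodic_2pi (\<lambda>\<theta>. m1 \<theta> - m2 \<theta>)"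
    using m1 m2 by (auto intro!: continuous_intros simp: periodic_2pi_def)
  then obtain B where B: "0 < B" "\<And>x. \<bar>m1 x - m2 x\<bar> \<le> B"
    by (rule periodic_2pi_bounded) (rule that)
  show "m1 \<theta> = m2 \<theta>"
  proof (rule ccontr)
    assume "m1 \<theta> \<noteq> m2 \<theta>"
    then have d: "0 < \<bar>m1 \<theta> - m2 \<theta>\<bar>" by simp
    obtain n where "B / \<bar>m1 \<theta> - m2 \<theta>\<bar> < \<bar>a\<bar> ^ n"
      using real_arch_pow[OF a] by blast
    then have "B < \<bar>a\<bar> ^ n * \<bar>m1 \<theta> - m2 \<theta>\<bar>"
      using d by (simp add: pos_divide_less_eq)
    also have "\<dots> = \<bar>m1 (\<theta> + real n * \<omega>) - m2 (\<theta> + real n * \<omega>)\<bar>"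
      by (simp add: iter abs_mult power_abs)
    finally show False using B(2)[of "\<theta> + real n * \<omega>"] by simp
  qed
qed

text \<open>Evaluates the definite descriptions in \<open>mu\<close> and \<open>mu2_hat\<close>;
  \<open>P\<close> stands for their functional equations, whose solutions differ by solutions of the
  homogeneous equation.\<close>

lemma expanding_the_solution:
  assumes a: "1 < \<bar>a\<bar>" and m: "continuous_on UNIV m" "periodic_2pi m"
    and P: "P m" "\<And>m'. P m' \<Longrightarrow> \<forall>\<theta>. m' (\<theta> + \<omega>) - m (\<theta> + \<omega>) = a * (m' \<theta> - m \<theta>)"
  shows "(THE m. continuous_on UNIV m \<and> periodic_2pi m \<and> P m) = m"
  by (rule the_equality) (use m P expanding_solution_unique[OF a _ _ m] in blast)+

lemma affine_solution_properties:
  assumes a: "1 < \<bar>a\<bar>" and g: "continuous_on UNIV g" "periodic_2pi g"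
  shows "continuous_on UNIV (\<lambda>\<theta>. c + d * expanding_solution a \<omega> g \<theta>)" "periodic_2pi (\<lambda>\<theta>. c + d * expanding_solution a \<omega> g \<theta>)"
  using expanding_solution(1,2)[OF a g, of \<omega>] by (auto intro!: continuous_intros simp: periodic_2pi_def)

text \<open>The constant for the second map is the fixed point of
  \<open>\<lambda>x. a * (x - \<delta>)\<close>; the sign in front of the expanding solution is
  opposite to that of \<open>b * g\<close> in the equation.\<close>

lemma mu_eq:
  assumes a: "1 < \<bar>a\<bar>" and g: "continuous_on UNIV g" "periodic_2pi g"
  shows "mu i a \<delta> \<omega> g b = (\<lambda>\<theta>. (if i = Map2 then a * \<delta> / (a - 1) else 0) + (if i \<in> {Map1, Map4} then b else - b) * expanding_solution a \<omega> g \<theta>)"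
proof -
  have "a \<noteq> 1" using a by auto
  then have fix2: "a * (a * \<delta> / (a - 1)) - a * \<delta> = a * \<delta> / (a - 1)"
    by (simp add: field_simps)
  show ?thesis
    unfolding mu_def
    by (rule expanding_the_solution[where \<omega> = \<omega>, OF a affine_solution_properties[OF a g]])
       (use fix2 in \<open>auto simp: expanding_solution(3)[OF a g] algebra_simps split: map_index.splits\<close>)
qed

lemma mu2_hat_eq:
  assumes a: "1 < \<bar>a\<bar>" and g: "continuous_on UNIV g" "periodic_2pi g"
  shows "mu2_hat a \<delta> \<omega> g b = (\<lambda>\<theta>. - (a * \<delta> / (a - 1)) + (- b) * expanding_solution a \<omega> g \<theta>)"
proof -
  have "a \<noteq> 1" using a by auto
  then have fix2: "a * (a * \<delta> / (a - 1)) - a * \<delta> = a * \<delta> / (a - 1)"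
    by (simp add: field_simps)
  show ?thesis
    unfolding mu2_hat_def
    by (rule expanding_the_solution[where \<omega> = \<omega>, OF a affine_solution_properties[OF a g]])
       (use fix2 in \<open>auto simp: expanding_solution(3)[OF a g] algebra_simps\<close>)
qed

text \<open>
  With \<open>W\<close> the bounded solution of \<open>W (\<theta> + \<omega>) = a W \<theta> - g \<theta>\<close>, all the curves are affine in \<open>b W\<close>,
  and a collision happens when \<open>a b W\<close> reaches this level (or, for the first two maps, its negative).
\<close>

fun collision_level :: "map_index \<Rightarrow> real \<Rightarrow> real \<Rightarrow> real" where
  "collision_level Map1 a \<delta> = pi / 2"
| "collision_level Map2 a \<delta> = a * \<delta> / (a - 1)"
| "collision_level Map3 a \<delta> = 1"
| "collision_level Map4 a \<delta> = 1"

section \<open>Collision level and initial deviation\<close>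

locale critical_map =
  fixes i :: map_index and a \<delta> \<omega> b :: real and g :: "real \<Rightarrow> real"
  assumes a_expanding: "if i = Map4 then a < - 1 else 1 < a" and delta_pos: "0 < \<delta>"
    and g_cont: "continuous_on UNIV g" and g_per: "periodic_2pi g"
    and critical: "bifurcation_value i a \<delta> \<omega> g b"
begin

abbreviation "W \<equiv> expanding_solution a \<omega> g"
abbreviation "f \<equiv> lambda0 i a \<delta> \<omega> g b"
abbreviation "\<mu> \<equiv> mu i a \<delta> \<omega> g b"
abbreviation "level \<equiv> collision_level i a \<delta>"

lemma abs_a: "1 < \<bar>a\<bar>"
  using a_expanding by (auto split: if_splits)

lemma b_pos: "0 < b"
  using critical by (simp add: bifurcation_value_def)

lemma level_pos: "0 < level"
  using a_expanding delta_pos by (cases i) auto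

lemmas W_props = expanding_solution[OF abs_a g_cont g_per, of \<omega>]
lemmas mu_formula = mu_eq[OF abs_a g_cont g_per, of i \<delta> \<omega>]

lemma mu_step:
  "\<mu> (\<theta> + \<omega>) = (case i of Map1 \<Rightarrow> a * \<mu> \<theta> - b * g \<theta> | Map2 \<Rightarrow> a * (\<mu> \<theta> - \<delta>) + b * g \<theta>
     | Map3 \<Rightarrow> a * \<mu> \<theta> + b * g \<theta> | Map4 \<Rightarrow> a * \<mu> \<theta> - b * g \<theta>)"
proof -
  have "a \<noteq> 1" using abs_a by auto
  then have "a * (a * \<delta> / (a - 1)) - a * \<delta> = a * \<delta> / (a - 1)"
    by (simp add: field_simps)
  then show ?thesis
    unfolding mu_formula W_props(3) by (cases i) (auto simp: algebra_simps)
qed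

text \<open>The same term in \<open>g\<close> occurs in \<open>phi0\<close> at
  \<open>\<theta> + \<omega>\<close> and in the equation for \<open>mu\<close>, and cancels.\<close>

lemma lambda0_step:
  "f (\<theta> + \<omega>) = (case i of Map1 \<Rightarrow> pi / 2 - a * \<mu> \<theta> | Map2 \<Rightarrow> a * (\<mu> \<theta> - \<delta>)
     | Map3 \<Rightarrow> 1 + a * \<mu> \<theta> | Map4 \<Rightarrow> 1 - a * \<mu> \<theta>)"
  unfolding lambda0_def using mu_step[of \<theta>] by (cases i) auto

lemma lambda0_eq: "f \<theta> = level - a * b * W (\<theta> - \<omega>)"
proof -
  have "a \<noteq> 1" using abs_a by auto
  then have "a * (a * \<delta> / (a - 1)) - a * \<delta> = a * \<delta> / (a - 1)"
    by (simp add: field_simps)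
  moreover have "f \<theta> = f (\<theta> - \<omega> + \<omega>)" by simp
  ultimately show ?thesis
    unfolding lambda0_step mu_formula by (cases i) (auto simp: algebra_simps)
qed

lemma lambda0_cont: "continuous_on UNIV f"
  unfolding lambda0_eq
  by (intro continuous_intros continuous_on_compose2[OF W_props(1)]) auto

lemma lambda0_per: "periodic_2pi f"
proof -
  have "W (\<theta> + 2 * pi - \<omega>) = W (\<theta> - \<omega>)" for \<theta>
    using W_props(2)[unfolded periodic_2pi_def, rule_format, of "\<theta> - \<omega>"] by (simp add: algebra_simps)
  then show ?thesis by (simp add: periodic_2pi_def lambda0_eq)
qed

text \<open>Compared at \<open>\<theta> + \<omega>\<close>, both curves contain the same term in
  \<open>g\<close>. The negative level is the collision with \<open>gamma1_tilde\<close>,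
  respectively \<open>mu2_hat\<close>.\<close>

lemma collision_at_level:
  assumes "a * c * W \<theta> = level \<or> i \<in> {Map1, Map2} \<and> a * c * W \<theta> = - level"
  shows "collision i a \<delta> \<omega> g c"
proof -
  have "a \<noteq> 1" using abs_a by auto
  then have fix2: "a * (a * \<delta> / (a - 1)) - a * \<delta> = a * \<delta> / (a - 1)"
    by (simp add: field_simps)
  have W: "W (\<theta> + \<omega>) = a * W \<theta> - g \<theta>" "W (\<omega> + \<theta>) = a * W \<theta> - g \<theta>"
    using W_props(3)[of \<theta>] by (simp_all add: add.commute)
  note eqs = mu_eq[OF abs_a g_cont g_per] mu2_hat_eq[OF abs_a g_cont g_per] gamma1_tilde_def
  have "(case i of
      Map1 \<Rightarrow> mu Map1 a \<delta> \<omega> g c (\<theta> + \<omega>) = phi0 Map1 \<omega> g c (\<theta> + \<omega>) \<or>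
        mu Map1 a \<delta> \<omega> g c (\<theta> + \<omega>) = gamma1_tilde \<omega> g c (\<theta> + \<omega>)
    | Map2 \<Rightarrow> phi0 Map2 \<omega> g c (\<theta> + \<omega>) = mu Map2 a \<delta> \<omega> g c (\<theta> + \<omega>) \<or>
        phi0 Map2 \<omega> g c (\<theta> + \<omega>) = mu2_hat a \<delta> \<omega> g c (\<theta> + \<omega>)
    | Map3 \<Rightarrow> phi0 Map3 \<omega> g c (\<theta> + \<omega>) = mu Map3 a \<delta> \<omega> g c (\<theta> + \<omega>)
    | Map4 \<Rightarrow> phi0 Map4 \<omega> g c (\<theta> + \<omega>) = mu Map4 a \<delta> \<omega> g c (\<theta> + \<omega>))"
    using assms fix2 by (cases i) (auto simp: eqs W algebra_simps)
  then show ?thesis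
    unfolding collision_def graphs_meet_def by (cases i) (auto simp del: phi0.simps)
qed

text \<open>For fixed \<open>\<theta>\<close> the expression is linear in the parameter, so a value
  beyond the level would mean that the level is attained at a smaller positive parameter, against
  the minimality of \<open>b\<close>.\<close>

lemma level_bounds:
  shows "a * b * W \<theta> \<le> level" and "i \<in> {Map1, Map2} \<Longrightarrow> - level \<le> a * b * W \<theta>"
proof -
  have least: "b \<le> c" if "0 < c" "collision i a \<delta> \<omega> g c" for c
    using critical that by (auto simp: bifurcation_value_def)
  show "a * b * W \<theta> \<le> level"
  proof (rule ccontr)
    assume "\<not> ?thesis"
    then have less: "level < (a * W \<theta>) * b" by (simp add: mult_ac)
    then have pos: "0 < a * W \<theta>"
      using level_pos b_pos by (smt (verit) mult_nonpos_nonneg)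
    let ?c = "level / (a * W \<theta>)"
    have "a \<noteq> 0" "W \<theta> \<noteq> 0" using pos by auto
    then have "a * ?c * W \<theta> = level" by simp
    then have "b \<le> ?c"
      using pos level_pos by (intro least collision_at_level[where \<theta> = \<theta>]) auto
    then show False using less pos by (simp add: pos_le_divide_eq mult.commute)
  qed
  show "- level \<le> a * b * W \<theta>" if i: "i \<in> {Map1, Map2}"
  proof (rule ccontr)
    assume "\<not> ?thesis"
    then have less: "level < - (a * W \<theta>) * b" by (simp add: mult_ac)
    then have pos: "0 < - (a * W \<theta>)"
      using level_pos b_pos by (smt (verit) mult_nonpos_nonneg)
    let ?c = "level / (- (a * W \<theta>))"
    have "a \<noteq> 0" "W \<theta> \<noteq> 0" using pos by auto
    then have "a * ?c * W \<theta> = - level" by simp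
    then have "b \<le> ?c"
      using pos level_pos i by (intro least collision_at_level[where \<theta> = \<theta>] divide_pos_pos) auto
    then have "b * - (a * W \<theta>) \<le> level" unfolding pos_le_divide_eq[OF pos] .
    then show False using less by (simp add: mult.commute)
  qed
qed

lemma lambda0_nonneg: "0 \<le> f \<theta>"
  using level_bounds(1)[of "\<theta> - \<omega>"] by (simp add: lambda0_eq)

section \<open>Deviation of the iterates from the curve \<open>\<mu>\<close>\<close>

definition deviation :: "(real \<Rightarrow> real) \<Rightarrow> real \<Rightarrow> real" where
  "deviation \<phi> \<theta> = (if i \<in> {Map1, Map4} then \<phi> \<theta> - \<mu> \<theta> else \<mu> \<theta> - \<phi> \<theta>)"

lemma deviation_phi0: "deviation (phi i a \<delta> \<omega> g b 0) = f"
  by (rule ext) (simp add: deviation_def lambda0_def)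

abbreviation "curve_map \<equiv> graph_transform i a \<delta> \<omega> g b"

text \<open>The flat part of \<open>h_map\<close> caps the expanded deviation at
  \<open>f (\<theta> + \<omega>)\<close>. For the first map the sign condition keeps the curve off
  the lower plateau; for the second, the branch below \<open>- \<delta>\<close> lets the deviation
  exceed the cap, so that only the two bounds hold.\<close>

lemma deviation_step:
  assumes "i = Map1 \<Longrightarrow> 0 \<le> deviation \<phi> \<theta>"
  shows "min (a * deviation \<phi> \<theta>) (f (\<theta> + \<omega>)) \<le> deviation (curve_map \<phi>) (\<theta> + \<omega>)"
    and "deviation (curve_map \<phi>) (\<theta> + \<omega>) \<le> a * deviation \<phi> \<theta>"
    and "i \<noteq> Map2 \<Longrightarrow> deviation (curve_map \<phi>) (\<theta> + \<omega>) = min (a * deviation \<phi> \<theta>) (f (\<theta> + \<omega>))"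
proof -
  have goal: "min (a * deviation \<phi> \<theta>) (f (\<theta> + \<omega>)) \<le> deviation (curve_map \<phi>) (\<theta> + \<omega>) \<and>
     deviation (curve_map \<phi>) (\<theta> + \<omega>) \<le> a * deviation \<phi> \<theta> \<and>
     (i \<noteq> Map2 \<longrightarrow> deviation (curve_map \<phi>) (\<theta> + \<omega>) = min (a * deviation \<phi> \<theta>) (f (\<theta> + \<omega>)))"
  proof (cases i)
    case Map1
    have "1 < a" using a_expanding Map1 by simp
    have "- (pi / 2) \<le> a * \<mu> \<theta>"
      unfolding mu_formula using level_bounds(2)[of \<theta>] Map1 by (simp add: mult.assoc)
    moreover have "a * \<mu> \<theta> \<le> a * \<phi> \<theta>"
      using assms \<open>1 < a\<close> unfolding deviation_def by (simp add: Map1)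
    moreover have "\<phi> \<theta> < - (pi / (2 * a)) \<longleftrightarrow> a * \<phi> \<theta> < - (pi / 2)" "\<phi> \<theta> \<le> pi / (2 * a) \<longleftrightarrow> a * \<phi> \<theta> \<le> pi / 2"
      using \<open>1 < a\<close> by (simp_all add: field_simps)
    ultimately show ?thesis
      using mu_step[of \<theta>] lambda0_step[of \<theta>]
      unfolding deviation_def graph_transform_def by (auto simp: Map1 right_diff_distrib min_def)
  next
    case Map2
    have "1 < a" using a_expanding Map2 by simp
    have "0 < a * \<delta>" "0 < \<delta> * a" using \<open>1 < a\<close> delta_pos by simp_all
    moreover have "\<phi> \<theta> < - \<delta> \<longleftrightarrow> a * \<phi> \<theta> < - (a * \<delta>)" "\<phi> \<theta> \<le> \<delta> \<longleftrightarrow> a * \<phi> \<theta> \<le> a * \<delta>"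
      using mult_less_cancel_left_pos[of a "\<phi> \<theta>" "- \<delta>"] mult_le_cancel_left_pos[of a "\<phi> \<theta>" \<delta>] \<open>1 < a\<close> by auto
    ultimately show ?thesis
      using mu_step[of \<theta>] lambda0_step[of \<theta>] unfolding deviation_def graph_transform_def
      by (auto simp: Map2 right_diff_distrib distrib_left min_def)
  next
    case Map3
    have "1 < a" using a_expanding Map3 by simp
    then have "- (1 / a) < \<phi> \<theta> \<longleftrightarrow> - 1 < a * \<phi> \<theta>"
      by (simp add: field_simps)
    then show ?thesis
      using mu_step[of \<theta>] lambda0_step[of \<theta>]
      unfolding deviation_def graph_transform_def by (auto simp: Map3 right_diff_distrib min_def)
  next
    case Map4
    have "a < 0" using a_expanding Map4 by simp
    then have "1 / a < \<phi> \<theta> \<longleftrightarrow> a * \<phi> \<theta> < 1"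
      by (simp add: field_simps)
    then show ?thesis
      using mu_step[of \<theta>] lambda0_step[of \<theta>]
      unfolding deviation_def graph_transform_def by (auto simp: Map4 right_diff_distrib min_def)
  qed
  show "min (a * deviation \<phi> \<theta>) (f (\<theta> + \<omega>)) \<le> deviation (curve_map \<phi>) (\<theta> + \<omega>)"
    "deviation (curve_map \<phi>) (\<theta> + \<omega>) \<le> a * deviation \<phi> \<theta>"
    "i \<noteq> Map2 \<Longrightarrow> deviation (curve_map \<phi>) (\<theta> + \<omega>) = min (a * deviation \<phi> \<theta>) (f (\<theta> + \<omega>))"
    using goal by auto
qed

definition rate :: real where
  "rate = (if i = Map4 then a * a else a)"

definition angle :: real where
  "angle = (if i = Map4 then 2 * \<omega> else \<omega>)"

abbreviation "\<phi> \<equiv> phi i a \<delta> \<omega> g b"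

lemma rate: "1 < rate"
  using a_expanding mult_strict_mono[of 1 "- a" 1 "- a"] by (auto simp: rate_def split: if_splits)

text \<open>For the fourth map the first of the two steps is never capped: as \<open>a < 0\<close>,
  the expanded deviation is at most 0 while \<open>f\<close> is nonnegative. The cap acts in the
  second step only.\<close>

lemma phi_step:
  assumes nonneg: "0 \<le> deviation (\<phi> n) \<theta>"
  shows "min (rate * deviation (\<phi> n) \<theta>) (f (\<theta> + angle)) \<le> deviation (\<phi> (Suc n)) (\<theta> + angle)"
    and "deviation (\<phi> (Suc n)) (\<theta> + angle) \<le> rate * deviation (\<phi> n) \<theta>"
proof -
  have "min (rate * deviation (\<phi> n) \<theta>) (f (\<theta> + angle)) \<le> deviation (\<phi> (Suc n)) (\<theta> + angle) \<and>
    deviation (\<phi> (Suc n)) (\<theta> + angle) \<le> rate * deviation (\<phi> n) \<theta>"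
  proof (cases "i = Map4")
    case False
    then show ?thesis
      using deviation_step(1,2)[OF nonneg] by (simp add: rate_def angle_def)
  next
    case True
    have "a * deviation (\<phi> n) \<theta> \<le> 0"
      using a_expanding True nonneg by (intro mult_nonpos_nonneg) auto
    also have "0 \<le> f (\<theta> + \<omega>)" by (rule lambda0_nonneg)
    finally have "deviation (curve_map (\<phi> n)) (\<theta> + \<omega>) = a * deviation (\<phi> n) \<theta>"
      using deviation_step(3)[of "\<phi> n" \<theta>] True by (simp add: min_def)
    moreover have "deviation (curve_map (curve_map (\<phi> n))) (\<theta> + \<omega> + \<omega>) =
        min (a * deviation (curve_map (\<phi> n)) (\<theta> + \<omega>)) (f (\<theta> + \<omega> + \<omega>))"
      using True by (intro deviation_step(3)) auto
    ultimately have "deviation (curve_map (curve_map (\<phi> n))) (\<theta> + angle) =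
        min (rate * deviation (\<phi> n) \<theta>) (f (\<theta> + angle))"
      unfolding rate_def angle_def by (simp add: True mult.assoc add.assoc)
    then show ?thesis using True by simp
  qed
  then show "min (rate * deviation (\<phi> n) \<theta>) (f (\<theta> + angle)) \<le> deviation (\<phi> (Suc n)) (\<theta> + angle)"
    "deviation (\<phi> (Suc n)) (\<theta> + angle) \<le> rate * deviation (\<phi> n) \<theta>" by auto
qed

lemma deviation_phi_nonneg: "0 \<le> deviation (\<phi> n) \<theta>"
proof (induction n arbitrary: \<theta>)
  case 0
  then show ?case using lambda0_nonneg by (simp only: deviation_phi0)
next
  case (Suc n)
  have "0 \<le> min (rate * deviation (\<phi> n) (\<theta> - angle)) (f (\<theta> - angle + angle))"
    using Suc[of "\<theta> - angle"] rate lambda0_nonneg by simp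
  also have "\<dots> \<le> deviation (\<phi> (Suc n)) (\<theta> - angle + angle)"
    by (intro phi_step Suc)
  finally show ?case by simp
qed

section \<open>Fibre maps and their derivatives\<close>

lemma h_map_eq:
  "h_map i a \<delta> x = (case i of Map1 \<Rightarrow> max (- (pi / 2)) (min (a * x) (pi / 2))
     | Map2 \<Rightarrow> max (a * x - a * \<delta>) 0 + min (a * x + a * \<delta>) 0
     | Map3 \<Rightarrow> max (a * x) (- 1) | Map4 \<Rightarrow> min (a * x) 1)"
proof (cases i)
  case Map1
  then have "1 < a" using a_expanding by simp
  then have "x < - (pi / (2 * a)) \<longleftrightarrow> a * x < - (pi / 2)" "x \<le> pi / (2 * a) \<longleftrightarrow> a * x \<le> pi / 2"
    by (simp_all add: field_simps)
  moreover have "0 < pi / (2 * a)" using \<open>1 < a\<close> by simp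
  ultimately show ?thesis using Map1 by (auto simp: min_def max_def)
next
  case Map2
  then have "1 < a" using a_expanding by simp
  then have "0 < a * \<delta>" "x < - \<delta> \<longleftrightarrow> a * x < - (a * \<delta>)" "x \<le> \<delta> \<longleftrightarrow> a * x \<le> a * \<delta>"
    using mult_less_cancel_left_pos[of a x "- \<delta>"] mult_le_cancel_left_pos[of a x \<delta>] delta_pos by auto
  then show ?thesis using Map2 by (auto simp: min_def max_def algebra_simps)
next
  case Map3
  then have "1 < a" using a_expanding by simp
  then have "- (1 / a) < x \<longleftrightarrow> - 1 < a * x" by (simp add: field_simps)
  then show ?thesis using Map3 by (auto simp: max_def)
next
  case Map4
  then have "a < 0" using a_expanding by simp
  then have "1 / a < x \<longleftrightarrow> a * x < 1" by (simp add: field_simps)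
  then show ?thesis using Map4 by (auto simp: min_def)
qed

lemma h_map_cont: "continuous_on UNIV (h_map i a \<delta>)"
  unfolding h_map_eq by (cases i) (auto intro!: continuous_intros)

lemma h_map_lipschitz: "\<bar>h_map i a \<delta> x - h_map i a \<delta> y\<bar> \<le> \<bar>a\<bar> * \<bar>x - y\<bar>"
proof -
  have "\<bar>h_map i a \<delta> x - h_map i a \<delta> y\<bar> \<le> \<bar>a * x - a * y\<bar>"
    unfolding h_map_eq
  proof (cases i)
    case Map2
    then have "0 < a * \<delta>" using a_expanding delta_pos by simp
    moreover have "\<bar>max (p - e) 0 + min (p + e) 0 - (max (q - e) 0 + min (q + e) 0)\<bar> \<le> \<bar>p - q\<bar>"
      if "0 < e" for p q e :: real
      using that by (auto simp: max_def min_def abs_if)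
    ultimately show "\<bar>(case i of Map1 \<Rightarrow> max (- (pi / 2)) (min (a * x) (pi / 2))
     | Map2 \<Rightarrow> max (a * x - a * \<delta>) 0 + min (a * x + a * \<delta>) 0
     | Map3 \<Rightarrow> max (a * x) (- 1) | Map4 \<Rightarrow> min (a * x) 1) -
     (case i of Map1 \<Rightarrow> max (- (pi / 2)) (min (a * y) (pi / 2))
     | Map2 \<Rightarrow> max (a * y - a * \<delta>) 0 + min (a * y + a * \<delta>) 0
     | Map3 \<Rightarrow> max (a * y) (- 1) | Map4 \<Rightarrow> min (a * y) 1)\<bar> \<le> \<bar>a * x - a * y\<bar>"
      unfolding Map2 map_index.case by blast
  qed (simp_all add: max_def min_def)
  then show ?thesis by (simp flip: right_diff_distrib add: abs_mult)
qed

lemma h_deriv_le: "\<bar>h_deriv i a \<delta> x\<bar> \<le> \<bar>a\<bar>"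
proof (cases "h_map i a \<delta> differentiable at x")
  case True
  then obtain D where D: "(h_map i a \<delta> has_field_derivative D) (at x)"
    using real_differentiable_def by blast
  then have "((\<lambda>h. \<bar>(h_map i a \<delta> (x + h) - h_map i a \<delta> x) / h\<bar>) \<longlongrightarrow> \<bar>D\<bar>) (at 0)"
    unfolding DERIV_def by (rule tendsto_rabs)
  moreover have "\<bar>(h_map i a \<delta> (x + h) - h_map i a \<delta> x) / h\<bar> \<le> \<bar>a\<bar>" if "h \<noteq> 0" for h
    using h_map_lipschitz[of "x + h" x] that by (simp add: abs_divide divide_le_eq)
  then have "\<forall>\<^sub>F h in at 0. \<bar>(h_map i a \<delta> (x + h) - h_map i a \<delta> x) / h\<bar> \<le> \<bar>a\<bar>"
    by (auto simp: eventually_at intro: exI[of _ 1])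
  ultimately have "\<bar>D\<bar> \<le> \<bar>a\<bar>"
    by (intro tendsto_upperbound) auto
  then show ?thesis using True DERIV_imp_deriv[OF D] by (simp add: h_deriv_def)
qed (simp add: h_deriv_def)

text \<open>The bound keeps the positive part of the logarithm integrable, so that the exponent is
  not decided by the convention for \<open>\<infinity> - \<infinity>\<close>.\<close>

lemma fibre_deriv_le: "\<bar>fibre_deriv i a \<delta> \<omega> g b x \<theta>\<bar> \<le> \<bar>a\<bar> * \<bar>a\<bar>"
proof (cases "i = Map4")
  case True
  then have "fibre_deriv i a \<delta> \<omega> g b x \<theta> =
      h_deriv i a \<delta> (fst (F_map i a \<delta> \<omega> g b (x, \<theta>))) * h_deriv i a \<delta> x"
    unfolding fibre_deriv_def by (rule if_P)
  then show ?thesis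
    by (simp only: abs_mult) (intro mult_mono h_deriv_le abs_ge_zero)
next
  case False
  have "\<bar>a\<bar> * 1 \<le> \<bar>a\<bar> * \<bar>a\<bar>" using abs_a by (intro mult_left_mono) auto
  then show ?thesis using False h_deriv_le[of x] by (simp add: fibre_deriv_def)
qed

lemma h_deriv_flat:
  assumes "open U" "x \<in> U" "\<And>y. y \<in> U \<Longrightarrow> h_map i a \<delta> y = c"
  shows "h_deriv i a \<delta> x = 0"
proof -
  have "(h_map i a \<delta> has_field_derivative 0) (at x)"
    by (rule has_field_derivative_transform_within_open[of "\<lambda>_. c" _ _ U]) (use assms in auto)
  then show ?thesis
    using DERIV_imp_deriv real_differentiable_def unfolding h_deriv_def by auto
qed

text \<open>The first inequality says that the point has crossed the edge of a plateau. The second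
  keeps it from leaving the plateau of the second map, which has width \<open>2 * \<delta>\<close>,
  at the far side.\<close>

lemma fibre_deriv_flat:
  assumes nonneg: "0 \<le> deviation \<psi> \<theta>"
    and flat: "f (\<theta> + angle) < rate * deviation \<psi> \<theta>"
      "rate * deviation \<psi> \<theta> < f (\<theta> + angle) + 2 * \<bar>a\<bar> * \<delta>"
  shows "fibre_deriv i a \<delta> \<omega> g b (\<psi> \<theta>) \<theta> = 0"
proof (cases i)
  case Map1
  have "1 < a" using a_expanding Map1 by simp
  have "pi / 2 < a * \<psi> \<theta>"
    using flat(1) lambda0_step[of \<theta>]
    unfolding angle_def rate_def deviation_def by (simp add: Map1 right_diff_distrib)
  then have "\<psi> \<theta> \<in> {pi / (2 * a)<..}"
    using \<open>1 < a\<close> by (simp add: field_simps)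
  then have "h_deriv i a \<delta> (\<psi> \<theta>) = 0"
  proof (rule h_deriv_flat[rotated])
    fix y assume "y \<in> {pi / (2 * a)<..}"
    then have "pi / 2 < a * y" using \<open>1 < a\<close> by (simp add: field_simps)
    then show "h_map i a \<delta> y = pi / 2" unfolding h_map_eq by (simp add: Map1)
  qed simp
  then show ?thesis using Map1 by (simp add: fibre_deriv_def)
next
  case Map2
  have "1 < a" using a_expanding Map2 by simp
  have "f (\<theta> + \<omega>) = a * \<mu> \<theta> - a * \<delta>"
    using lambda0_step[of \<theta>] by (simp add: Map2 right_diff_distrib)
  moreover have "f (\<theta> + \<omega>) < a * \<mu> \<theta> - a * \<psi> \<theta>" "a * \<mu> \<theta> - a * \<psi> \<theta> < f (\<theta> + \<omega>) + 2 * (a * \<delta>)"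
    using flat \<open>1 < a\<close> unfolding angle_def rate_def deviation_def
    by (simp_all add: Map2 right_diff_distrib)
  ultimately have "a * \<psi> \<theta> < a * \<delta>" "- (a * \<delta>) < a * \<psi> \<theta>"
    by linarith+
  then have "\<psi> \<theta> \<in> {- \<delta><..<\<delta>}"
    using mult_less_cancel_left_pos[of a "- \<delta>" "\<psi> \<theta>"] \<open>1 < a\<close> by auto
  then have "h_deriv i a \<delta> (\<psi> \<theta>) = 0"
    by (rule h_deriv_flat[rotated, where c = 0]) (use Map2 in auto)
  then show ?thesis using Map2 by (simp add: fibre_deriv_def)
next
  case Map3
  have "1 < a" using a_expanding Map3 by simp
  have "a * \<psi> \<theta> < - 1"
    using flat(1) lambda0_step[of \<theta>]
    unfolding angle_def rate_def deviation_def by (simp add: Map3 right_diff_distrib)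
  then have "\<psi> \<theta> \<in> {..<- (1 / a)}"
    using \<open>1 < a\<close> by (simp add: field_simps)
  then have "h_deriv i a \<delta> (\<psi> \<theta>) = 0"
    by (rule h_deriv_flat[rotated, where c = "- 1"]) (use Map3 in auto)
  then show ?thesis using Map3 by (simp add: fibre_deriv_def)
next
  case Map4
  have "a < 0" using a_expanding Map4 by simp
  \<comment> \<open>The first application is linear at this point; its image lies in the flat part,
    so the other factor of the chain rule vanishes.\<close>
  have "a * \<psi> \<theta> \<le> a * \<mu> \<theta>"
    using nonneg \<open>a < 0\<close> unfolding deviation_def by (simp add: Map4)
  also have "a * \<mu> \<theta> \<le> 1"
    using lambda0_nonneg[of "\<theta> + \<omega>"] lambda0_step[of \<theta>] Map4 by simp
  finally have image: "fst (F_map i a \<delta> \<omega> g b (\<psi> \<theta>, \<theta>)) = \<mu> (\<theta> + \<omega>) + a * deviation \<psi> \<theta>" (is "?y = _")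
    using mu_step[of \<theta>] unfolding F_map_def h_map_eq deviation_def by (simp add: Map4 right_diff_distrib)
  have "f (\<theta> + \<omega> + \<omega>) < a * (a * deviation \<psi> \<theta>)"
    using flat(1) unfolding angle_def rate_def by (simp add: Map4 add.assoc mult.assoc)
  then have "1 < a * ?y"
    unfolding image using lambda0_step[of "\<theta> + \<omega>"] Map4 by (simp add: distrib_left)
  then have "?y \<in> {..<1 / a}"
    using \<open>a < 0\<close> by (simp add: field_simps)
  then have "h_deriv i a \<delta> ?y = 0"
    by (rule h_deriv_flat[rotated, where c = 1]) (use Map4 in auto)
  then show ?thesis using Map4 by (simp add: fibre_deriv_def)
qed

lemma mu_cont: "continuous_on UNIV \<mu>"
  unfolding mu_formula by (intro continuous_intros W_props(1))

lemma mu_per: "\<mu> (\<theta> + 2 * pi) = \<mu> \<theta>"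
  using W_props(2) by (simp add: mu_formula periodic_2pi_def)

lemma phi_cont_per: "continuous_on UNIV (\<phi> n) \<and> (\<forall>\<theta>. \<phi> n (\<theta> + 2 * pi) = \<phi> n \<theta>)"
proof (induction n)
  case 0
  have shift: "g (\<theta> + 2 * pi - \<omega>) = g (\<theta> - \<omega>)" for \<theta>
    using g_per[unfolded periodic_2pi_def, rule_format, of "\<theta> - \<omega>"] by (simp add: algebra_simps)
  have "continuous_on UNIV (\<lambda>\<theta>. g (\<theta> - \<omega>))"
    by (intro continuous_on_compose2[OF g_cont] continuous_intros) auto
  then have "continuous_on UNIV (\<lambda>\<theta>. phi0 i \<omega> g b \<theta>)"
    by (cases i) (auto intro!: continuous_intros)
  then show ?case
    by (cases i) (auto simp: shift)
next
  case (Suc n)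
  have step: "continuous_on UNIV (curve_map \<psi>) \<and> (\<forall>\<theta>. curve_map \<psi> (\<theta> + 2 * pi) = curve_map \<psi> \<theta>)"
    if \<psi>: "continuous_on UNIV \<psi> \<and> (\<forall>\<theta>. \<psi> (\<theta> + 2 * pi) = \<psi> \<theta>)" for \<psi>
  proof
    show "continuous_on UNIV (curve_map \<psi>)"
      unfolding graph_transform_def
      by (intro continuous_intros continuous_on_compose2[OF h_map_cont]
          continuous_on_compose2[OF conjunct1[OF \<psi>]] continuous_on_compose2[OF g_cont]) auto
    have "\<psi> (\<theta> + 2 * pi - \<omega>) = \<psi> (\<theta> - \<omega>)" "g (\<theta> + 2 * pi - \<omega>) = g (\<theta> - \<omega>)" for \<theta>
      using \<psi>[THEN conjunct2, rule_format, of "\<theta> - \<omega>"]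
        g_per[unfolded periodic_2pi_def, rule_format, of "\<theta> - \<omega>"] by (simp_all add: algebra_simps)
    then show "\<forall>\<theta>. curve_map \<psi> (\<theta> + 2 * pi) = curve_map \<psi> \<theta>"
      by (simp add: graph_transform_def)
  qed
  show ?case
  proof (cases "i = Map4")
    case True
    have "\<phi> (Suc n) = curve_map (curve_map (\<phi> n))" using True by simp
    show ?thesis unfolding \<open>\<phi> (Suc n) = _\<close> by (rule step[OF step[OF Suc]])
  next
    case False
    have "\<phi> (Suc n) = curve_map (\<phi> n)" using False by simp
    show ?thesis unfolding \<open>\<phi> (Suc n) = _\<close> by (rule step[OF Suc])
  qed
qed

lemma deviation_phi_cont: "continuous_on UNIV (deviation (\<phi> n))"
proof -
  have "continuous_on UNIV (\<lambda>\<theta>. \<phi> n \<theta> - \<mu> \<theta>)" "continuous_on UNIV (\<lambda>\<theta>. \<mu> \<theta> - \<phi> n \<theta>)"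
    using phi_cont_per[of n] mu_cont by (auto intro!: continuous_intros)
  moreover have "deviation (\<phi> n) = (\<lambda>\<theta>. \<phi> n \<theta> - \<mu> \<theta>) \<or> deviation (\<phi> n) = (\<lambda>\<theta>. \<mu> \<theta> - \<phi> n \<theta>)"
    unfolding deviation_def fun_eq_iff by presburger
  ultimately show ?thesis by metis
qed

text \<open>The abstract result applies to the deviations with
  \<open>\<kappa> = 2 * \<bar>a\<bar> * \<delta>\<close>, the window that
  \<open>fibre_deriv_flat\<close> tolerates.\<close>

lemma limit_flat_nonnegligible:
  assumes irrational: "\<omega> / (2 * pi) \<notin> \<rat>" and finite_order: "\<forall>z. f z = 0 \<longrightarrow> finite_order_zero f z"
    and zero: "f z0 = 0" and lim: "\<And>\<theta>. (\<lambda>n. \<phi> n \<theta>) \<longlonglongrightarrow> \<phi>_inf \<theta>"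
  shows "\<not> negligible {\<theta>. f (\<theta> + angle) < rate * deviation \<phi>_inf \<theta> \<and>
      rate * deviation \<phi>_inf \<theta> < f (\<theta> + angle) + 2 * \<bar>a\<bar> * \<delta>}"
    and "0 \<le> deviation \<phi>_inf \<theta>"
proof -
  have dev_lim: "(\<lambda>n. deviation (\<phi> n) \<theta>) \<longlonglongrightarrow> deviation \<phi>_inf \<theta>" for \<theta>
    unfolding deviation_def by (cases "i \<in> {Map1, Map4}") (auto intro!: tendsto_intros lim)
  have "angle / (2 * pi) \<notin> \<rat>"
  proof
    assume "angle / (2 * pi) \<in> \<rat>"
    then have "angle / (2 * pi) / (if i = Map4 then 2 else 1) \<in> \<rat>"
      by (rule Rats_divide) simp
    also have "angle / (2 * pi) / (if i = Map4 then 2 else 1) = \<omega> / (2 * pi)"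
      by (simp add: angle_def)
    finally show False using irrational by simp
  qed
  then interpret rotated_zeros f rate angle
    using lambda0_cont lambda0_per lambda0_nonneg finite_order rate by unfold_locales auto
  have "0 < 2 * \<bar>a\<bar> * \<delta>" using abs_a delta_pos by (intro mult_pos_pos) auto
  then show "\<not> negligible {\<theta>. f (\<theta> + angle) < rate * deviation \<phi>_inf \<theta> \<and>
      rate * deviation \<phi>_inf \<theta> < f (\<theta> + angle) + 2 * \<bar>a\<bar> * \<delta>}"
    by (rule limit_enters_flat_part[OF deviation_phi0 deviation_phi_cont phi_step[OF deviation_phi_nonneg]
          dev_lim zero])
  show "0 \<le> deviation \<phi>_inf \<theta>"
    by (rule LIMSEQ_le_const[OF dev_lim]) (use deviation_phi_nonneg in blast)
qed

end

section \<open>From the flat set to the Lyapunov exponent\<close>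

lemma negligible_periodic:
  assumes periodic: "\<And>x. x + 2 * pi \<in> S \<longleftrightarrow> x \<in> S" and neg: "negligible (S \<inter> {0..<2 * pi})"
  shows "negligible S"
proof -
  have "periodic_2pi (\<lambda>x. if x \<in> S then 1 else 0)"
    using periodic by (simp add: periodic_2pi_def)
  from periodic_2pi_int[OF this] have shift: "x + 2 * pi * of_int j \<in> S \<longleftrightarrow> x \<in> S" for x and j :: int
    by (metis zero_neq_one)
  have "S \<subseteq> (\<Union>j::int. (+) (2 * pi * of_int j) ` (S \<inter> {0..<2 * pi}))"
  proof
    fix x assume x: "x \<in> S"
    obtain j :: int where j: "x - 2 * pi * of_int j \<in> {0..<2 * pi}"
      by (rule obtain_2pi_representative)
    moreover have "x - 2 * pi * of_int j \<in> S" using shift[of "x - 2 * pi * of_int j" j] x by simp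
    ultimately show "x \<in> (\<Union>j::int. (+) (2 * pi * of_int j) ` (S \<inter> {0..<2 * pi}))"
      by (intro UN_I[of j] image_eqI[of _ _ "x - 2 * pi * of_int j"]) simp_all
  qed
  moreover have "negligible (\<Union>j::int. (+) (2 * pi * of_int j) ` (S \<inter> {0..<2 * pi}))"
    by (rule negligible_countable_Union) (auto intro: negligible_translation neg)
  ultimately show ?thesis using negligible_subset by blast
qed

text \<open>On \<open>S\<close> the negative part of the integrand is infinite, which makes its
  integral infinite; the bound \<open>C\<close> keeps the integral of the positive part over one
  period finite.\<close>

lemma ereal_integral_ln_abs_minus_infinity:
  fixes D :: "real \<Rightarrow> real"
  assumes bound: "\<And>x. \<bar>D x\<bar> \<le> C" and S: "S \<in> sets lebesgue" "\<not> negligible (S \<inter> {0..<2 * pi})"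
    and zero: "\<And>x. x \<in> S \<Longrightarrow> D x = 0"
  shows "ereal_integral (lebesgue_on {0..<2 * pi}) (\<lambda>x. ln_abs (D x)) = - \<infinity>"
proof -
  let ?M = "lebesgue_on {0..<2 * pi}"
  have "(\<integral>\<^sup>+x. e2ennreal (ln_abs (D x)) \<partial>?M) \<le> (\<integral>\<^sup>+x. ennreal (ln (C + 1)) \<partial>?M)"
  proof (rule nn_integral_mono)
    fix x
    show "e2ennreal (ln_abs (D x)) \<le> ennreal (ln (C + 1))"
    proof (cases "D x = 0")
      case False
      then have "ln \<bar>D x\<bar> \<le> ln (C + 1)"
        using bound[of x] by (subst ln_le_cancel_iff) auto
      then show ?thesis
        using False by (simp add: ln_abs_def e2ennreal_ereal ennreal_leI)
    qed (simp add: ln_abs_def e2ennreal_neg)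
  qed
  also have "\<dots> < \<infinity>"
    by (simp add: emeasure_restrict_space space_restrict_space ennreal_mult_less_top)
  finally have pos: "(\<integral>\<^sup>+x. e2ennreal (ln_abs (D x)) \<partial>?M) \<noteq> \<infinity>" by simp
  have S': "S \<inter> {0..<2 * pi} \<in> sets ?M"
    using S(1) by (auto simp: sets_restrict_space)
  have "S \<inter> {0..<2 * pi} \<in> sets lebesgue" using S(1) by auto
  then have "emeasure lebesgue (S \<inter> {0..<2 * pi}) \<noteq> 0"
    using S(2) by (auto simp: negligible_iff_null_sets null_sets_def)
  then have "emeasure ?M (S \<inter> {0..<2 * pi}) \<noteq> 0"
    by (subst emeasure_restrict_space) auto
  then have "\<infinity> = \<infinity> * emeasure ?M (S \<inter> {0..<2 * pi})"
    by (simp add: ennreal_top_mult)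
  also have "\<dots> = (\<integral>\<^sup>+x. \<infinity> * indicator (S \<inter> {0..<2 * pi}) x \<partial>?M)"
    using S' by (rule nn_integral_cmult_indicator[symmetric])
  also have "\<dots> \<le> (\<integral>\<^sup>+x. e2ennreal (- ln_abs (D x)) \<partial>?M)"
    by (intro nn_integral_mono) (auto simp: indicator_def ln_abs_def zero)
  finally have neg: "(\<integral>\<^sup>+x. e2ennreal (- ln_abs (D x)) \<partial>?M) = \<infinity>"
    by (simp add: top_unique)
  obtain r where "enn2ereal (\<integral>\<^sup>+x. e2ennreal (ln_abs (D x)) \<partial>?M) = ereal r"
    using pos by (cases "\<integral>\<^sup>+x. e2ennreal (ln_abs (D x)) \<partial>?M") (auto simp: enn2ereal_ennreal)
  then show ?thesis
    unfolding ereal_integral_def neg by simp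
qed

theorem proposition3p7:
  fixes i :: map_index and a \<delta> \<omega> \<tau> b :: real and g \<phi>_inf :: "real \<Rightarrow> real"
  assumes a_expanding: "if i = Map4 then a < - 1 else 1 < a"
    and delta_pos: "0 < \<delta>"
    and omega_irrational: "\<nexists>r. r \<in> \<rat> \<and> \<omega> = 2 * pi * r"
    and g_periodic: "periodic_2pi g"
    and g_regular: "0 < \<tau>" "\<tau> \<le> 1" "class_C1_plus \<tau> g"
    and g_nonconstant: "\<not> g constant_on UNIV"
    and b_critical: "bifurcation_value i a \<delta> \<omega> g b"
    and zeros: "\<exists>\<theta>. lambda0 i a \<delta> \<omega> g b \<theta> = 0"
    and standing: "real_analytic g \<or> even_order_zeros (lambda0 i a \<delta> \<omega> g b)"
    and phi_limit: "\<forall>\<theta>. (\<lambda>n. phi i a \<delta> \<omega> g b n \<theta>) \<longlonglongrightarrow> \<phi>_inf \<theta>"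
  shows "lyapunov_exponent i a \<delta> \<omega> g b \<phi>_inf = - \<infinity>"
proof -
  have g_cont: "continuous_on UNIV g"
    using g_regular(3) DERIV_isCont unfolding class_C1_plus_def
    by (fastforce simp: continuous_on_eq_continuous_at)
  interpret critical_map i a \<delta> \<omega> b g
    using a_expanding delta_pos g_cont g_periodic b_critical by unfold_locales
  have irrational: "\<omega> / (2 * pi) \<notin> \<rat>"
    using omega_irrational by auto
  have finite_order: "\<forall>z. f z = 0 \<longrightarrow> finite_order_zero f z"
  proof (intro allI impI)
    fix z assume z: "f z = 0"
    show "finite_order_zero f z"
    proof (cases "even_order_zeros f")
      case True
      then show ?thesis using even_order_zeros_finite_order z by blast
    next
      case False
      then have "real_analytic g" using standing by blast
      have u: "\<bar>1 / a\<bar> < 1" using abs_a by simp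
      \<comment> \<open>If \<open>f\<close> vanished identically, \<open>W\<close> and hence
        \<open>g\<close> would be constant.\<close>
      have "\<exists>p. f p \<noteq> 0"
      proof (rule ccontr)
        assume "\<not> ?thesis"
        then have at_level: "a * b * W (\<theta> + \<omega> - \<omega>) = level" for \<theta>
          using lambda0_eq by (metis eq_iff_diff_eq_0)
        have "a * b \<noteq> 0" using abs_a b_pos by auto
        moreover define w where "w = W 0"
        ultimately have "W \<theta> = w" for \<theta>
          using at_level[of \<theta>] at_level[of 0] mult_left_cancel[of "a * b" "W \<theta>" w] by simp
        then have "g \<theta> = a * w - w" for \<theta>
          using W_props(3)[of \<theta>] by simp
        then show False using g_nonconstant by (auto simp: constant_on_def)
      qed
      then obtain p where p: "f p \<noteq> 0" by blast
      have "real_analytic f"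
        unfolding real_analytic_def
      proof
        fix x0
        obtain e c where e: "0 < e" and c: "\<And>x. \<bar>x - (x0 - \<omega>)\<bar> < e \<Longrightarrow>
            (\<lambda>n. c n * (x - (x0 - \<omega>)) ^ n) sums orbit_sum (1 / a) \<omega> g x"
          using real_analytic_orbit_sum[OF \<open>real_analytic g\<close> g_periodic u, of \<omega>]
          unfolding real_analytic_def by meson
        \<comment> \<open>The factor \<open>a\<close> in \<open>lambda0_eq\<close> cancels the
          division in the definition of \<open>W\<close>, so \<open>f x\<close> is
          \<open>level\<close> minus \<open>b\<close> times the orbit sum at
          \<open>x - \<omega>\<close>; \<open>level\<close> enters the constant term only.\<close>
        define d where "d n = (if n = 0 then level else 0) - b * c n" for n
        have "(\<lambda>n. d n * (x - x0) ^ n) sums f x" if "\<bar>x - x0\<bar> < e" for x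
        proof -
          have "(\<lambda>n. c n * (x - x0) ^ n) sums orbit_sum (1 / a) \<omega> g (x - \<omega>)"
            using c[of "x - \<omega>"] that by simp
          then have "(\<lambda>n. b * (c n * (x - x0) ^ n)) sums (b * orbit_sum (1 / a) \<omega> g (x - \<omega>))"
            by (rule sums_mult)
          moreover have "(\<lambda>n. if n = 0 then level else 0) sums level"
            by (rule sums_single)
          ultimately have "(\<lambda>n. (if n = 0 then level else 0) - b * (c n * (x - x0) ^ n)) sums
              (level - b * orbit_sum (1 / a) \<omega> g (x - \<omega>))"
            by (intro sums_diff)
          moreover have "(if n = 0 then level else 0) - b * (c n * (x - x0) ^ n) = d n * (x - x0) ^ n" for n
            by (simp add: d_def left_diff_distrib)
          moreover have "level - b * orbit_sum (1 / a) \<omega> g (x - \<omega>) = f x"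
            using abs_a by (auto simp: lambda0_eq expanding_solution_def)
          ultimately show ?thesis by simp
        qed
        then show "\<exists>\<epsilon>>0. \<exists>c. \<forall>x. \<bar>x - x0\<bar> < \<epsilon> \<longrightarrow> (\<lambda>n. c n * (x - x0) ^ n) sums f x"
          using e by blast
      qed
      then show ?thesis
        using real_analytic_finite_order_zeros[OF _ lambda0_nonneg p z] by blast
    qed
  qed
  obtain z0 where z0: "f z0 = 0" using zeros by blast
  have lim: "(\<lambda>n. phi i a \<delta> \<omega> g b n \<theta>) \<longlonglongrightarrow> \<phi>_inf \<theta>" for \<theta>
    using phi_limit by blast
  define S where "S = {\<theta>. f (\<theta> + angle) < rate * deviation \<phi>_inf \<theta> \<and>
      rate * deviation \<phi>_inf \<theta> < f (\<theta> + angle) + 2 * \<bar>a\<bar> * \<delta>}"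
  note flat = limit_flat_nonnegligible[OF irrational finite_order z0 lim, folded S_def]
  have zero: "fibre_deriv i a \<delta> \<omega> g b (\<phi>_inf \<theta>) \<theta> = 0" if "\<theta> \<in> S" for \<theta>
    using that fibre_deriv_flat[OF flat(2)] by (simp add: S_def)
  \<comment> \<open>Periodicity of \<open>S\<close> ensures that, being nonnegligible on the line,
    it is so within one period.\<close>
  have inf_per: "\<phi>_inf (\<theta> + 2 * pi) = \<phi>_inf \<theta>" for \<theta>
    using LIMSEQ_unique[OF lim[of "\<theta> + 2 * pi"]] lim[of \<theta>] phi_cont_per by simp
  have "deviation \<phi>_inf (\<theta> + 2 * pi) = deviation \<phi>_inf \<theta>" for \<theta>
    unfolding deviation_def inf_per mu_per ..
  moreover have "f (\<theta> + 2 * pi + angle) = f (\<theta> + angle)" for \<theta>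
    using lambda0_per[unfolded periodic_2pi_def, rule_format, of "\<theta> + angle"] by (simp add: add_ac)
  ultimately have S_per: "\<theta> + 2 * pi \<in> S \<longleftrightarrow> \<theta> \<in> S" for \<theta>
    by (simp add: S_def)
  \<comment> \<open>As a pointwise limit of continuous functions \<open>\<phi>_inf\<close> is Borel,
    and hence so is \<open>S\<close>.\<close>
  have inf_meas [measurable]: "\<phi>_inf \<in> borel_measurable borel"
    by (rule borel_measurable_LIMSEQ_metric[OF borel_measurable_continuous_onI[OF conjunct1[OF phi_cont_per]] lim])
  have [measurable]: "\<mu> \<in> borel_measurable borel"
    by (rule borel_measurable_continuous_onI[OF mu_cont])
  have "continuous_on UNIV (\<lambda>\<theta>. f (\<theta> + angle))"
    by (intro continuous_on_compose2[OF lambda0_cont] continuous_intros) auto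
  then have [measurable]: "(\<lambda>\<theta>. f (\<theta> + angle)) \<in> borel_measurable borel"
    by (rule borel_measurable_continuous_onI)
  have [measurable]: "deviation \<phi>_inf \<in> borel_measurable borel"
    unfolding deviation_def by measurable
  have "S \<in> sets borel" unfolding S_def by measurable
  then have "S \<in> sets lebesgue" by simp
  then have "ereal_integral (lebesgue_on {0..<2 * pi}) (\<lambda>\<theta>. ln_abs (fibre_deriv i a \<delta> \<omega> g b (\<phi>_inf \<theta>) \<theta>)) = - \<infinity>"
    using flat(1) negligible_periodic[OF S_per] zero fibre_deriv_le
    by (intro ereal_integral_ln_abs_minus_infinity) blast+
  then show ?thesis
    unfolding lyapunov_exponent_def by simp
qed

end
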